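(* Let $\mathcal I$ be an ideal on a set $I$ such that the Boolean algebra $\mathcal P(I)/\mathcal I$ is atomless, and let $\kappa$ be an infinite cardinal. (1) Suppose $\mathcal P(I)/\mathcal I$ is not $\kappa$-saturated. Then for every structure $M$ in a countable language, if the theory of the reduced power $M^I/\mathcal I$ is unstable, then $M^I/\mathcal I$ is not $\kappa$-saturated. (2) Suppose that for every $\mathcal I$-positive $A\subseteq I$ the Boolean algebra $\mathcal P(A)/(\mathcal I\restriction A)$ is not $\kappa$-saturated. Then for any structures $M_i$ ($i\in I$) in a common countable language such that the theory of $M=\prod_i M_i/\mathcal I$ is unstable, $M$ is not $\kappa$-saturated.
   Context: A set $A\subseteq I$ is $\mathcal I$-positive if $A\notin\mathcal I$; $\mathcal I\restriction A=\mathcal I\cap\mathcal P(A)$. Reduced product $\prod_i M_i/\mathcal I$: $\prod_iM_i$ modulo $(a_i)\sim(b_i)\iff\{i:a_i\neq b_i\}\in\mathcal I$, functions coordinatewise, relations holding iff they fail only on a set in $\mathcal I$; the reduced power $M^I/\mathcal I$ is the case $M_i=M$ for all $i$. Boolean algebras are considered as structures in the language of Boolean algebras. A structure is $\kappa$-saturated if every consistent set of formulas in one free variable with parameters from a subset of size $<\kappa$ is realised. A complete theory is unstable if some formula $\varphi(\bar x,\bar y)$ has the order property: for every $k$ there are tuples $\bar a_i,\bar b_i$ ($i<k$) in a model with $\varphi(\bar a_i,\bar b_j)$ iff $i\le j$. *)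

theory Defs
  imports Main "HOL-Library.FuncSet" "HOL-Library.Countable_Set"
begin

unbundle cardinal_syntax

section \<open>First-order logic\<close>

record ('f, 'p) language =
  funs :: "'f set"
  rels :: "'p set"
  fun_arity :: "'f \<Rightarrow> nat"
  rel_arity :: "'p \<Rightarrow> nat"

definition countable_language :: "('f, 'p) language \<Rightarrow> bool" where
  "countable_language L \<longleftrightarrow> countable (funs L) \<and> countable (rels L)"

datatype 'f tm = Var nat | Fn 'f "'f tm list"

datatype ('f, 'p) fm =
    Eq "'f tm" "'f tm"
  | Rel 'p "'f tm list"
  | Neg "('f, 'p) fm"
  | And "('f, 'p) fm" "('f, 'p) fm"
  | Ex nat "('f, 'p) fm"

fun wf_tm :: "('f, 'p) language \<Rightarrow> 'f tm \<Rightarrow> bool" where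
  "wf_tm L (Var v) \<longleftrightarrow> True"
| "wf_tm L (Fn f ts) \<longleftrightarrow> f \<in> funs L \<and> length ts = fun_arity L f \<and> (\<forall>t \<in> set ts. wf_tm L t)"

fun wf_fm :: "('f, 'p) language \<Rightarrow> ('f, 'p) fm \<Rightarrow> bool" where
  "wf_fm L (Eq s t) \<longleftrightarrow> wf_tm L s \<and> wf_tm L t"
| "wf_fm L (Rel r ts) \<longleftrightarrow> r \<in> rels L \<and> length ts = rel_arity L r \<and> (\<forall>t \<in> set ts. wf_tm L t)"
| "wf_fm L (Neg \<phi>) \<longleftrightarrow> wf_fm L \<phi>"
| "wf_fm L (And \<phi> \<psi>) \<longleftrightarrow> wf_fm L \<phi> \<and> wf_fm L \<psi>"
| "wf_fm L (Ex v \<phi>) \<longleftrightarrow> wf_fm L \<phi>"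

fun fv_tm :: "'f tm \<Rightarrow> nat set" where
  "fv_tm (Var v) = {v}"
| "fv_tm (Fn f ts) = (\<Union>t \<in> set ts. fv_tm t)"

fun fv :: "('f, 'p) fm \<Rightarrow> nat set" where
  "fv (Eq s t) = fv_tm s \<union> fv_tm t"
| "fv (Rel r ts) = (\<Union>t \<in> set ts. fv_tm t)"
| "fv (Neg \<phi>) = fv \<phi>"
| "fv (And \<phi> \<psi>) = fv \<phi> \<union> fv \<psi>"
| "fv (Ex v \<phi>) = fv \<phi> - {v}"

record ('f, 'p, 'a) fo_struct =
  univ :: "'a set"
  fun_interp :: "'f \<Rightarrow> 'a list \<Rightarrow> 'a"
  rel_interp :: "'p \<Rightarrow> 'a list \<Rightarrow> bool"

definition is_struct :: "('f, 'p) language \<Rightarrow> ('f, 'p, 'a) fo_struct \<Rightarrow> bool" where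
  "is_struct L M \<longleftrightarrow> univ M \<noteq> {} \<and>
     (\<forall>f \<in> funs L. \<forall>as. set as \<subseteq> univ M \<and> length as = fun_arity L f \<longrightarrow> fun_interp M f as \<in> univ M)"

fun eval_tm :: "('f, 'p, 'a) fo_struct \<Rightarrow> (nat \<Rightarrow> 'a) \<Rightarrow> 'f tm \<Rightarrow> 'a" where
  "eval_tm M e (Var v) = e v"
| "eval_tm M e (Fn f ts) = fun_interp M f (map (eval_tm M e) ts)"

fun sat :: "('f, 'p, 'a) fo_struct \<Rightarrow> (nat \<Rightarrow> 'a) \<Rightarrow> ('f, 'p) fm \<Rightarrow> bool" where
  "sat M e (Eq s t) \<longleftrightarrow> eval_tm M e s = eval_tm M e t"
| "sat M e (Rel r ts) \<longleftrightarrow> rel_interp M r (map (eval_tm M e) ts)"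
| "sat M e (Neg \<phi>) \<longleftrightarrow> \<not> sat M e \<phi>"
| "sat M e (And \<phi> \<psi>) \<longleftrightarrow> sat M e \<phi> \<and> sat M e \<psi>"
| "sat M e (Ex v \<phi>) \<longleftrightarrow> (\<exists>a \<in> univ M. sat M (e(v := a)) \<phi>)"

section \<open>Theories, instability, saturation\<close>

definition sentences :: "('f, 'p) language \<Rightarrow> ('f, 'p) fm set" where
  "sentences L = {\<phi>. wf_fm L \<phi> \<and> fv \<phi> = {}}"

definition true_in :: "('f, 'p, 'a) fo_struct \<Rightarrow> ('f, 'p) fm \<Rightarrow> bool" where
  "true_in M \<phi> \<longleftrightarrow> (\<forall>e. range e \<subseteq> univ M \<longrightarrow> sat M e \<phi>)"

definition theory_of :: "('f, 'p) language \<Rightarrow> ('f, 'p, 'a) fo_struct \<Rightarrow> ('f, 'p) fm set" where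
  "theory_of L M = {\<phi> \<in> sentences L. true_in M \<phi>}"

definition is_model :: "('f, 'p) language \<Rightarrow> ('f, 'p) fm set \<Rightarrow> ('f, 'p, 'a) fo_struct \<Rightarrow> bool" where
  "is_model L T N \<longleftrightarrow> is_struct L N \<and> (\<forall>\<phi> \<in> T. true_in N \<phi>)"

text \<open>
  In \<open>\<phi>(x, y)\<close> the tuple \<open>x\<close> consists of the variables \<open>0, \<dots>, m - 1\<close> and \<open>y\<close> of
  \<open>m, \<dots>, m + n - 1\<close>. A definition cannot quantify over types, so the type \<open>'u\<close> over which the
  models are formed is a parameter; theorems are to be stated for an arbitrary \<open>'u\<close>.
\<close>

definition order_property ::
    "'u itself \<Rightarrow> ('f, 'p) language \<Rightarrow> ('f, 'p) fm set \<Rightarrow> nat \<Rightarrow> nat \<Rightarrow> ('f, 'p) fm \<Rightarrow> bool" where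
  "order_property (_ :: 'u itself) L T m n \<phi> \<longleftrightarrow>
     (\<forall>k::nat. \<exists>(N :: ('f, 'p, 'u) fo_struct) (a :: nat \<Rightarrow> 'u list) (b :: nat \<Rightarrow> 'u list).
        is_model L T N \<and>
        (\<forall>i<k. length (a i) = m \<and> set (a i) \<subseteq> univ N \<and> length (b i) = n \<and> set (b i) \<subseteq> univ N) \<and>
        (\<forall>i<k. \<forall>j<k. sat N (\<lambda>v. (a i @ b j) ! v) \<phi> \<longleftrightarrow> i \<le> j))"

definition unstable ::
    "'u itself \<Rightarrow> ('f, 'p) language \<Rightarrow> ('f, 'p) fm set \<Rightarrow> bool" where
  "unstable U L T \<longleftrightarrow>
     (\<exists>\<phi> m n. wf_fm L \<phi> \<and> fv \<phi> \<subseteq> {..<m + n} \<and> order_property U L T m n \<phi>)"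

text \<open>
  A formula in the single free variable \<open>0\<close> with parameters from \<open>A\<close> is a pair \<open>(\<phi>, e)\<close>, where \<open>e\<close>
  assigns an element of \<open>A\<close> to each other free variable of \<open>\<phi>\<close>. Consistency of a set of such
  formulas means finite satisfiability in the structure.
\<close>

definition param_formulas ::
    "('f, 'p) language \<Rightarrow> 'a set \<Rightarrow> (('f, 'p) fm \<times> (nat \<Rightarrow> 'a)) set" where
  "param_formulas L A = {(\<phi>, e). wf_fm L \<phi> \<and> (\<forall>v \<in> fv \<phi> - {0}. e v \<in> A)}"

definition realised ::
    "('f, 'p, 'a) fo_struct \<Rightarrow> (('f, 'p) fm \<times> (nat \<Rightarrow> 'a)) set \<Rightarrow> bool" where
  "realised M p \<longleftrightarrow> (\<exists>a \<in> univ M. \<forall>(\<phi>, e) \<in> p. sat M (e(0 := a)) \<phi>)"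

definition consistent ::
    "('f, 'p, 'a) fo_struct \<Rightarrow> (('f, 'p) fm \<times> (nat \<Rightarrow> 'a)) set \<Rightarrow> bool" where
  "consistent M p \<longleftrightarrow> (\<forall>q \<subseteq> p. finite q \<longrightarrow> realised M q)"

definition saturated :: "'k rel \<Rightarrow> ('f, 'p) language \<Rightarrow> ('f, 'p, 'a) fo_struct \<Rightarrow> bool" where
  "saturated \<kappa> L M \<longleftrightarrow>
     (\<forall>A \<subseteq> univ M. |A| <o \<kappa> \<longrightarrow>
        (\<forall>p \<subseteq> param_formulas L A. consistent M p \<longrightarrow> realised M p))"

section \<open>Ideals and reduced products\<close>

definition ideal_on :: "'i set \<Rightarrow> 'i set set \<Rightarrow> bool" where
  "ideal_on I J \<longleftrightarrow> J \<subseteq> Pow I \<and> {} \<in> J \<and>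
     (\<forall>A \<in> J. \<forall>B \<subseteq> A. B \<in> J) \<and> (\<forall>A \<in> J. \<forall>B \<in> J. A \<union> B \<in> J)"

definition positive_sets :: "'i set \<Rightarrow> 'i set set \<Rightarrow> 'i set set" where
  "positive_sets I J = {A. A \<subseteq> I \<and> A \<notin> J}"

definition restrict_ideal :: "'i set set \<Rightarrow> 'i set \<Rightarrow> 'i set set" where
  "restrict_ideal J A = J \<inter> Pow A"

definition product_univ :: "'i set \<Rightarrow> ('i \<Rightarrow> ('f, 'p, 'a) fo_struct) \<Rightarrow> ('i \<Rightarrow> 'a) set" where
  "product_univ I M = (\<Pi>\<^sub>E i \<in> I. univ (M i))"

definition reduced_rel ::
    "'i set \<Rightarrow> 'i set set \<Rightarrow> ('i \<Rightarrow> ('f, 'p, 'a) fo_struct) \<Rightarrow> ('i \<Rightarrow> 'a) rel" where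
  "reduced_rel I J M =
     {(a, b). a \<in> product_univ I M \<and> b \<in> product_univ I M \<and> {i \<in> I. a i \<noteq> b i} \<in> J}"

text \<open>
  The arguments of an operation on a quotient are equivalence classes \<open>Xs\<close>, and \<open>as\<close> runs over
  the lists of representatives. For an ideal \<open>J\<close> the value does not depend on \<open>as\<close>: the union
  below is over equal classes, and the existential quantifier is equivalent to the universal one.
\<close>

definition reduced_product ::
    "'i set \<Rightarrow> 'i set set \<Rightarrow> ('i \<Rightarrow> ('f, 'p, 'a) fo_struct) \<Rightarrow> ('f, 'p, ('i \<Rightarrow> 'a) set) fo_struct" where
  "reduced_product I J M =
     \<lparr> univ = product_univ I M // reduced_rel I J M,
       fun_interp = (\<lambda>f Xs. \<Union>as \<in> listset Xs.
          reduced_rel I J M `` {\<lambda>i \<in> I. fun_interp (M i) f (map (\<lambda>a. a i) as)}),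
       rel_interp = (\<lambda>r Xs. \<exists>as \<in> listset Xs.
          {i \<in> I. \<not> rel_interp (M i) r (map (\<lambda>a. a i) as)} \<in> J) \<rparr>"

definition reduced_power ::
    "'i set \<Rightarrow> 'i set set \<Rightarrow> ('f, 'p, 'a) fo_struct \<Rightarrow> ('f, 'p, ('i \<Rightarrow> 'a) set) fo_struct" where
  "reduced_power I J M = reduced_product I J (\<lambda>_. M)"

section \<open>Quotients of power set algebras\<close>

datatype ba_fun = Zero | One | Compl | Meet | Join

text \<open>The language of Boolean algebras has no relation symbols.\<close>

definition ba_language :: "(ba_fun, unit) language" where
  "ba_language =
     \<lparr> funs = UNIV, rels = {},
       fun_arity = (\<lambda>f. case f of Zero \<Rightarrow> 0 | One \<Rightarrow> 0 | Compl \<Rightarrow> 1 | Meet \<Rightarrow> 2 | Join \<Rightarrow> 2),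
       rel_arity = (\<lambda>_. 0) \<rparr>"

definition ideal_rel :: "'i set \<Rightarrow> 'i set set \<Rightarrow> 'i set rel" where
  "ideal_rel I J = {(A, B). A \<subseteq> I \<and> B \<subseteq> I \<and> (A - B) \<union> (B - A) \<in> J}"

text \<open>The operations of the power set algebra of \<open>I\<close>; lists of the wrong length are irrelevant.\<close>

fun pow_op :: "'i set \<Rightarrow> ba_fun \<Rightarrow> 'i set list \<Rightarrow> 'i set" where
  "pow_op I Zero [] = {}"
| "pow_op I One [] = I"
| "pow_op I Compl [A] = I - A"
| "pow_op I Meet [A, B] = A \<inter> B"
| "pow_op I Join [A, B] = A \<union> B"
| "pow_op I _ _ = {}"

definition pow_quotient :: "'i set \<Rightarrow> 'i set set \<Rightarrow> (ba_fun, unit, 'i set set) fo_struct" where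
  "pow_quotient I J =
     \<lparr> univ = Pow I // ideal_rel I J,
       fun_interp = (\<lambda>f Xs. \<Union>As \<in> listset Xs. ideal_rel I J `` {pow_op I f As}),
       rel_interp = (\<lambda>_ _. False) \<rparr>"

definition ba_le :: "(ba_fun, unit, 'a) fo_struct \<Rightarrow> 'a \<Rightarrow> 'a \<Rightarrow> bool" where
  "ba_le B x y \<longleftrightarrow> fun_interp B Meet [x, y] = x"

definition ba_atom :: "(ba_fun, unit, 'a) fo_struct \<Rightarrow> 'a \<Rightarrow> bool" where
  "ba_atom B x \<longleftrightarrow> x \<in> univ B \<and> x \<noteq> fun_interp B Zero [] \<and>
     (\<forall>y \<in> univ B. ba_le B y x \<longrightarrow> y = fun_interp B Zero [] \<or> y = x)"

definition atomless :: "(ba_fun, unit, 'a) fo_struct \<Rightarrow> bool" where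
  "atomless B \<longleftrightarrow> \<not> (\<exists>x. ba_atom B x)"

end

theory Submission
  imports Defs "HOL-Library.Nat_Bijection" "HOL-Library.Ramsey"
begin

text \<open>
  Call a formula an h-formula if it is built from atomic formulas by conjunction, \<open>\<exists>\<close> and
  \<open>(\<exists>v. \<theta>) \<and> (\<forall>v. \<theta> \<longrightarrow> \<eta>)\<close> (Palyutin). An h-formula holds in a reduced product iff it holds in almost all
  coordinates, and since \<open>P(I)/J\<close> is atomless, the truth of any formula is determined by finitely many
  h-formulas. If all of these were normal, i.e. if \<open>\<eta>(a, b)\<close>, \<open>\<eta>(a, b')\<close>, \<open>\<eta>(a', b)\<close> always implied
  \<open>\<eta>(a', b')\<close>, then Ramsey's theorem would refute the order property. A failure of normality yields an
  h-definable preorder with \<open>a' \<le> a\<close> everywhere and \<open>a \<not>\<le> a'\<close> on the positive set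
  \<open>A = {i. \<not> \<eta>(a' i, b' i)}\<close>; for a reduced power one coordinate and constant sequences give \<open>A = I\<close>.
  Coding \<open>Z \<subseteq> A\<close> by the tuple that is \<open>a\<close> on \<open>Z\<close> and \<open>a'\<close> off \<open>Z\<close>, saturation of the reduced product
  provides, for families of fewer than \<open>\<kappa>\<close> elements of \<open>P(A)/J\<close>, nonzero lower bounds of centred families
  and separation of orthogonal families. The tuples realising these types need not code subsets of \<open>A\<close>,
  so splitting elements are not obtained directly; but the two properties give disjoint refinements of
  small families of nonzero elements, hence splitting, and by quantifier elimination for atomless Boolean
  algebras \<open>P(A)/J\<close> is \<open>\<kappa>\<close>-saturated.
\<close>

section \<open>First-order formulas\<close>

text \<open>What has to be circumvented is that negation does not pass to reduced products: denying
  an almost-everywhere statement says only that it fails on a positive set. The conjunct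
  \<open>\<exists>v. \<theta>\<close> in \<open>himp\<close> answers this, as it supplies a default
  solution around which coordinatewise counterexamples are glued to a global one. The preorder
  compares the sets \<open>Y(s)\<close> of common solutions of \<open>\<eta>\<close> for the base
  tuple \<alpha> and for \<open>s\<close>. Because the base tuple cuts down every
  \<open>Y(s)\<close>, each \<open>s\<close> with \<open>Y(s)\<close> nonempty lies below \<alpha>.
  Nonemptiness is demanded in order that inclusion become an h-formula; \<beta> provides it for
  \<alpha> and \<alpha>', while \<beta>' is a member of \<open>Y(\<alpha>)\<close> missing from
  \<open>Y(\<alpha>')\<close> on the positive set. From an arbitrary realisation \<open>x\<close>
  two sets can still be read off: the coordinates where \<open>x\<close> is not below \<alpha>', and
  those where \<alpha> is below \<open>x\<close>. The former yields lower bounds, the latter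
  separators.\<close>

lemma eval_tm_cong: "(\<And>v. v \<in> fv_tm t \<Longrightarrow> e v = e' v) \<Longrightarrow> eval_tm M e t = eval_tm M e' t"
proof (induction t)
  case (Fn f ts)
  then have "map (eval_tm M e) ts = map (eval_tm M e') ts"
    by (intro map_cong refl Fn.IH) auto
  then show ?case by (simp only: eval_tm.simps)
qed simp

lemma eval_tm_list_cong:
  "(\<And>v. v \<in> (\<Union>t \<in> set ts. fv_tm t) \<Longrightarrow> e v = e' v) \<Longrightarrow> map (eval_tm M e) ts = map (eval_tm M e') ts"
  by (intro map_cong refl eval_tm_cong) auto

lemma sat_cong: "(\<And>v. v \<in> fv \<phi> \<Longrightarrow> e v = e' v) \<Longrightarrow> sat M e \<phi> \<longleftrightarrow> sat M e' \<phi>"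
proof (induction \<phi> arbitrary: e e')
  case (Eq s t)
  have "eval_tm M e s = eval_tm M e' s" "eval_tm M e t = eval_tm M e' t"
    by (rule eval_tm_cong; rule Eq.prems; simp)+
  then show ?case by simp
next
  case (Rel r ts)
  then have "map (eval_tm M e) ts = map (eval_tm M e') ts"
    by (intro eval_tm_list_cong) auto
  then show ?case by (simp only: sat.simps)
next
  case (And \<phi> \<psi>)
  have "sat M e \<phi> = sat M e' \<phi>" "sat M e \<psi> = sat M e' \<psi>"
    by (rule And.IH; rule And.prems; simp)+
  then show ?case by simp
next
  case (Ex v \<phi>)
  have "sat M (e(v := a)) \<phi> = sat M (e'(v := a)) \<phi>" for a
    using Ex.prems by (intro Ex.IH) auto
  then show ?case by simp
next
  case (Neg \<phi>)
  have "sat M e \<phi> = sat M e' \<phi>"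
    by (rule Neg.IH; rule Neg.prems; simp)
  then show ?case by simp
qed

lemma finite_fv_tm: "finite (fv_tm t)"
  by (induction t) auto

lemma finite_fv: "finite (fv \<phi>)"
  by (induction \<phi>) (auto simp: finite_fv_tm)

section \<open>Renaming of variables, finite conjunctions and blocks of quantifiers\<close>

fun ren_tm :: "(nat \<Rightarrow> nat) \<Rightarrow> 'f tm \<Rightarrow> 'f tm" where
  "ren_tm \<pi> (Var v) = Var (\<pi> v)"
| "ren_tm \<pi> (Fn f ts) = Fn f (map (ren_tm \<pi>) ts)"

text \<open>Bound variables are renamed too. For injective \<open>\<pi>\<close> no capture can
  happen, so that tuples can be moved freely to blocks of variables coded by
  \<open>prod_encode\<close>.\<close>

fun ren :: "(nat \<Rightarrow> nat) \<Rightarrow> ('f, 'p) fm \<Rightarrow> ('f, 'p) fm" where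
  "ren \<pi> (Eq s t) = Eq (ren_tm \<pi> s) (ren_tm \<pi> t)"
| "ren \<pi> (Rel r ts) = Rel r (map (ren_tm \<pi>) ts)"
| "ren \<pi> (Neg \<phi>) = Neg (ren \<pi> \<phi>)"
| "ren \<pi> (And \<phi> \<psi>) = And (ren \<pi> \<phi>) (ren \<pi> \<psi>)"
| "ren \<pi> (Ex v \<phi>) = Ex (\<pi> v) (ren \<pi> \<phi>)"

lemma eval_ren_tm: "eval_tm M e (ren_tm \<pi> t) = eval_tm M (\<lambda>v. e (\<pi> v)) t"
proof (induction t)
  case (Fn f ts)
  then have "map (eval_tm M e) (map (ren_tm \<pi>) ts) = map (eval_tm M (\<lambda>v. e (\<pi> v))) ts"
    by simp
  then show ?case by (simp only: eval_tm.simps ren_tm.simps)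
qed simp

lemma sat_ren: "inj \<pi> \<Longrightarrow> sat M e (ren \<pi> \<phi>) \<longleftrightarrow> sat M (\<lambda>v. e (\<pi> v)) \<phi>"
proof (induction \<phi> arbitrary: e)
  case (Rel r ts)
  have "map (eval_tm M e) (map (ren_tm \<pi>) ts) = map (eval_tm M (\<lambda>v. e (\<pi> v))) ts"
    by (simp add: eval_ren_tm)
  then show ?case by (simp only: sat.simps ren.simps)
next
  case (Ex v \<phi>)
  have "(\<lambda>w. (e(\<pi> v := a)) (\<pi> w)) = (\<lambda>w. e (\<pi> w))(v := a)" for a
    using Ex.prems by (auto simp: fun_eq_iff inj_eq)
  then show ?case using Ex by simp
qed (auto simp: eval_ren_tm)

lemma fv_ren_tm: "fv_tm (ren_tm \<pi> t) = \<pi> ` fv_tm t"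
  by (induction t) auto

lemma fv_ren: "inj \<pi> \<Longrightarrow> fv (ren \<pi> \<phi>) = \<pi> ` fv \<phi>"
  by (induction \<phi>) (auto simp: fv_ren_tm image_Un image_UN inj_eq)

lemma wf_ren_tm: "wf_tm L (ren_tm \<pi> t) \<longleftrightarrow> wf_tm L t"
  by (induction t) auto

lemma wf_ren: "wf_fm L (ren \<pi> \<phi>) \<longleftrightarrow> wf_fm L \<phi>"
  by (induction \<phi>) (auto simp: wf_ren_tm)

text \<open>There is no formula for truth, so the list ends in a given \<open>\<chi>\<close>. In its
  uses \<open>\<chi>\<close> is an equation of a variable with itself, or the existential closure of
  one.\<close>

fun conj :: "('f, 'p) fm list \<Rightarrow> ('f, 'p) fm \<Rightarrow> ('f, 'p) fm" where
  "conj [] \<chi> = \<chi>"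
| "conj (\<phi> # \<phi>s) \<chi> = And \<phi> (conj \<phi>s \<chi>)"

lemma sat_conj: "sat M e (conj \<phi>s \<chi>) \<longleftrightarrow> (\<forall>\<phi> \<in> set \<phi>s. sat M e \<phi>) \<and> sat M e \<chi>"
  by (induction \<phi>s) auto

lemma fv_conj: "fv (conj \<phi>s \<chi>) = (\<Union>\<phi> \<in> set \<phi>s. fv \<phi>) \<union> fv \<chi>"
  by (induction \<phi>s) auto

lemma wf_conj: "wf_fm L (conj \<phi>s \<chi>) \<longleftrightarrow> (\<forall>\<phi> \<in> set \<phi>s. wf_fm L \<phi>) \<and> wf_fm L \<chi>"
  by (induction \<phi>s) auto

definition exs :: "nat list \<Rightarrow> ('f, 'p) fm \<Rightarrow> ('f, 'p) fm" where
  "exs vs \<phi> = foldr Ex vs \<phi>"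

lemma exs_simps [simp]: "exs [] \<phi> = \<phi>" "exs (v # vs) \<phi> = Ex v (exs vs \<phi>)"
  by (simp_all add: exs_def)

lemma fv_exs: "fv (exs vs \<phi>) = fv \<phi> - set vs"
  by (induction vs) auto

lemma wf_exs: "wf_fm L (exs vs \<phi>) \<longleftrightarrow> wf_fm L \<phi>"
  by (induction vs) auto

lemma upd_override_on: "v \<notin> set vs \<Longrightarrow> override_on (e(v := a)) f (set vs) = override_on e (f(v := a)) (set (v # vs))"
  by (auto simp: override_on_def fun_eq_iff)

lemma sat_exs:
  "distinct vs \<Longrightarrow> sat M e (exs vs \<phi>) \<longleftrightarrow>
     (\<exists>f. f ` set vs \<subseteq> univ M \<and> sat M (override_on e f (set vs)) \<phi>)"
proof (induction vs arbitrary: e)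
  case (Cons v vs)
  then have v: "v \<notin> set vs" by simp
  show ?case
  proof
    assume "sat M e (exs (v # vs) \<phi>)"
    then obtain a f where "a \<in> univ M" "f ` set vs \<subseteq> univ M" "sat M (override_on (e(v := a)) f (set vs)) \<phi>"
      using Cons by (auto simp del: fun_upd_apply)
    with v show "\<exists>f. f ` set (v # vs) \<subseteq> univ M \<and> sat M (override_on e f (set (v # vs))) \<phi>"
      by (intro exI[of _ "f(v := a)"]) (auto simp: upd_override_on)
  next
    assume "\<exists>f. f ` set (v # vs) \<subseteq> univ M \<and> sat M (override_on e f (set (v # vs))) \<phi>"
    then obtain f where f: "f ` set (v # vs) \<subseteq> univ M" "sat M (override_on e f (set (v # vs))) \<phi>"
      by blast
    have "f(v := f v) = f" by simp
    with f upd_override_on[OF v, of e "f v" f] have "sat M (override_on (e(v := f v)) f (set vs)) \<phi>"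
      by metis
    with f Cons show "sat M e (exs (v # vs) \<phi>)" by auto
  qed
qed simp

section \<open>Saturation for tuples\<close>

lemma Card_order_finite_ordLess:
  assumes "Card_order \<kappa>" "infinite (Field \<kappa>)" "finite A"
  shows "|A| <o \<kappa>"
  using assms finite_ordLess_infinite[of "|A|" \<kappa>] card_of_Well_order
  by (auto simp: card_order_on_def Field_card_of)

lemma insert_ordLess:
  assumes "Card_order \<kappa>" "infinite (Field \<kappa>)" "|A| <o \<kappa>"
  shows "|insert a A| <o \<kappa>"
  using card_of_Un_ordLess_infinite_Field[OF assms(2,1) Card_order_finite_ordLess[OF assms(1,2), of "{a}"] assms(3)]
  by simp

definition realised_on ::
    "('f, 'p, 'a) fo_struct \<Rightarrow> nat set \<Rightarrow> (('f, 'p) fm \<times> (nat \<Rightarrow> 'a)) set \<Rightarrow> bool" where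
  "realised_on M V p \<longleftrightarrow> (\<exists>f. f ` V \<subseteq> univ M \<and> (\<forall>(\<phi>, e) \<in> p. sat M (override_on e f V) \<phi>))"

text \<open>Saturation speaks of one variable, so a tuple is found one coordinate at a time: for
  \<open>x\<close> one realises the type saying that every finite part of \<open>p\<close> is
  solvable in the remaining variables, and the element found becomes a parameter. The difficulty is
  that each formula carries its own assignment; before formulas enter one conjunction, their
  parameter variables must be made disjoint.\<close>

lemma saturated_realised_on:
  fixes M :: "('f, 'p, 'a) fo_struct"
  assumes \<kappa>: "Card_order \<kappa>" "infinite (Field \<kappa>)" and M: "saturated \<kappa> L M"
    and "finite V" "A \<subseteq> univ M" "|A| <o \<kappa>"
    and "\<And>\<phi> e. (\<phi>, e) \<in> p \<Longrightarrow> wf_fm L \<phi> \<and> (\<forall>v \<in> fv \<phi> - V. e v \<in> A)"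
    and "\<And>q. q \<subseteq> p \<Longrightarrow> finite q \<Longrightarrow> realised_on M V q"
  shows "realised_on M V p"
  using assms(4-)
proof (induction V arbitrary: A p rule: finite_induct)
  case empty
  have "sat M e \<phi>" if "(\<phi>, e) \<in> p" for \<phi> e
    using empty.prems(4)[of "{(\<phi>, e)}"] that by (auto simp: realised_on_def)
  then show ?case by (auto simp: realised_on_def)
next
  case (insert x V)
  \<comment> \<open>Variable 0 is reserved for \<open>x\<close>. Behind the outer
    \<open>Suc\<close>, block 0 is shared by all formulas and holds the variables of
    \<open>V\<close>, whereas block \<open>Suc j\<close> holds the parameters of the
    \<open>j\<close>-th formula alone.\<close>
  define \<pi> where "\<pi> j v = (if v = x then 0 else
      if v \<in> V then Suc (prod_encode (0, v)) else Suc (prod_encode (Suc j, v)))" for j v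
  have inj: "inj (\<pi> j)" for j
    by (auto simp: \<pi>_def inj_def split: if_splits)
  define vs where "vs = map (\<lambda>v. Suc (prod_encode (0, v))) (sorted_list_of_set V)"
  have vs: "set vs = (\<lambda>v. Suc (prod_encode (0, v))) ` V" "distinct vs"
    using insert.hyps by (auto simp: vs_def distinct_map inj_on_def)
  define \<chi> where "\<chi> qs = exs vs (conj (map (\<lambda>j. ren (\<pi> j) (fst (qs ! j))) [0..<length qs]) (Eq (Var 0) (Var 0)))"
    for qs :: "(('f, 'p) fm \<times> (nat \<Rightarrow> 'a)) list"
  \<comment> \<open>This inverts the coding: \<open>w - 1\<close> undoes the outer
    \<open>Suc\<close>, \<open>j - 1\<close> that of the block number. Block 0 is bound in
    \<open>\<chi> qs\<close>, so the values there do not matter.\<close>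
  define E where "E qs w = (let (j, v) = prod_decode (w - 1) in snd (qs ! (j - 1)) v)"
    for qs :: "(('f, 'p) fm \<times> (nat \<Rightarrow> 'a)) list" and w
  have sat_\<chi>: "sat M ((E qs)(0 := a)) (\<chi> qs) \<longleftrightarrow>
      (\<exists>f. f ` V \<subseteq> univ M \<and> (\<forall>(\<phi>, e) \<in> set qs. sat M (override_on e (f(x := a)) (insert x V)) \<phi>))"
    (is "?L \<longleftrightarrow> ?R") for qs a
  proof -
    have 1: "sat M (override_on ((E qs)(0 := a)) f (set vs)) (ren (\<pi> j) (fst (qs ! j))) \<longleftrightarrow>
      sat M (override_on (snd (qs ! j)) ((\<lambda>v. f (Suc (prod_encode (0, v))))(x := a)) (insert x V)) (fst (qs ! j))"
      if "j < length qs" for j f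
    proof -
      have *: "(\<lambda>v. override_on ((E qs)(0 := a)) f (set vs) (\<pi> j v)) =
         override_on (snd (qs ! j)) ((\<lambda>v. f (Suc (prod_encode (0, v))))(x := a)) (insert x V)"
        using insert.hyps by (auto simp: fun_eq_iff override_on_def vs \<pi>_def E_def)
      show ?thesis by (simp add: sat_ren[OF inj] *)
    qed
    have 2: "?L \<longleftrightarrow> (\<exists>f. f ` set vs \<subseteq> univ M \<and>
       (\<forall>j < length qs. sat M (override_on (snd (qs ! j)) ((\<lambda>v. f (Suc (prod_encode (0, v))))(x := a)) (insert x V)) (fst (qs ! j))))"
      unfolding \<chi>_def sat_exs[OF vs(2)] sat_conj
      by (intro arg_cong[of _ _ HOL.Ex] ext conj_cong refl) (auto simp: 1)
    have 3: "(\<forall>(\<phi>, e) \<in> set qs. sat M (override_on e g (insert x V)) \<phi>) \<longleftrightarrow>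
       (\<forall>j < length qs. sat M (override_on (snd (qs ! j)) g (insert x V)) (fst (qs ! j)))" for g
      by (simp only: all_set_conv_all_nth case_prod_beta)
    show ?thesis
    proof
      assume ?L
      then obtain f where "f ` set vs \<subseteq> univ M"
       "(\<forall>j < length qs. sat M (override_on (snd (qs ! j)) ((\<lambda>v. f (Suc (prod_encode (0, v))))(x := a)) (insert x V)) (fst (qs ! j)))"
        unfolding 2 by blast
      then show ?R unfolding 3 vs
        by (intro exI[of _ "\<lambda>v. f (Suc (prod_encode (0, v)))"]) auto
    next
      assume ?R
      then obtain f where "f ` V \<subseteq> univ M"
       "\<forall>j < length qs. sat M (override_on (snd (qs ! j)) (f(x := a)) (insert x V)) (fst (qs ! j))"
        unfolding 3 by blast
      then show ?L unfolding 2 vs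
        by (intro exI[of _ "\<lambda>w. f (snd (prod_decode (w - 1)))"]) auto
    qed
  qed
  have wf: "wf_fm L (\<chi> qs)" if "set qs \<subseteq> p" for qs
  proof -
    have "wf_fm L (fst (qs ! j))" if "j < length qs" for j
      using insert.prems(3)[of "fst (qs ! j)" "snd (qs ! j)"] nth_mem[OF that] \<open>set qs \<subseteq> p\<close> by auto
    then show ?thesis by (auto simp: \<chi>_def wf_exs wf_conj wf_ren)
  qed
  have par: "E qs w \<in> A" if "set qs \<subseteq> p" "w \<in> fv (\<chi> qs) - {0}" for qs w
  proof -
    from that obtain j v where j: "j < length qs" "v \<in> fv (fst (qs ! j))" "w = \<pi> j v" "w \<notin> set vs"
      by (auto simp: \<chi>_def fv_exs fv_conj fv_ren[OF inj])
    have "v \<notin> insert x V" using j that(2) by (auto simp: \<pi>_def vs split: if_splits)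
    moreover have "qs ! j \<in> p" using j that(1) by auto
    ultimately have "snd (qs ! j) v \<in> A"
      using insert.prems(3)[of "fst (qs ! j)" "snd (qs ! j)"] j by simp
    moreover have "E qs w = snd (qs ! j) v"
      using j \<open>v \<notin> insert x V\<close> by (auto simp: E_def \<pi>_def)
    ultimately show ?thesis by simp
  qed
  \<comment> \<open>All lists over \<open>p\<close> are used at once. Finitely many lists have a
    finite union, so consistency of \<open>p1\<close> reduces to finite solvability of
    \<open>p\<close>.\<close>
  define p1 where "p1 = (\<lambda>qs. (\<chi> qs, E qs)) ` {qs. set qs \<subseteq> p}"
  have "p1 \<subseteq> param_formulas L A"
    unfolding p1_def param_formulas_def using wf par by blast
  moreover have "consistent M p1"
    unfolding consistent_def
  proof (intro allI impI)
    fix q assume "q \<subseteq> p1" "finite q"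
    then obtain Q where Q: "Q \<subseteq> {qs. set qs \<subseteq> p}" "finite Q" "q = (\<lambda>qs. (\<chi> qs, E qs)) ` Q"
      unfolding p1_def by (meson finite_subset_image)
    have "realised_on M (insert x V) (\<Union>qs \<in> Q. set qs)"
      using Q by (intro insert.prems(4)) auto
    then obtain f where f: "f ` insert x V \<subseteq> univ M"
      "\<And>\<phi> e qs. qs \<in> Q \<Longrightarrow> (\<phi>, e) \<in> set qs \<Longrightarrow> sat M (override_on e f (insert x V)) \<phi>"
      unfolding realised_on_def by fast
    have "sat M ((E qs)(0 := f x)) (\<chi> qs)" if "qs \<in> Q" for qs
      unfolding sat_\<chi> using f that by (intro exI[of _ f]) auto
    then show "realised M q"
      unfolding realised_def Q using f by (intro bexI[of _ "f x"]) auto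
  qed
  ultimately have "realised M p1"
    using M insert.prems(1,2) by (auto simp: saturated_def)
  then obtain a where a: "a \<in> univ M" "\<And>qs. set qs \<subseteq> p \<Longrightarrow> sat M ((E qs)(0 := a)) (\<chi> qs)"
    by (auto simp: realised_def p1_def)
  \<comment> \<open>Fixing \<open>x\<close> as \<open>a\<close> preserves finite solvability,
    because any finite part of \<open>p\<close> is the set of a list covered by
    \<open>p1\<close>.\<close>
  define p' where "p' = (\<lambda>(\<phi>, e). (\<phi>, e(x := a))) ` p"
  have ov: "override_on (e(x := a)) f V = override_on e (f(x := a)) (insert x V)" for e f
    using insert.hyps by (auto simp: override_on_def fun_eq_iff)
  have "realised_on M V p'"
  proof (rule insert.IH)
    show "insert a A \<subseteq> univ M" using a insert.prems by simp
    show "|insert a A| <o \<kappa>" by (rule insert_ordLess[OF \<kappa> insert.prems(2)])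
    show "wf_fm L \<phi> \<and> (\<forall>v \<in> fv \<phi> - V. e v \<in> insert a A)" if pe: "(\<phi>, e) \<in> p'" for \<phi> e
    proof -
      obtain e' where "(\<phi>, e') \<in> p" "e = e'(x := a)" using pe unfolding p'_def by auto
      then show ?thesis using insert.prems(3)[of \<phi> e'] by auto
    qed
    fix q assume "q \<subseteq> p'" "finite q"
    then obtain q0 where q0: "q0 \<subseteq> p" "finite q0" "q = (\<lambda>(\<phi>, e). (\<phi>, e(x := a))) ` q0"
      unfolding p'_def by (meson finite_subset_image)
    then obtain qs where "set qs = q0" using finite_list by blast
    then obtain f where "f ` V \<subseteq> univ M" "\<forall>(\<phi>, e) \<in> q0. sat M (override_on e (f(x := a)) (insert x V)) \<phi>"
      using a(2)[of qs] q0(1) unfolding sat_\<chi> by blast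
    then show "realised_on M V q"
      unfolding realised_on_def q0(3) by (intro exI[of _ f]) (auto simp: ov[symmetric] simp del: fun_upd_apply)
  qed
  then obtain f where f: "f ` V \<subseteq> univ M" "\<forall>(\<phi>, e) \<in> p'. sat M (override_on e f V) \<phi>"
    unfolding realised_on_def by blast
  have f': "\<forall>(\<phi>, e) \<in> p. sat M (override_on e (f(x := a)) (insert x V)) \<phi>"
  proof clarify
    fix \<phi> e assume "(\<phi>, e) \<in> p"
    then have "(\<phi>, e(x := a)) \<in> p'" unfolding p'_def by (rule rev_image_eqI) simp
    then show "sat M (override_on e (f(x := a)) (insert x V)) \<phi>"
      using f(2) unfolding ov[symmetric] by blast
  qed
  have "(f(x := a)) ` insert x V \<subseteq> univ M" using f(1) a(1) by auto
  with f' show ?case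
    unfolding realised_on_def by (intro exI[of _ "f(x := a)"] conjI)
qed

section \<open>Ideals of sets\<close>

lemma ideal_onD:
  assumes "ideal_on I J"
  shows "{} \<in> J" "\<And>X Y. X \<in> J \<Longrightarrow> Y \<subseteq> X \<Longrightarrow> Y \<in> J"
    "\<And>X Y. X \<in> J \<Longrightarrow> Y \<in> J \<Longrightarrow> X \<union> Y \<in> J" "\<And>X. X \<in> J \<Longrightarrow> X \<subseteq> I"
  using assms unfolding ideal_on_def by blast+

lemma ideal_subset_Un:
  assumes "ideal_on I J" "X \<in> J" "Y \<in> J" "Z \<subseteq> X \<union> Y"
  shows "Z \<in> J"
  using ideal_onD[OF assms(1)] assms by blast

lemma ideal_finite_Union:
  assumes "ideal_on I J" "finite F" "F \<subseteq> J"
  shows "\<Union>F \<in> J"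
  using assms(2,3) by (induction F) (auto intro: ideal_onD[OF assms(1)])

definition atomless_ideal :: "'i set \<Rightarrow> 'i set set \<Rightarrow> bool" where
  "atomless_ideal I J \<longleftrightarrow> (\<forall>X \<subseteq> I. X \<notin> J \<longrightarrow> (\<exists>Y \<subseteq> X. Y \<notin> J \<and> X - Y \<notin> J))"

definition lower_bound_property :: "'k rel \<Rightarrow> 'i set \<Rightarrow> 'i set set \<Rightarrow> bool" where
  "lower_bound_property \<kappa> I J \<longleftrightarrow> (\<forall>\<C> \<subseteq> Pow I. |\<C>| <o \<kappa> \<longrightarrow>
     (\<forall>F \<subseteq> \<C>. finite F \<longrightarrow> I \<inter> \<Inter>F \<notin> J) \<longrightarrow> (\<exists>Y \<subseteq> I. Y \<notin> J \<and> (\<forall>C \<in> \<C>. Y - C \<in> J)))"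

definition separation_property :: "'k rel \<Rightarrow> 'i set \<Rightarrow> 'i set set \<Rightarrow> bool" where
  "separation_property \<kappa> I J \<longleftrightarrow> (\<forall>\<A> \<subseteq> Pow I. \<forall>\<B> \<subseteq> Pow I. |\<A>| <o \<kappa> \<longrightarrow> |\<B>| <o \<kappa> \<longrightarrow>
     (\<forall>A \<in> \<A>. \<forall>B \<in> \<B>. A \<inter> B \<in> J) \<longrightarrow>
     (\<exists>X \<subseteq> I. (\<forall>A \<in> \<A>. A - X \<in> J) \<and> (\<forall>B \<in> \<B>. B \<inter> X \<in> J)))"

section \<open>Zorn's lemma and ultrafilters\<close>

lemma chain_finite_subset:
  assumes "subset.chain \<A> \<C>" "\<C> \<noteq> {}" "finite F" "F \<subseteq> \<Union>\<C>"
  shows "\<exists>R \<in> \<C>. F \<subseteq> R"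
  using assms(3,4)
proof (induction F)
  case empty
  then show ?case using assms(2) by blast
next
  case (insert x F)
  then obtain R S where "R \<in> \<C>" "F \<subseteq> R" "S \<in> \<C>" "x \<in> S" by auto
  moreover have "R \<subseteq> S \<or> S \<subseteq> R"
    using assms(1) \<open>R \<in> \<C>\<close> \<open>S \<in> \<C>\<close> by (auto simp: subset.chain_def)
  ultimately show ?case by blast
qed

lemma finite_subset_insert_image:
  assumes "F \<subseteq> insert y (f ` A)" "finite F"
  obtains C where "C \<subseteq> A" "finite C" "F - {y} = f ` C"
proof -
  have "finite (F - {y})" "F - {y} \<subseteq> f ` A" using assms by auto
  from finite_subset_image[OF this] show ?thesis using that by blast
qed

text \<open>A maximal family with the finite intersection property decides every set: if
  \<open>S\<close> and \<open>- S\<close> were both missing, each would be disjoint from the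
  intersection of some finite subfamily, and the union of the two subfamilies would have empty
  intersection.\<close>

lemma ultrafilter_extension:
  fixes \<G> :: "'x set set"
  assumes fip: "\<forall>F \<subseteq> \<G>. finite F \<longrightarrow> \<Inter>F \<noteq> {}"
  obtains \<U> where "\<G> \<subseteq> \<U>" "\<forall>F \<subseteq> \<U>. finite F \<longrightarrow> \<Inter>F \<noteq> {}" "\<forall>S. S \<in> \<U> \<or> - S \<in> \<U>"
proof -
  define \<F> where "\<F> = {\<U>. \<G> \<subseteq> \<U> \<and> (\<forall>F \<subseteq> \<U>. finite F \<longrightarrow> \<Inter>F \<noteq> {})}"
  have "\<exists>\<U> \<in> \<F>. \<forall>X \<in> \<F>. \<U> \<subseteq> X \<longrightarrow> X = \<U>"
  proof (rule subset_Zorn_nonempty)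
    show "\<F> \<noteq> {}" using fip by (auto simp: \<F>_def)
    fix \<C> assume C: "\<C> \<noteq> {}" "subset.chain \<F> \<C>"
    then have sub: "\<C> \<subseteq> \<F>" by (auto simp: subset.chain_def)
    have "\<Inter>F \<noteq> {}" if "F \<subseteq> \<Union>\<C>" "finite F" for F
      using chain_finite_subset[OF C(2,1) that(2,1)] that sub unfolding \<F>_def by blast
    then show "\<Union>\<C> \<in> \<F>" using C sub unfolding \<F>_def by blast
  qed
  then obtain \<U> where U: "\<U> \<in> \<F>" "\<And>X. X \<in> \<F> \<Longrightarrow> \<U> \<subseteq> X \<Longrightarrow> X = \<U>" by blast
  have ext: "\<exists>F \<subseteq> \<U>. finite F \<and> \<Inter>F \<inter> S = {}" if "S \<notin> \<U>" for S
  proof -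
    have "insert S \<U> \<notin> \<F>" using U(2)[of "insert S \<U>"] that by blast
    then obtain F where F: "F \<subseteq> insert S \<U>" "finite F" "\<Inter>F = {}"
      using U(1) unfolding \<F>_def by blast
    then show ?thesis by (intro exI[of _ "F - {S}"]) auto
  qed
  have "S \<in> \<U> \<or> - S \<in> \<U>" for S
  proof (rule ccontr)
    assume "\<not> (S \<in> \<U> \<or> - S \<in> \<U>)"
    then obtain F G where "F \<subseteq> \<U>" "finite F" "\<Inter>F \<inter> S = {}" "G \<subseteq> \<U>" "finite G" "\<Inter>G \<inter> - S = {}"
      using ext[of S] ext[of "- S"] by blast
    then have "F \<union> G \<subseteq> \<U>" "finite (F \<union> G)" "\<Inter>(F \<union> G) = {}"
      unfolding Inter_Un_distrib by blast+
    then show False using U(1) unfolding \<F>_def by blast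
  qed
  then show ?thesis using U(1) unfolding \<F>_def by (intro that[of \<U>]) blast+
qed

lemma small_image:
  assumes "|A| <o \<kappa>" shows "|f ` A| <o \<kappa>"
  using card_of_image assms ordLeq_ordLess_trans by blast

lemma small_subset:
  assumes "|B| <o \<kappa>" "A \<subseteq> B" shows "|A| <o \<kappa>"
  using card_of_mono1 assms ordLeq_ordLess_trans by blast

lemma small_Un:
  assumes "Card_order \<kappa>" "infinite (Field \<kappa>)" "|A| <o \<kappa>" "|B| <o \<kappa>"
  shows "|A \<union> B| <o \<kappa>"
  using card_of_Un_ordLess_infinite_Field assms by blast

section \<open>Disjoint refinement and splitting from lower bounds\<close>

context
  fixes I :: "'i set" and J :: "'i set set" and \<kappa> :: "'k rel"
  assumes ideal: "ideal_on I J" and atomless: "atomless_ideal I J"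
    and \<kappa>: "Card_order \<kappa>" "infinite (Field \<kappa>)"
    and lower: "lower_bound_property \<kappa> I J"
begin

lemma lower_bound:
  assumes "\<C> \<subseteq> Pow I" "|\<C>| <o \<kappa>" "\<forall>F \<subseteq> \<C>. finite F \<longrightarrow> I \<inter> \<Inter>F \<notin> J"
  obtains Y where "Y \<subseteq> I" "Y \<notin> J" "\<forall>C \<in> \<C>. Y - C \<in> J"
proof -
  have "\<exists>Y \<subseteq> I. Y \<notin> J \<and> (\<forall>C \<in> \<C>. Y - C \<in> J)"
    using lower[unfolded lower_bound_property_def, rule_format, OF assms(1,2)] assms(3) by blast
  then show ?thesis using that by blast
qed

text \<open>Each \<open>W \<gamma>\<close> is halved; an ultrafilter containing \<open>Y\<close> omits a half of each, and a lower bound of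
  \<open>Y\<close> and the complements of the omitted halves works for all \<open>\<gamma>\<close> at once.\<close>

lemma positive_subset_not_covering:
  assumes "|D| <o \<kappa>" "\<forall>\<gamma> \<in> D. W \<gamma> \<subseteq> I \<and> W \<gamma> \<notin> J" "Y \<subseteq> I" "Y \<notin> J"
  obtains E where "E \<subseteq> Y" "E \<notin> J" "\<forall>\<gamma> \<in> D. W \<gamma> - E \<notin> J"
proof -
  define \<G> where "\<G> = insert Y (uminus ` J)"
  have fip: "\<Inter>F \<noteq> {}" if sF: "F \<subseteq> \<G>" "finite F" for F
  proof
    assume F: "\<Inter>F = {}"
    obtain N where N: "N \<subseteq> J" "finite N" "F - {Y} = uminus ` N"
      by (rule finite_subset_insert_image[OF sF[unfolded \<G>_def]]) (rule that)
    have "Y \<subseteq> \<Union>N"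
    proof
      fix y assume "y \<in> Y"
      with F obtain S where "S \<in> F" "y \<notin> S" by blast
      then have "S \<in> F - {Y}" using \<open>y \<in> Y\<close> by blast
      then show "y \<in> \<Union>N" using N \<open>y \<notin> S\<close> by auto
    qed
    then show False
      using assms ideal_finite_Union[OF ideal N(2,1)] ideal_onD(2)[OF ideal] by blast
  qed
  have "\<forall>F \<subseteq> \<G>. finite F \<longrightarrow> \<Inter>F \<noteq> {}" using fip by blast
  from ultrafilter_extension[OF this] obtain \<U> where U: "\<G> \<subseteq> \<U>" "\<forall>F \<subseteq> \<U>. finite F \<longrightarrow> \<Inter>F \<noteq> {}" "\<forall>S. S \<in> \<U> \<or> - S \<in> \<U>"
    by metis
  have "\<exists>G \<in> \<U>. W \<gamma> - G \<notin> J" if \<gamma>: "\<gamma> \<in> D" for \<gamma>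
  proof -
    obtain P where P: "P \<subseteq> W \<gamma>" "P \<notin> J" "W \<gamma> - P \<notin> J"
      using atomless bspec[OF assms(2) \<gamma>] unfolding atomless_ideal_def by blast
    show ?thesis
    proof (cases "P \<in> \<U>")
      case True
      then show ?thesis using P by blast
    next
      case False
      then have "- P \<in> \<U>" using U by blast
      moreover have "W \<gamma> - - P = P" using P by blast
      ultimately show ?thesis using P by metis
    qed
  qed
  then obtain G where G: "\<And>\<gamma>. \<gamma> \<in> D \<Longrightarrow> G \<gamma> \<in> \<U> \<and> W \<gamma> - G \<gamma> \<notin> J" by metis
  define \<C> where "\<C> = insert Y ((\<lambda>\<gamma>. I \<inter> G \<gamma>) ` D)"
  have fipC: "I \<inter> \<Inter>F \<notin> J" if sF: "F \<subseteq> \<C>" "finite F" for F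
  proof
    assume F: "I \<inter> \<Inter>F \<in> J"
    obtain D' where D': "D' \<subseteq> D" "finite D'" "F - {Y} = (\<lambda>\<gamma>. I \<inter> G \<gamma>) ` D'"
      by (rule finite_subset_insert_image[OF sF[unfolded \<C>_def]]) (rule that)
    \<comment> \<open>If \<open>I \<inter> \<Inter>F\<close> were in \<open>J\<close>, its
      complement would belong to \<open>\<U>\<close>, although \<open>F\<close> is built from
      members of \<open>\<U>\<close>.\<close>
    let ?H = "insert (- (I \<inter> \<Inter>F)) (insert Y (G ` D'))"
    have "- (I \<inter> \<Inter>F) \<in> \<U>" "Y \<in> \<U>" using U(1) F unfolding \<G>_def by blast+
    moreover have "G ` D' \<subseteq> \<U>" using G D'(1) by blast
    ultimately have "?H \<subseteq> \<U>" by simp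
    moreover have "finite ?H" using D'(2) by simp
    ultimately obtain x where x: "x \<in> \<Inter>?H" using U(2) by blast
    then have "x \<in> I" using assms by auto
    have "x \<in> S" if "S \<in> F" for S
    proof (cases "S = Y")
      case False
      then have "S \<in> (\<lambda>\<gamma>. I \<inter> G \<gamma>) ` D'" using that D' by blast
      then show ?thesis using x \<open>x \<in> I\<close> by auto
    qed (use x in auto)
    then show False using x \<open>x \<in> I\<close> by blast
  qed
  have subC: "\<C> \<subseteq> Pow I" using assms by (auto simp: \<C>_def)
  have smallC: "|\<C>| <o \<kappa>" unfolding \<C>_def by (intro insert_ordLess \<kappa> small_image assms)
  have "\<forall>F \<subseteq> \<C>. finite F \<longrightarrow> I \<inter> \<Inter>F \<notin> J" using fipC by blast
  from lower_bound[OF subC smallC this] obtain E where E: "E \<subseteq> I" "E \<notin> J" "\<forall>C \<in> \<C>. E - C \<in> J"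
    by metis
  show ?thesis
  proof (rule that[of "E \<inter> Y"], goal_cases)
    case 1
    show "E \<inter> Y \<subseteq> Y" by blast
  next
    case 2
    have "E - Y \<in> J" using E by (auto simp: \<C>_def)
    then show "E \<inter> Y \<notin> J" using ideal_subset_Un[OF ideal, of "E - Y" "E \<inter> Y" E] E by blast
  next
    case 3
    show ?case
    proof
      fix \<gamma> assume \<gamma>: "\<gamma> \<in> D"
      then have "E - I \<inter> G \<gamma> \<in> J" using E by (auto simp: \<C>_def)
      then show "W \<gamma> - E \<inter> Y \<notin> J"
        using ideal_subset_Un[OF ideal, of "E - I \<inter> G \<gamma>" "W \<gamma> - E \<inter> Y" "W \<gamma> - G \<gamma>"] G[OF \<gamma>] by blast
    qed
  qed
qed

text \<open>Zorn's lemma is applied to partial refinements, coded as relations. The third clause of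
  \<open>\<F>\<close>, that finitely many pieces never almost cover a \<open>W \<gamma>\<close>, is
  the invariant that keeps them extendable: it makes \<open>W \<delta>\<close> together with the
  complements of the pieces a centred family, whose lower bound yields a positive
  \<open>V \<delta>\<close> almost disjoint from all pieces. The new piece inside
  \<open>V \<gamma>\<close> is then taken from \<open>positive_subset_not_covering\<close>, so that
  the invariant survives.\<close>

lemma disjoint_refinement:
  assumes "|D| <o \<kappa>" "\<forall>\<gamma> \<in> D. W \<gamma> \<subseteq> I \<and> W \<gamma> \<notin> J"
  obtains E where "\<forall>\<gamma> \<in> D. E \<gamma> \<subseteq> W \<gamma> \<and> E \<gamma> \<notin> J"
    "\<forall>\<gamma> \<in> D. \<forall>\<delta> \<in> D. \<gamma> \<noteq> \<delta> \<longrightarrow> E \<gamma> \<inter> E \<delta> \<in> J"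
proof -
  define \<F> where "\<F> = {R. (\<forall>\<gamma> X. (\<gamma>, X) \<in> R \<longrightarrow> \<gamma> \<in> D \<and> X \<subseteq> W \<gamma> \<and> X \<notin> J) \<and>
     (\<forall>\<gamma> X \<delta> Y. (\<gamma>, X) \<in> R \<longrightarrow> (\<delta>, Y) \<in> R \<longrightarrow> (\<gamma> = \<delta> \<longrightarrow> X = Y) \<and> (\<gamma> \<noteq> \<delta> \<longrightarrow> X \<inter> Y \<in> J)) \<and>
     (\<forall>F \<gamma>. F \<subseteq> R \<longrightarrow> finite F \<longrightarrow> \<gamma> \<in> D \<longrightarrow> W \<gamma> - \<Union>(snd ` F) \<notin> J)}"
  have \<F>I: "R \<in> \<F>" if "\<And>\<gamma> X. (\<gamma>, X) \<in> R \<Longrightarrow> \<gamma> \<in> D \<and> X \<subseteq> W \<gamma> \<and> X \<notin> J"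
    "\<And>\<gamma> X \<delta> Y. (\<gamma>, X) \<in> R \<Longrightarrow> (\<delta>, Y) \<in> R \<Longrightarrow> (\<gamma> = \<delta> \<longrightarrow> X = Y) \<and> (\<gamma> \<noteq> \<delta> \<longrightarrow> X \<inter> Y \<in> J)"
    "\<And>F \<gamma>. F \<subseteq> R \<Longrightarrow> finite F \<Longrightarrow> \<gamma> \<in> D \<Longrightarrow> W \<gamma> - \<Union>(snd ` F) \<notin> J" for R
    unfolding \<F>_def mem_Collect_eq using that by (intro conjI allI impI) simp_all
  have \<F>1: "\<gamma> \<in> D \<and> X \<subseteq> W \<gamma> \<and> X \<notin> J" if "R \<in> \<F>" "(\<gamma>, X) \<in> R" for R \<gamma> X
    using that by (simp add: \<F>_def)
  have \<F>2: "(\<gamma> = \<delta> \<longrightarrow> X = Y) \<and> (\<gamma> \<noteq> \<delta> \<longrightarrow> X \<inter> Y \<in> J)" if "R \<in> \<F>" "(\<gamma>, X) \<in> R" "(\<delta>, Y) \<in> R" for R \<gamma> X \<delta> Y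
    using that by (simp add: \<F>_def)
  have \<F>3: "W \<gamma> - \<Union>(snd ` F) \<notin> J" if "R \<in> \<F>" "F \<subseteq> R" "finite F" "\<gamma> \<in> D" for R F \<gamma>
    using that by (simp add: \<F>_def)
  have "\<exists>R \<in> \<F>. \<forall>X \<in> \<F>. R \<subseteq> X \<longrightarrow> X = R"
  proof (rule subset_Zorn_nonempty)
    have "{} \<in> \<F>" using assms by (intro \<F>I) auto
    then show "\<F> \<noteq> {}" by blast
    fix \<C> assume C: "\<C> \<noteq> {}" "subset.chain \<F> \<C>"
    then have sub: "\<And>R. R \<in> \<C> \<Longrightarrow> R \<in> \<F>" by (auto simp: subset.chain_def)
    note fin = chain_finite_subset[OF C(2,1)]
    show "\<Union>\<C> \<in> \<F>"
    proof (rule \<F>I)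
      fix \<gamma> X assume "(\<gamma>, X) \<in> \<Union>\<C>"
      then obtain R where "R \<in> \<C>" "(\<gamma>, X) \<in> R" by blast
      then show "\<gamma> \<in> D \<and> X \<subseteq> W \<gamma> \<and> X \<notin> J" by (intro \<F>1[OF sub])
    next
      fix \<gamma> X \<delta> Y assume "(\<gamma>, X) \<in> \<Union>\<C>" "(\<delta>, Y) \<in> \<Union>\<C>"
      then have "{(\<gamma>, X), (\<delta>, Y)} \<subseteq> \<Union>\<C>" by simp
      then obtain R where "R \<in> \<C>" "{(\<gamma>, X), (\<delta>, Y)} \<subseteq> R"
        using fin[of "{(\<gamma>, X), (\<delta>, Y)}"] by auto
      then show "(\<gamma> = \<delta> \<longrightarrow> X = Y) \<and> (\<gamma> \<noteq> \<delta> \<longrightarrow> X \<inter> Y \<in> J)"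
        by (intro \<F>2[OF sub[of R]]) auto
    next
      fix F \<gamma> assume F: "F \<subseteq> \<Union>\<C>" "finite F" "\<gamma> \<in> D"
      then obtain R where "R \<in> \<C>" "F \<subseteq> R" using fin by blast
      then show "W \<gamma> - \<Union>(snd ` F) \<notin> J" using F by (intro \<F>3[OF sub])
    qed
  qed
  then obtain R where R: "R \<in> \<F>" and max: "\<And>X. X \<in> \<F> \<Longrightarrow> R \<subseteq> X \<Longrightarrow> X = R" by blast
  note R1 = \<F>1[OF R] and R2 = \<F>2[OF R] and R3 = \<F>3[OF R]
  \<comment> \<open>One piece per index at most, hence few enough pieces for the lower bound
    property to apply to their complements.\<close>
  have "inj_on fst R"
  proof (rule inj_onI)
    fix x y assume "x \<in> R" "y \<in> R" "fst x = fst y"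
    then show "x = y" by (cases x; cases y) (use R2 in simp)
  qed
  moreover have "fst ` R \<subseteq> D" using R1 by auto
  ultimately have "|R| \<le>o |D|" by (metis card_of_ordLeq)
  then have small: "|R| <o \<kappa>" using assms(1) ordLeq_ordLess_trans by blast
  have "\<exists>X. (\<gamma>, X) \<in> R" if \<gamma>: "\<gamma> \<in> D" for \<gamma>
  proof (rule ccontr)
    assume no: "\<nexists>X. (\<gamma>, X) \<in> R"
    have "\<exists>V. V \<subseteq> W \<delta> \<and> V \<notin> J \<and> (\<forall>X \<in> snd ` R. V \<inter> X \<in> J)" if \<delta>: "\<delta> \<in> D" for \<delta>
    proof -
      define \<C> where "\<C> = insert (W \<delta>) ((\<lambda>x. I - snd x) ` R)"
      have fipC: "I \<inter> \<Inter>F \<notin> J" if sF: "F \<subseteq> \<C>" "finite F" for F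
      proof
        assume F: "I \<inter> \<Inter>F \<in> J"
        obtain G where G: "G \<subseteq> R" "finite G" "F - {W \<delta>} = (\<lambda>x. I - snd x) ` G"
          by (rule finite_subset_insert_image[OF sF[unfolded \<C>_def]]) (rule that)
        have "W \<delta> - \<Union>(snd ` G) \<subseteq> I \<inter> \<Inter>F"
        proof
          fix i assume i: "i \<in> W \<delta> - \<Union>(snd ` G)"
          then have "i \<in> I" using bspec[OF assms(2) \<delta>] by blast
          moreover have "i \<in> S" if "S \<in> F" for S
          proof (cases "S = W \<delta>")
            case False
            then have "S \<in> (\<lambda>x. I - snd x) ` G" using that G by blast
            then show ?thesis using i \<open>i \<in> I\<close> by auto
          qed (use i in auto)
          ultimately show "i \<in> I \<inter> \<Inter>F" by blast
        qed
        then show False using R3[OF G(1,2) \<delta>] F ideal_onD(2)[OF ideal] by blast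
      qed
      have subC: "\<C> \<subseteq> Pow I" using bspec[OF assms(2) \<delta>] by (auto simp: \<C>_def)
      have smallC: "|\<C>| <o \<kappa>" unfolding \<C>_def by (intro insert_ordLess \<kappa> small_image small)
      have "\<forall>F \<subseteq> \<C>. finite F \<longrightarrow> I \<inter> \<Inter>F \<notin> J" using fipC by blast
      from lower_bound[OF subC smallC this] obtain V where V: "V \<subseteq> I" "V \<notin> J" "\<forall>C \<in> \<C>. V - C \<in> J"
        by metis
      have "V - W \<delta> \<in> J" using V by (auto simp: \<C>_def)
      then have "V \<inter> W \<delta> \<notin> J" using ideal_subset_Un[OF ideal, of "V - W \<delta>" "V \<inter> W \<delta>" V] V by blast
      moreover have "V \<inter> W \<delta> \<inter> X \<in> J" if "X \<in> snd ` R" for X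
      proof -
        have "V - (I - X) \<in> J" using bspec[OF V(3), of "I - X"] that by (auto simp: \<C>_def)
        then show ?thesis using ideal_onD(2)[OF ideal, of _ "V \<inter> W \<delta> \<inter> X"] by blast
      qed
      ultimately show ?thesis by (intro exI[of _ "V \<inter> W \<delta>"]) auto
    qed
    then obtain V where V: "\<And>\<delta>. \<delta> \<in> D \<Longrightarrow> V \<delta> \<subseteq> W \<delta> \<and> V \<delta> \<notin> J \<and> (\<forall>X \<in> snd ` R. V \<delta> \<inter> X \<in> J)"
      by metis
    have V': "\<forall>\<delta> \<in> D. V \<delta> \<subseteq> I \<and> V \<delta> \<notin> J" using V assms(2) by blast
    obtain E where E: "E \<subseteq> V \<gamma>" "E \<notin> J" "\<forall>\<delta> \<in> D. V \<delta> - E \<notin> J"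
      using positive_subset_not_covering[OF assms(1) V', of "V \<gamma>"] V' \<gamma> by blast
    have disj: "E \<inter> X \<in> J" "X \<inter> E \<in> J" if "(\<delta>, X) \<in> R" for \<delta> X
    proof -
      have "X \<in> snd ` R" using that by force
      then have "V \<gamma> \<inter> X \<in> J" using V \<gamma> by blast
      then show "E \<inter> X \<in> J" "X \<inter> E \<in> J" using E(1) ideal_onD(2)[OF ideal, of "V \<gamma> \<inter> X"] by blast+
    qed
    have "insert (\<gamma>, E) R \<in> \<F>"
    proof (rule \<F>I)
      fix \<delta> X assume "(\<delta>, X) \<in> insert (\<gamma>, E) R"
      then show "\<delta> \<in> D \<and> X \<subseteq> W \<delta> \<and> X \<notin> J"
        using R1[of \<delta> X] V[OF \<gamma>] E(1,2) \<gamma> by auto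
    next
      fix \<delta> X \<delta>' Y assume "(\<delta>, X) \<in> insert (\<gamma>, E) R" "(\<delta>', Y) \<in> insert (\<gamma>, E) R"
      then show "(\<delta> = \<delta>' \<longrightarrow> X = Y) \<and> (\<delta> \<noteq> \<delta>' \<longrightarrow> X \<inter> Y \<in> J)"
        using R2[of \<delta> X \<delta>' Y] no disj[of \<delta> X] disj[of \<delta>' Y] by auto
    next
      fix F \<delta> assume F: "F \<subseteq> insert (\<gamma>, E) R" "finite F" and \<delta>: "\<delta> \<in> D"
      let ?G = "F - {(\<gamma>, E)}"
      \<comment> \<open>\<open>V \<delta>\<close> meets every old piece in a member of
        \<open>J\<close>; up to \<open>J\<close>, therefore, \<open>F\<close> leaves all of
        \<open>V \<delta> - E\<close> uncovered.\<close>
      have "(\<lambda>X. V \<delta> \<inter> X) ` snd ` ?G \<subseteq> J" using V[OF \<delta>] F by blast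
      then have "\<Union>((\<lambda>X. V \<delta> \<inter> X) ` snd ` ?G) \<in> J" using F by (intro ideal_finite_Union[OF ideal]) auto
      moreover have "V \<delta> - E \<subseteq> \<Union>((\<lambda>X. V \<delta> \<inter> X) ` snd ` ?G) \<union> (W \<delta> - \<Union>(snd ` F))"
      proof
        fix i assume i: "i \<in> V \<delta> - E"
        show "i \<in> \<Union>((\<lambda>X. V \<delta> \<inter> X) ` snd ` ?G) \<union> (W \<delta> - \<Union>(snd ` F))"
        proof (cases "i \<in> \<Union>(snd ` F)")
          case True
          then obtain x where "x \<in> F" "i \<in> snd x" by blast
          then show ?thesis using i by auto
        next
          case False
          then show ?thesis using i V[OF \<delta>] by blast
        qed
      qed
      ultimately show "W \<delta> - \<Union>(snd ` F) \<notin> J"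
        using ideal_subset_Un[OF ideal] bspec[OF E(3) \<delta>] by blast
    qed
    then show False using max no by blast
  qed
  then obtain E where E: "\<And>\<gamma>. \<gamma> \<in> D \<Longrightarrow> (\<gamma>, E \<gamma>) \<in> R" by metis
  show ?thesis
  proof (rule that[of E])
    show "\<forall>\<gamma> \<in> D. E \<gamma> \<subseteq> W \<gamma> \<and> E \<gamma> \<notin> J" using R1 E by blast
    show "\<forall>\<gamma> \<in> D. \<forall>\<delta> \<in> D. \<gamma> \<noteq> \<delta> \<longrightarrow> E \<gamma> \<inter> E \<delta> \<in> J"
      using R2[OF E E] by blast
  qed
qed

text \<open>This is the shape in which types over \<open>P(I)/J\<close> get realised:
  \<open>\<A>\<close> is to lie below the new element, \<open>\<B>\<close> outside it, and the
  elements of \<open>\<D>\<close> are to be split. Every \<open>D\<close> contains a positive set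
  almost disjoint from all members of \<open>\<A>\<close> and \<open>\<B>\<close>; these sets are
  refined disjointly and halved, and the halves are added to the two sides before
  separating.\<close>

lemma separating_and_splitting_set:
  assumes sep: "separation_property \<kappa> I J"
    and small: "|\<A>| <o \<kappa>" "|\<B>| <o \<kappa>" "|\<D>| <o \<kappa>"
    and sub: "\<A> \<subseteq> Pow I" "\<B> \<subseteq> Pow I" "\<D> \<subseteq> Pow I"
    and ne: "\<A> \<noteq> {}" "\<B> \<noteq> {}"
    and un: "\<And>A A'. A \<in> \<A> \<Longrightarrow> A' \<in> \<A> \<Longrightarrow> A \<union> A' \<in> \<A>" "\<And>B B'. B \<in> \<B> \<Longrightarrow> B' \<in> \<B> \<Longrightarrow> B \<union> B' \<in> \<B>"
    and orth: "\<And>A B. A \<in> \<A> \<Longrightarrow> B \<in> \<B> \<Longrightarrow> A \<inter> B \<in> J"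
    and pos: "\<And>A B D. A \<in> \<A> \<Longrightarrow> B \<in> \<B> \<Longrightarrow> D \<in> \<D> \<Longrightarrow> D - (A \<union> B) \<notin> J"
  obtains X where "X \<subseteq> I" "\<forall>A \<in> \<A>. A - X \<in> J" "\<forall>B \<in> \<B>. B \<inter> X \<in> J"
    "\<forall>D \<in> \<D>. D \<inter> X \<notin> J \<and> D - X \<notin> J"
proof -
  have "\<exists>V. V \<subseteq> D \<and> V \<notin> J \<and> (\<forall>S \<in> \<A> \<union> \<B>. V \<inter> S \<in> J)" if D: "D \<in> \<D>" for D
  proof -
    define \<C> where "\<C> = insert D ((\<lambda>S. I - S) ` (\<A> \<union> \<B>))"
    have fipC: "I \<inter> \<Inter>F \<notin> J" if F: "F \<subseteq> \<C>" "finite F" for F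
    proof -
      obtain G where G: "G \<subseteq> \<A> \<union> \<B>" "finite G" "F - {D} = (\<lambda>S. I - S) ` G"
        by (rule finite_subset_insert_image[OF F[unfolded \<C>_def]]) (rule that)
      \<comment> \<open>Closure under unions reduces a finite part of
        \<open>\<A> \<union> \<B>\<close> to one pair, to which \<open>pos\<close> applies.\<close>
      have "\<exists>A \<in> \<A>. \<exists>B \<in> \<B>. \<Union>G \<subseteq> A \<union> B"
        using G(2,1)
      proof (induction G)
        case empty
        then show ?case using ne by blast
      next
        case (insert S G)
        then obtain A B where AB: "A \<in> \<A>" "B \<in> \<B>" "\<Union>G \<subseteq> A \<union> B" by auto
        show ?case
        proof (cases "S \<in> \<A>")
          case True
          then show ?thesis using AB un(1)[of S A] by (intro bexI[of _ "S \<union> A"] bexI[of _ B]) auto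
        next
          case False
          then show ?thesis using AB un(2)[of S B] insert.prems
            by (intro bexI[of _ A] bexI[of _ "S \<union> B"]) auto
        qed
      qed
      then obtain A B where AB: "A \<in> \<A>" "B \<in> \<B>" "\<Union>G \<subseteq> A \<union> B" by blast
      have "D - (A \<union> B) \<subseteq> I \<inter> \<Inter>F"
      proof
        fix i assume i: "i \<in> D - (A \<union> B)"
        then have "i \<in> I" using D sub by blast
        moreover have "i \<in> S" if "S \<in> F" for S
        proof (cases "S = D")
          case False
          then have "S \<in> (\<lambda>S. I - S) ` G" using that G by blast
          then show ?thesis using i \<open>i \<in> I\<close> AB by auto
        qed (use i in auto)
        ultimately show "i \<in> I \<inter> \<Inter>F" by blast
      qed
      then show ?thesis using pos[OF AB(1,2) D] ideal_onD(2)[OF ideal] by blast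
    qed
    have subC: "\<C> \<subseteq> Pow I" using D sub by (auto simp: \<C>_def)
    have smallC: "|\<C>| <o \<kappa>" unfolding \<C>_def by (intro insert_ordLess \<kappa> small_image small_Un small)
    have "\<forall>F \<subseteq> \<C>. finite F \<longrightarrow> I \<inter> \<Inter>F \<notin> J" using fipC by blast
    from lower_bound[OF subC smallC this] obtain V where V: "V \<subseteq> I" "V \<notin> J" "\<forall>C \<in> \<C>. V - C \<in> J"
      by metis
    have "V - D \<in> J" using V by (auto simp: \<C>_def)
    then have "V \<inter> D \<notin> J" using ideal_subset_Un[OF ideal, of "V - D" "V \<inter> D" V] V by blast
    moreover have "V \<inter> D \<inter> S \<in> J" if "S \<in> \<A> \<union> \<B>" for S
    proof -
      have "V - (I - S) \<in> J" using bspec[OF V(3), of "I - S"] that by (auto simp: \<C>_def)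
      then show ?thesis using ideal_onD(2)[OF ideal, of _ "V \<inter> D \<inter> S"] by blast
    qed
    ultimately show ?thesis by (intro exI[of _ "V \<inter> D"]) auto
  qed
  then obtain V where V: "\<And>D. D \<in> \<D> \<Longrightarrow> V D \<subseteq> D \<and> V D \<notin> J \<and> (\<forall>S \<in> \<A> \<union> \<B>. V D \<inter> S \<in> J)"
    by metis
  have V': "\<forall>D \<in> \<D>. V D \<subseteq> I \<and> V D \<notin> J" using V sub(3) by blast
  obtain E where E: "\<forall>D \<in> \<D>. E D \<subseteq> V D \<and> E D \<notin> J"
    "\<forall>D \<in> \<D>. \<forall>D' \<in> \<D>. D \<noteq> D' \<longrightarrow> E D \<inter> E D' \<in> J"
    using disjoint_refinement[OF small(3) V'] by metis
  have "\<exists>Y \<subseteq> E D. Y \<notin> J \<and> E D - Y \<notin> J" if "D \<in> \<D>" for D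
  proof -
    have "E D \<subseteq> I" using E(1) V that sub by blast
    then show ?thesis using atomless bspec[OF E(1) that] unfolding atomless_ideal_def by blast
  qed
  then obtain H where H: "\<And>D. D \<in> \<D> \<Longrightarrow> H D \<subseteq> E D \<and> H D \<notin> J \<and> E D - H D \<notin> J" by metis
  have EI: "E D \<subseteq> D \<and> E D \<subseteq> I \<and> (\<forall>S \<in> \<A> \<union> \<B>. E D \<inter> S \<in> J)" if "D \<in> \<D>" for D
  proof -
    have "E D \<inter> S \<in> J" if "S \<in> \<A> \<union> \<B>" for S
      using ideal_onD(2)[OF ideal, of "V D \<inter> S" "E D \<inter> S"] V[OF \<open>D \<in> \<D>\<close>] bspec[OF E(1) \<open>D \<in> \<D>\<close>] that by blast
    then show ?thesis using E(1) V that sub by blast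
  qed
  let ?A = "\<A> \<union> H ` \<D>" and ?B = "\<B> \<union> (\<lambda>D. E D - H D) ` \<D>"
  have "?A \<subseteq> Pow I" "?B \<subseteq> Pow I" using sub EI H by blast+
  moreover have "|?A| <o \<kappa>" "|?B| <o \<kappa>" by (intro small_Un small_image small \<kappa>)+
  moreover have "A \<inter> B \<in> J" if "A \<in> ?A" "B \<in> ?B" for A B
  proof -
    consider "A \<in> \<A>" "B \<in> \<B>" | D where "A \<in> \<A>" "D \<in> \<D>" "B = E D - H D"
      | D where "B \<in> \<B>" "D \<in> \<D>" "A = H D"
      | D D' where "D \<in> \<D>" "D' \<in> \<D>" "A = H D" "B = E D' - H D'"
      using \<open>A \<in> ?A\<close> \<open>B \<in> ?B\<close> by blast
    then show ?thesis
    proof cases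
      case 1
      then show ?thesis using orth by blast
    next
      case (2 D)
      then have "E D \<inter> A \<in> J" using EI by blast
      then show ?thesis using ideal_onD(2)[OF ideal, of _ "A \<inter> B"] 2 by blast
    next
      case (3 D)
      then have "E D \<inter> B \<in> J" using EI by blast
      then show ?thesis using ideal_onD(2)[OF ideal, of _ "A \<inter> B"] 3 H by blast
    next
      case (4 D D')
      show ?thesis
      proof (cases "D = D'")
        case True
        then have "A \<inter> B = {}" using 4 by blast
        then show ?thesis using ideal_onD(1)[OF ideal] by simp
      next
        case False
        then have "E D \<inter> E D' \<in> J" using 4 E by blast
        moreover have "A \<inter> B \<subseteq> E D \<inter> E D'" using 4 H by blast
        ultimately show ?thesis using ideal_onD(2)[OF ideal] by blast
      qed
    qed
  qed
  ultimately have "\<exists>X \<subseteq> I. (\<forall>A \<in> ?A. A - X \<in> J) \<and> (\<forall>B \<in> ?B. B \<inter> X \<in> J)"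
    using sep[unfolded separation_property_def, rule_format, of ?A ?B] by blast
  then obtain X where X: "X \<subseteq> I" "\<forall>A \<in> ?A. A - X \<in> J" "\<forall>B \<in> ?B. B \<inter> X \<in> J" by blast
  have "D \<inter> X \<notin> J \<and> D - X \<notin> J" if D: "D \<in> \<D>" for D
  proof -
    have "H D - X \<in> J" using X(2) D by blast
    moreover have "(E D - H D) \<inter> X \<in> J" using X(3) D by blast
    ultimately show "D \<inter> X \<notin> J \<and> D - X \<notin> J"
      using ideal_subset_Un[OF ideal, of "H D - X" "D \<inter> X" "H D"]
        ideal_subset_Un[OF ideal, of "(E D - H D) \<inter> X" "D - X" "E D - H D"] H[OF D] EI[OF D] by blast
  qed
  then show ?thesis using X by (intro that[of X]) auto
qed

end

section \<open>Small algebras of sets\<close>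

lemma Fpow_ordLeq:
  assumes "infinite C"
  shows "|Fpow C| \<le>o |C|"
proof -
  have C: "Card_order |C|" "infinite (Field |C| )"
    by (rule card_of_Card_order) (simp add: Field_card_of assms)
  have fin: "|X| \<le>o |C|" if "finite X" for X :: "'a set set"
    using Card_order_finite_ordLess[OF C that] by (rule ordLess_imp_ordLeq)
  \<comment> \<open>Layers by cardinality: up to the empty set, each layer is contained in an image
    of the product of \<open>C\<close> with the previous one, and there are countably many.\<close>
  define A where "A n = {F \<in> Fpow C. card F \<le> n}" for n
  have "|A n| \<le>o |C|" for n
  proof (induction n)
    case 0
    have "A 0 \<subseteq> {{}}" by (auto simp: A_def Fpow_def)
    then have "finite (A 0)" by (rule finite_subset) simp
    then show ?case by (rule fin)
  next
    case (Suc n)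
    have sub: "A (Suc n) \<subseteq> insert {} ((\<lambda>(x, F). insert x F) ` (C \<times> A n))"
    proof
      fix F assume F: "F \<in> A (Suc n)"
      show "F \<in> insert {} ((\<lambda>(x, F). insert x F) ` (C \<times> A n))"
      proof (cases "F = {}")
        case False
        then obtain x where x: "x \<in> F" by blast
        have "x \<in> C" "F - {x} \<in> A n" using F x by (auto simp: A_def Fpow_def)
        moreover have "F = insert x (F - {x})" using x by blast
        ultimately show ?thesis by blast
      qed simp
    qed
    have "|C \<times> A n| \<le>o |C|"
      by (intro card_of_Times_ordLeq_infinite_Field C Suc ordIso_imp_ordLeq card_of_refl)
    then have "|(\<lambda>(x, F). insert x F) ` (C \<times> A n)| \<le>o |C|"
      by (rule ordLeq_transitive[OF card_of_image])
    then have "|insert {} ((\<lambda>(x, F). insert x F) ` (C \<times> A n))| \<le>o |C|"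
      using card_of_Un_ordLeq_infinite_Field[OF C(2) fin[of "{{}}"] _ C(1)] by simp
    then show ?case by (rule ordLeq_transitive[OF card_of_mono1[OF sub]])
  qed
  moreover have "|UNIV :: nat set| \<le>o |C|" using assms infinite_iff_card_of_nat by blast
  ultimately have "|\<Union>n. A n| \<le>o |C|"
    using card_of_UNION_ordLeq_infinite[OF assms] by blast
  moreover have "Fpow C = (\<Union>n. A n)" by (auto simp: A_def)
  ultimately show ?thesis by simp
qed

lemma small_set_algebra:
  assumes \<kappa>: "Card_order \<kappa>" "infinite (Field \<kappa>)" and C: "C \<subseteq> Pow I" "|C| <o \<kappa>"
  obtains C' where "C \<subseteq> C'" "C' \<subseteq> Pow I" "|C'| <o \<kappa>" "I \<in> C'" "\<forall>X \<in> C'. \<forall>Y \<in> C'. X - Y \<in> C'"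
proof -
  define g where "g = (\<lambda>(F, T). {i \<in> I. {c \<in> F. i \<in> c} \<in> T})"
  define C' where "C' = g ` (Fpow C \<times> Fpow (Fpow C))"
  have "C \<subseteq> C'"
  proof
    fix c assume c: "c \<in> C"
    have "c = g ({c}, {{c}})" using c C by (auto simp: g_def)
    moreover have "({c}, {{c}}) \<in> Fpow C \<times> Fpow (Fpow C)" using c by (auto simp: Fpow_def)
    ultimately show "c \<in> C'" unfolding C'_def by blast
  qed
  moreover have "C' \<subseteq> Pow I" by (auto simp: C'_def g_def)
  moreover have "|C'| <o \<kappa>"
  proof (cases "finite C")
    case True
    then have "finite C'" by (auto simp: C'_def Fpow_def)
    then show ?thesis using \<kappa> by (intro Card_order_finite_ordLess)
  next
    case False
    have inf: "infinite (Fpow C)"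
    proof
      assume "finite (Fpow C)"
      moreover have "(\<lambda>x. {x}) ` C \<subseteq> Fpow C" by (auto simp: Fpow_def)
      ultimately have "finite ((\<lambda>x. {x}) ` C)" by (rule rev_finite_subset)
      then show False using False by (simp add: finite_image_iff)
    qed
    have "|Fpow (Fpow C)| \<le>o |C|"
      by (rule ordLeq_transitive[OF Fpow_ordLeq[OF inf] Fpow_ordLeq[OF False]])
    then have "|Fpow C \<times> Fpow (Fpow C)| \<le>o |C|"
      using Fpow_ordLeq[OF False] False
      by (intro card_of_Times_ordLeq_infinite_Field card_of_Card_order) (simp add: Field_card_of)
    then have "|C'| \<le>o |C|" unfolding C'_def by (rule ordLeq_transitive[OF card_of_image])
    then show ?thesis using C(2) by (rule ordLeq_ordLess_trans)
  qed
  moreover have "I \<in> C'"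
  proof -
    have "I = g ({}, {{}})" by (auto simp: g_def)
    moreover have "({}, {{}}) \<in> Fpow C \<times> Fpow (Fpow C)" by (auto simp: Fpow_def)
    ultimately show ?thesis unfolding C'_def by blast
  qed
  moreover have "X - Y \<in> C'" if X: "X \<in> C'" and Y: "Y \<in> C'" for X Y
  proof -
    obtain F T where F: "X = g (F, T)" "F \<in> Fpow C" using X by (auto simp: C'_def)
    obtain F' T' where F': "Y = g (F', T')" "F' \<in> Fpow C" using Y by (auto simp: C'_def)
    define T'' where "T'' = {S \<in> Pow (F \<union> F'). S \<inter> F \<in> T \<and> S \<inter> F' \<notin> T'}"
    have *: "{c \<in> F \<union> F'. i \<in> c} \<inter> F = {c \<in> F. i \<in> c}" "{c \<in> F \<union> F'. i \<in> c} \<inter> F' = {c \<in> F'. i \<in> c}" for i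
      by auto
    have "X - Y = g (F \<union> F', T'')" unfolding F F' g_def T''_def 
      by (simp only: prod.case set_eq_iff Diff_iff mem_Collect_eq * Pow_iff) blast
    moreover have "(F \<union> F', T'') \<in> Fpow C \<times> Fpow (Fpow C)"
    proof -
      have "finite (F \<union> F')" "F \<union> F' \<subseteq> C" using F F' by (auto simp: Fpow_def)
      moreover have "finite T''" using \<open>finite (F \<union> F')\<close> by (simp add: T''_def)
      moreover have "T'' \<subseteq> Fpow C"
        using calculation by (auto simp: T''_def Fpow_def intro: rev_finite_subset)
      ultimately show ?thesis by (simp add: Fpow_def)
    qed
    ultimately show ?thesis unfolding C'_def by blast
  qed
  ultimately show ?thesis by (intro that[of C']) blast+
qed

section \<open>Saturation of quotients of power set algebras\<close>

lemma listset_iff: "as \<in> listset Xs \<longleftrightarrow> list_all2 (\<in>) as Xs"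
  by (induction Xs arbitrary: as) (auto simp: set_Cons_def list_all2_Cons2)

definition pcl :: "'i set \<Rightarrow> 'i set set \<Rightarrow> 'i set \<Rightarrow> 'i set set" where
  "pcl I J X = ideal_rel I J `` {X}"

fun peval :: "'i set \<Rightarrow> (nat \<Rightarrow> 'i set) \<Rightarrow> ba_fun tm \<Rightarrow> 'i set" where
  "peval I e (Var v) = e v"
| "peval I e (Fn f ts) = pow_op I f (map (peval I e) ts)"

lemma pow_op_subset: "set As \<subseteq> Pow I \<Longrightarrow> pow_op I f As \<subseteq> I"
  by (induction I f As rule: pow_op.induct) auto

lemma peval_subset: "range e \<subseteq> Pow I \<Longrightarrow> peval I e t \<subseteq> I"
proof (induction t)
  case (Fn f ts)
  have "set (map (peval I e) ts) \<subseteq> Pow I" using Fn.IH[OF _ Fn.prems] by (simp add: image_subset_iff)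
  then show ?case by (simp only: peval.simps pow_op_subset)
qed auto

text \<open>Boolean operations act pointwise. Two points and two lists are compared because a point
  of a cell will be matched with a point of the corresponding cell of another assignment.\<close>

lemma pow_op_local:
  assumes "i \<in> I" "j \<in> I" "list_all2 (\<lambda>A B. i \<in> A \<longleftrightarrow> j \<in> B) As Bs"
  shows "i \<in> pow_op I f As \<longleftrightarrow> j \<in> pow_op I f Bs"
proof -
  have "length As = length Bs" using assms(3) by (rule list_all2_lengthD)
  then show ?thesis using assms
    by (cases "(I, f, As)" rule: pow_op.cases; cases "(I, f, Bs)" rule: pow_op.cases) auto
qed

lemma peval_local:
  assumes "i \<in> I" "j \<in> I"
  shows "(\<And>v. v \<in> fv_tm t \<Longrightarrow> i \<in> e v \<longleftrightarrow> j \<in> e' v) \<Longrightarrow> i \<in> peval I e t \<longleftrightarrow> j \<in> peval I e' t"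
proof (induction t)
  case (Fn f ts)
  have "list_all2 (\<lambda>A B. i \<in> A \<longleftrightarrow> j \<in> B) (map (peval I e) ts) (map (peval I e') ts)"
    unfolding list.rel_map by (rule list.rel_refl_strong, rule Fn.IH, assumption, rule Fn.prems) auto
  then show ?case by (simp only: peval.simps pow_op_local[OF assms])
qed simp

section \<open>Cells and back and forth\<close>

definition cell :: "'i set \<Rightarrow> (nat \<Rightarrow> 'i set) \<Rightarrow> nat set \<Rightarrow> nat set \<Rightarrow> 'i set" where
  "cell I e V S = {i \<in> I. {v \<in> V. i \<in> e v} = S}"

text \<open>For finite \<open>V\<close> this is equality of quantifier-free types in the quotient,
  as a Boolean combination is null iff all cells contained in it are.\<close>

definition same_cells :: "'i set \<Rightarrow> 'i set set \<Rightarrow> nat set \<Rightarrow> (nat \<Rightarrow> 'i set) \<Rightarrow> (nat \<Rightarrow> 'i set) \<Rightarrow> bool" where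
  "same_cells I J V e e' \<longleftrightarrow> (\<forall>S \<subseteq> V. cell I e V S \<in> J \<longleftrightarrow> cell I e' V S \<in> J)"

lemma same_cells_sym: "same_cells I J V e e' \<Longrightarrow> same_cells I J V e' e"
  by (auto simp: same_cells_def)

context
  fixes I :: "'i set" and J :: "'i set set"
  assumes ideal: "ideal_on I J"
begin

lemma equiv_ideal_rel: "equiv (Pow I) (ideal_rel I J)"
proof (rule equivI)
  show "ideal_rel I J \<subseteq> Pow I \<times> Pow I" by (auto simp: ideal_rel_def)
  show "refl_on (Pow I) (ideal_rel I J)" using ideal_onD(1)[OF ideal] by (auto simp: refl_on_def ideal_rel_def)
  show "sym (ideal_rel I J)" by (auto simp: sym_def ideal_rel_def Un_commute)
  show "trans (ideal_rel I J)"
  proof (rule transI)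
    fix A B C assume "(A, B) \<in> ideal_rel I J" "(B, C) \<in> ideal_rel I J"
    then show "(A, C) \<in> ideal_rel I J"
      unfolding ideal_rel_def
      using ideal_subset_Un[OF ideal, of "A - B \<union> (B - A)" "B - C \<union> (C - B)" "A - C \<union> (C - A)"] by blast
  qed
qed

lemma pcl_eq_iff: "A \<subseteq> I \<Longrightarrow> B \<subseteq> I \<Longrightarrow> pcl I J A = pcl I J B \<longleftrightarrow> (A - B) \<union> (B - A) \<in> J"
  unfolding pcl_def using eq_equiv_class_iff[OF equiv_ideal_rel, of A B] by (simp add: ideal_rel_def)

lemma mem_pcl: "B \<in> pcl I J A \<longleftrightarrow> (A, B) \<in> ideal_rel I J"
  by (simp add: pcl_def)

lemma univ_pow_quotient: "univ (pow_quotient I J) = pcl I J ` Pow I"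
  by (auto simp: pow_quotient_def quotient_def pcl_def)

lemma pow_op_cong:
  assumes "list_all2 (\<lambda>A B. (A, B) \<in> ideal_rel I J) As Bs"
  shows "(pow_op I f As, pow_op I f Bs) \<in> ideal_rel I J"
proof -
  have len: "length As = length Bs" using assms by (rule list_all2_lengthD)
  have r: "(X, X) \<in> ideal_rel I J" if "X \<subseteq> I" for X
    using that ideal_onD(1)[OF ideal] by (auto simp: ideal_rel_def)
  have c: "(I - A, I - B) \<in> ideal_rel I J" if "(A, B) \<in> ideal_rel I J" for A B
    using that ideal_onD(2)[OF ideal, of "A - B \<union> (B - A)" "(I - A) - (I - B) \<union> ((I - B) - (I - A))"]
    unfolding ideal_rel_def by blast
  have m: "(A \<inter> C, B \<inter> D) \<in> ideal_rel I J" if "(A, B) \<in> ideal_rel I J" "(C, D) \<in> ideal_rel I J" for A B C D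
    using that ideal_subset_Un[OF ideal, of "A - B \<union> (B - A)" "C - D \<union> (D - C)" "(A \<inter> C) - (B \<inter> D) \<union> ((B \<inter> D) - (A \<inter> C))"]
    unfolding ideal_rel_def by blast
  have u: "(A \<union> C, B \<union> D) \<in> ideal_rel I J" if "(A, B) \<in> ideal_rel I J" "(C, D) \<in> ideal_rel I J" for A B C D
    using that ideal_subset_Un[OF ideal, of "A - B \<union> (B - A)" "C - D \<union> (D - C)" "(A \<union> C) - (B \<union> D) \<union> ((B \<union> D) - (A \<union> C))"]
    unfolding ideal_rel_def by blast
  show ?thesis using assms len
    by (cases "(I, f, As)" rule: pow_op.cases; cases "(I, f, Bs)" rule: pow_op.cases) (auto intro: r c m u)
qed

lemma fun_interp_pow_quotient:
  assumes "set As \<subseteq> Pow I"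
  shows "fun_interp (pow_quotient I J) f (map (pcl I J) As) = pcl I J (pow_op I f As)"
proof -
  have eq: "pcl I J (pow_op I f Bs) = pcl I J (pow_op I f As)" if "Bs \<in> listset (map (pcl I J) As)" for Bs
  proof -
    have "list_all2 (\<lambda>A B. (A, B) \<in> ideal_rel I J) As Bs"
      using that by (auto simp: listset_iff list.rel_map mem_pcl list_all2_conv_all_nth)
    from pow_op_cong[OF this, of f] show ?thesis
      unfolding pcl_def by (metis equiv_class_eq[OF equiv_ideal_rel])
  qed
  have mem: "As \<in> listset (map (pcl I J) As)"
  proof -
    have "A \<in> pcl I J A" if "A \<in> set As" for A
      using assms that ideal_onD(1)[OF ideal] by (auto simp: mem_pcl ideal_rel_def)
    then show ?thesis by (simp add: listset_iff list_all2_conv_all_nth)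
  qed
  have "fun_interp (pow_quotient I J) f (map (pcl I J) As) =
      (\<Union>Bs \<in> listset (map (pcl I J) As). pcl I J (pow_op I f Bs))"
    by (simp add: pow_quotient_def pcl_def)
  also have "(\<Union>Bs \<in> listset (map (pcl I J) As). pcl I J (pow_op I f Bs)) = pcl I J (pow_op I f As)"
    by (rule equalityI[OF UN_least UN_upper[OF mem]]) (rule equalityD1[OF eq])
  finally show ?thesis .
qed

lemma eval_pow_quotient:
  assumes "range e \<subseteq> Pow I"
  shows "eval_tm (pow_quotient I J) (\<lambda>v. pcl I J (e v)) t = pcl I J (peval I e t)"
proof (induction t)
  case (Fn f ts)
  have "map (eval_tm (pow_quotient I J) (\<lambda>v. pcl I J (e v))) ts = map (pcl I J) (map (peval I e) ts)"
    using Fn.IH by simp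
  moreover have "set (map (peval I e) ts) \<subseteq> Pow I" using peval_subset[OF assms] by auto
  ultimately show ?case by (simp only: eval_tm.simps peval.simps fun_interp_pow_quotient)
qed simp

text \<open>A cell for \<open>W\<close> is a finite union of cells for \<open>V\<close>, and is null
  iff all of them are.\<close>

lemma same_cells_mono:
  assumes "same_cells I J V e e'" "finite V" "W \<subseteq> V"
  shows "same_cells I J W e e'"
proof -
  have 1: "cell I e W S = \<Union>(cell I e V ` {T. T \<subseteq> V \<and> T \<inter> W = S})" if "S \<subseteq> W" for e S
  proof (intro equalityI subsetI)
    fix i assume "i \<in> cell I e W S"
    then have "i \<in> cell I e V {v \<in> V. i \<in> e v}" "{v \<in> V. i \<in> e v} \<inter> W = S"
      using assms(3) by (auto simp: cell_def)
    then show "i \<in> \<Union>(cell I e V ` {T. T \<subseteq> V \<and> T \<inter> W = S})"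
      by (intro UN_I[of "{v \<in> V. i \<in> e v}"]) auto
  next
    fix i assume "i \<in> \<Union>(cell I e V ` {T. T \<subseteq> V \<and> T \<inter> W = S})"
    then have "i \<in> I" "{v \<in> V. i \<in> e v} \<inter> W = S" by (auto simp: cell_def)
    then show "i \<in> cell I e W S" using assms(3) by (auto simp: cell_def)
  qed
  have *: "cell I e' W S \<in> J" if "cell I e W S \<in> J" "S \<subseteq> W" "same_cells I J V e e'" for S e e'
  proof -
    have "cell I e' V T \<in> J" if T: "T \<subseteq> V" "T \<inter> W = S" for T
    proof -
      have "cell I e V T \<subseteq> cell I e W S" using T unfolding 1[OF \<open>S \<subseteq> W\<close>] by blast
      then have "cell I e V T \<in> J" using \<open>cell I e W S \<in> J\<close> ideal_onD(2)[OF ideal] by blast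
      then show ?thesis using \<open>same_cells I J V e e'\<close> T by (auto simp: same_cells_def)
    qed
    moreover have "finite {T. T \<subseteq> V \<and> T \<inter> W = S}" using assms(2) by simp
    ultimately show ?thesis unfolding 1[OF \<open>S \<subseteq> W\<close>]
      by (intro ideal_finite_Union[OF ideal]) auto
  qed
  show ?thesis unfolding same_cells_def
    using *[OF _ _ assms(1)] *[OF _ _ same_cells_sym[OF assms(1)]] by blast
qed

lemma cell_insert:
  assumes "v \<notin> W" "S \<subseteq> W"
  shows "cell I (e(v := X)) (insert v W) (insert v S) = cell I e W S \<inter> X"
    and "cell I (e(v := X)) (insert v W) S = cell I e W S - X"
proof -
  have "{w \<in> insert v W. i \<in> (e(v := X)) w} = {w \<in> W. i \<in> e w} \<union> (if i \<in> X then {v} else {})" for i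
    using assms by auto
  moreover have "v \<notin> {w \<in> W. i \<in> e w}" "v \<notin> S" for i using assms by auto
  ultimately show "cell I (e(v := X)) (insert v W) (insert v S) = cell I e W S \<inter> X"
    "cell I (e(v := X)) (insert v W) S = cell I e W S - X"
    unfolding cell_def by (auto simp: insert_eq_iff)
qed

lemma same_cells_insert:
  assumes "v \<notin> W"
  shows "same_cells I J (insert v W) (e(v := X)) (e'(v := X')) \<longleftrightarrow>
    (\<forall>S \<subseteq> W. (cell I e W S \<inter> X \<in> J \<longleftrightarrow> cell I e' W S \<inter> X' \<in> J) \<and>
              (cell I e W S - X \<in> J \<longleftrightarrow> cell I e' W S - X' \<in> J))" (is "?L \<longleftrightarrow> ?R")
proof
  assume L: ?L
  show ?R
  proof (intro allI impI)
    fix S assume S: "S \<subseteq> W"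
    then show "(cell I e W S \<inter> X \<in> J \<longleftrightarrow> cell I e' W S \<inter> X' \<in> J) \<and>
              (cell I e W S - X \<in> J \<longleftrightarrow> cell I e' W S - X' \<in> J)"
      using L[unfolded same_cells_def, rule_format, of S] L[unfolded same_cells_def, rule_format, of "insert v S"]
      unfolding cell_insert[OF assms S] by auto
  qed
next
  assume R: ?R
  show ?L
    unfolding same_cells_def
  proof (intro allI impI)
    fix T assume T: "T \<subseteq> insert v W"
    show "(cell I (e(v := X)) (insert v W) T \<in> J) = (cell I (e'(v := X')) (insert v W) T \<in> J)"
    proof (cases "v \<in> T")
      case True
      then obtain S where S: "T = insert v S" "S \<subseteq> W" using T by (metis Set.set_insert subset_insert subset_insert_iff Diff_insert_absorb)
      then show ?thesis using R unfolding S(1) cell_insert[OF assms S(2)] by blast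
    next
      case False
      then have "T \<subseteq> W" using T by blast
      then show ?thesis using R unfolding cell_insert[OF assms \<open>T \<subseteq> W\<close>] by blast
    qed
  qed
qed

text \<open>Inside a cell, \<open>X\<close> is null, conull or neither. This is imitated in the
  corresponding cell of \<open>e'\<close> by the empty set, by the whole cell, or by a splitting
  that atomlessness provides. Since cells are disjoint, the choices can be united to one
  \<open>X'\<close>.\<close>

lemma same_cells_extend:
  assumes at: "atomless_ideal I J" and same: "same_cells I J W e e'" "finite W" "v \<notin> W"
  obtains X' where "X' \<subseteq> I" "same_cells I J (insert v W) (e(v := X)) (e'(v := X'))"
proof -
  have "\<exists>Y \<subseteq> cell I e' W S. (cell I e W S \<inter> X \<in> J \<longleftrightarrow> Y \<in> J) \<and>
     (cell I e W S - X \<in> J \<longleftrightarrow> cell I e' W S - Y \<in> J)" if S: "S \<subseteq> W" for S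
  proof -
    let ?c = "cell I e W S" and ?c' = "cell I e' W S"
    have cc': "?c \<in> J \<longleftrightarrow> ?c' \<in> J" using same S by (auto simp: same_cells_def)
    have c: "?c \<in> J \<longleftrightarrow> ?c \<inter> X \<in> J \<and> ?c - X \<in> J"
      using ideal_onD(2)[OF ideal, of ?c "?c \<inter> X"] ideal_onD(2)[OF ideal, of ?c "?c - X"]
        ideal_subset_Un[OF ideal, of "?c \<inter> X" "?c - X" ?c] by blast
    consider "?c \<inter> X \<in> J" | "?c \<inter> X \<notin> J" "?c - X \<in> J" | "?c \<inter> X \<notin> J" "?c - X \<notin> J" by blast
    then show ?thesis
    proof cases
      case 1
      then show ?thesis using c cc' ideal_onD(1)[OF ideal] by (intro exI[of _ "{}"]) auto
    next
      case 2
      then show ?thesis using c cc' ideal_onD(1)[OF ideal] by (intro exI[of _ ?c']) auto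
    next
      case 3
      have "?c' \<notin> J" "?c' \<subseteq> I" using 3 c cc' by (auto simp: cell_def)
      then obtain Y where "Y \<subseteq> ?c'" "Y \<notin> J" "?c' - Y \<notin> J"
        using at unfolding atomless_ideal_def by blast
      then show ?thesis using 3 by (intro exI[of _ Y]) auto
    qed
  qed
  then obtain Y where Y: "\<And>S. S \<subseteq> W \<Longrightarrow> Y S \<subseteq> cell I e' W S \<and> (cell I e W S \<inter> X \<in> J \<longleftrightarrow> Y S \<in> J) \<and>
     (cell I e W S - X \<in> J \<longleftrightarrow> cell I e' W S - Y S \<in> J)" by metis
  define X' where "X' = \<Union>(Y ` Pow W)"
  have disj: "cell I e' W S \<inter> cell I e' W T = {}" if "S \<noteq> T" for S T
    using that by (auto simp: cell_def)
  have X': "cell I e' W S \<inter> X' = Y S" if S: "S \<subseteq> W" for S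
  proof
    show "cell I e' W S \<inter> X' \<subseteq> Y S"
    proof
      fix i assume i: "i \<in> cell I e' W S \<inter> X'"
      then obtain T where T: "T \<subseteq> W" "i \<in> Y T" by (auto simp: X'_def)
      then have "i \<in> cell I e' W T" using Y by blast
      then have "S = T" using i disj by blast
      then show "i \<in> Y S" using T by simp
    qed
    show "Y S \<subseteq> cell I e' W S \<inter> X'" using Y[OF S] S by (auto simp: X'_def)
  qed
  have X'': "cell I e' W S - X' = cell I e' W S - Y S" if "S \<subseteq> W" for S
    using X'[OF that] by blast
  show ?thesis
  proof (rule that[of X'])
    have "Y S \<subseteq> I" if "S \<subseteq> W" for S
      using Y[OF that] by (auto simp: cell_def)
    then show "X' \<subseteq> I" by (auto simp: X'_def)
    show "same_cells I J (insert v W) (e(v := X)) (e'(v := X'))"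
      unfolding same_cells_insert[OF same(3)]
    proof (intro allI impI)
      fix S assume S: "S \<subseteq> W"
      show "(cell I e W S \<inter> X \<in> J \<longleftrightarrow> cell I e' W S \<inter> X' \<in> J) \<and>
              (cell I e W S - X \<in> J \<longleftrightarrow> cell I e' W S - X' \<in> J)"
        unfolding X'[OF S] X''[OF S] using Y[OF S] by blast
    qed
  qed
qed

lemma pcl_upd: "(\<lambda>w. pcl I J (e w))(v := pcl I J X) = (\<lambda>w. pcl I J ((e(v := X)) w))"
  by (simp add: fun_eq_iff)

text \<open>Back and forth: the type of a finite tuple in an atomless quotient is determined by which of
  its cells vanish.\<close>

lemma sat_same_cells:
  assumes at: "atomless_ideal I J"
  shows "finite V \<Longrightarrow> fv \<phi> \<subseteq> V \<Longrightarrow> range e \<subseteq> Pow I \<Longrightarrow> range e' \<subseteq> Pow I \<Longrightarrow> wf_fm ba_language \<phi> \<Longrightarrow>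
    same_cells I J V e e' \<Longrightarrow>
    sat (pow_quotient I J) (\<lambda>v. pcl I J (e v)) \<phi> \<longleftrightarrow> sat (pow_quotient I J) (\<lambda>v. pcl I J (e' v)) \<phi>"
proof (induction \<phi> arbitrary: V e e')
  case (Eq s t)
  let ?D = "\<lambda>e. (peval I e s - peval I e t) \<union> (peval I e t - peval I e s)"
  have *: "?D e' \<in> J" if same: "same_cells I J V e e'" and D: "?D e \<in> J"
    and e: "range e \<subseteq> Pow I" "range e' \<subseteq> Pow I" for e e'
  proof -
    \<comment> \<open>On a cell the symmetric difference of the two values is all or nothing, so it
      suffices to compare the cells that meet it.\<close>
    let ?T = "{S. S \<subseteq> V \<and> cell I e' V S \<inter> ?D e' \<noteq> {}}"
    have "cell I e' V S \<in> J" if ST: "S \<in> ?T" for S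
    proof -
      obtain j where j: "j \<in> cell I e' V S" "j \<in> ?D e'" using ST by blast
      have "i \<in> ?D e" if i: "i \<in> cell I e V S" for i
      proof -
        have ij: "i \<in> I" "j \<in> I" "\<And>v. v \<in> V \<Longrightarrow> i \<in> e v \<longleftrightarrow> j \<in> e' v" using i j by (auto simp: cell_def)
        have "i \<in> peval I e s \<longleftrightarrow> j \<in> peval I e' s" "i \<in> peval I e t \<longleftrightarrow> j \<in> peval I e' t"
          using Eq.prems(2) ij(3) by (intro peval_local ij(1,2); auto)+
        then show ?thesis using j by blast
      qed
      then have "cell I e V S \<in> J" using ideal_onD(2)[OF ideal D] by blast
      then show ?thesis using same ST by (auto simp: same_cells_def)
    qed
    moreover have "finite ?T" using Eq.prems(1) by simp
    ultimately have "\<Union>(cell I e' V ` ?T) \<in> J" by (intro ideal_finite_Union[OF ideal]) auto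
    moreover have "?D e' \<subseteq> \<Union>(cell I e' V ` ?T)"
    proof
      fix j assume j: "j \<in> ?D e'"
      then have "j \<in> I" using peval_subset[OF e(2)] by blast
      then have "j \<in> cell I e' V {v \<in> V. j \<in> e' v}" by (simp add: cell_def)
      then show "j \<in> \<Union>(cell I e' V ` ?T)" using j by (intro UN_I[of "{v \<in> V. j \<in> e' v}"]) auto
    qed
    ultimately show ?thesis by (rule ideal_onD(2)[OF ideal])
  qed
  have "?D e \<in> J \<longleftrightarrow> ?D e' \<in> J"
    using *[OF Eq.prems(6) _ Eq.prems(3,4)] *[OF same_cells_sym[OF Eq.prems(6)] _ Eq.prems(4,3)] by blast
  then show ?case
    using Eq.prems by (simp add: eval_pow_quotient pcl_eq_iff peval_subset)
next
  case (Rel r ts)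
  then show ?case by (simp add: ba_language_def)
next
  case (Neg \<phi>)
  show ?case using Neg.IH[of V e e'] Neg.prems by simp
next
  case (And \<phi> \<psi>)
  show ?case using And.IH(1)[of V e e'] And.IH(2)[of V e e'] And.prems by simp
next
  case (Ex v \<phi>)
  \<comment> \<open>\<open>V\<close> may contain \<open>v\<close> with a value that has nothing to
    do with the quantified one; it is forgotten here and put back by the extension step.\<close>
  define W where "W = V - {v}"
  have W: "finite W" "v \<notin> W" "fv \<phi> \<subseteq> insert v W" using Ex.prems by (auto simp: W_def)
  have same: "same_cells I J W e e'" by (rule same_cells_mono[OF Ex.prems(6,1)]) (auto simp: W_def)
  have *: "sat (pow_quotient I J) (\<lambda>v. pcl I J (e' v)) (Ex v \<phi>)"
    if same: "same_cells I J W e e'" and e: "range e \<subseteq> Pow I" "range e' \<subseteq> Pow I"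
      and s: "sat (pow_quotient I J) (\<lambda>v. pcl I J (e v)) (Ex v \<phi>)" for e e'
  proof -
    obtain X where X: "X \<subseteq> I" "sat (pow_quotient I J) ((\<lambda>v. pcl I J (e v))(v := pcl I J X)) \<phi>"
      using s by (auto simp: univ_pow_quotient simp del: fun_upd_apply)
    obtain X' where X': "X' \<subseteq> I" "same_cells I J (insert v W) (e(v := X)) (e'(v := X'))"
      using same_cells_extend[OF at same W(1,2)] by metis
    have "sat (pow_quotient I J) (\<lambda>w. pcl I J ((e'(v := X')) w)) \<phi>"
    proof (rule iffD1[OF Ex.IH[OF _ W(3) _ _ _ X'(2)]])
      show "range (e(v := X)) \<subseteq> Pow I" "range (e'(v := X')) \<subseteq> Pow I" 
        using e X(1) X'(1) by (auto simp: image_subset_iff)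
      show "sat (pow_quotient I J) (\<lambda>w. pcl I J ((e(v := X)) w)) \<phi>" using X(2) unfolding pcl_upd .
    qed (use W Ex.prems in auto)
    then have "sat (pow_quotient I J) ((\<lambda>v. pcl I J (e' v))(v := pcl I J X')) \<phi>" unfolding pcl_upd .
    moreover have "pcl I J X' \<in> univ (pow_quotient I J)" using X' by (auto simp: univ_pow_quotient)
    ultimately show ?thesis unfolding sat.simps by blast
  qed
  show ?case
    using *[OF same Ex.prems(3,4)] *[OF same_cells_sym[OF same] Ex.prems(4,3)] by blast
qed

lemma cell_in_algebra:
  assumes "finite W" "S \<subseteq> W" "\<forall>v \<in> W. e v \<in> C" "I \<in> C" "\<forall>X \<in> C. \<forall>Y \<in> C. X - Y \<in> C" "C \<subseteq> Pow I"
  shows "cell I e W S \<in> C"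
  using assms(1-3)
proof (induction W arbitrary: S)
  case empty
  then show ?case using assms(4) by (simp add: cell_def)
next
  case (insert v W)
  have e: "e(v := e v) = e" by simp
  show ?case
  proof (cases "v \<in> S")
    case True
    let ?S = "S - {v}"
    have S: "?S \<subseteq> W" "insert v ?S = S" using insert.prems True by auto
    have "cell I e W ?S \<in> C" using insert S by auto
    moreover have "e v \<in> C" using insert by auto
    moreover have "cell I e W ?S \<inter> e v = cell I e W ?S - (cell I e W ?S - e v)" by blast
    ultimately have "cell I e W ?S \<inter> e v \<in> C" using assms(5) by metis
    then show ?thesis using cell_insert(1)[OF insert.hyps(2) S(1), of e "e v"] unfolding e S(2) by simp
  next
    case False
    then have S: "S \<subseteq> W" using insert.prems by auto
    then have "cell I e W S - e v \<in> C" using insert assms(5) by auto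
    then show ?thesis using cell_insert(2)[OF insert.hyps(2) S, of e "e v"] unfolding e by simp
  qed
qed

end

section \<open>Realising types over an atomless quotient\<close>

lemma ultrafilter_upward:
  assumes "\<forall>F \<subseteq> \<U>. finite F \<longrightarrow> \<Inter>F \<noteq> {}" "\<forall>S. S \<in> \<U> \<or> - S \<in> \<U>" "S \<in> \<U>" "T \<in> \<U>" "S \<inter> T \<subseteq> R"
  shows "R \<in> \<U>"
proof (rule ccontr)
  assume "R \<notin> \<U>"
  then have "{S, T, - R} \<subseteq> \<U>" using assms(2-4) by blast
  then have "\<Inter>{S, T, - R} \<noteq> {}" using assms(1) by blast
  then show False using assms(5) by auto
qed

text \<open>By back and forth, \<open>X\<close> realises \<open>p\<close> once it is prescribed
  suitably, for each \<open>c\<close> in the algebra \<open>C'\<close> generated by representatives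
  of the parameters, whether \<open>c \<inter> X\<close> and \<open>c - X\<close> are null. An
  ultrafilter of candidate sets containing all solution sets gives such a prescription, coherent
  with every formula of \<open>p\<close>. It sorts \<open>C'\<close> into sets to be put below
  \<open>X\<close>, sets to be put outside, and sets to be split if those two kinds do not already
  cover them.\<close>

lemma saturated_pow_quotient:
  assumes ideal: "ideal_on I J" and at: "atomless_ideal I J"
    and \<kappa>: "Card_order \<kappa>" "infinite (Field \<kappa>)"
    and lower: "lower_bound_property \<kappa> I J" and sep: "separation_property \<kappa> I J"
  shows "saturated \<kappa> ba_language (pow_quotient I J)"
  unfolding saturated_def
proof (intro allI impI)
  let ?M = "pow_quotient I J"
  note univ = univ_pow_quotient[OF ideal]
  fix C p assume C: "C \<subseteq> univ ?M" "|C| <o \<kappa>" and p: "p \<subseteq> param_formulas ba_language C" "consistent ?M p"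
  \<comment> \<open>The default \<open>{}\<close> ensures \<open>r c \<subseteq> I\<close> also at
    values outside the quotient, which an assignment may take at irrelevant variables.\<close>
  define r where "r c = (if c \<in> univ ?M then SOME X. X \<subseteq> I \<and> pcl I J X = c else {})" for c
  have r': "r c \<subseteq> I \<and> pcl I J (r c) = c" if c: "c \<in> univ ?M" for c
  proof -
    have "\<exists>X. X \<subseteq> I \<and> pcl I J X = c" using c unfolding univ by blast
    from someI_ex[OF this] show ?thesis using c by (simp add: r_def)
  qed
  have r: "r c \<subseteq> I" for c using r' by (cases "c \<in> univ ?M") (auto simp: r_def)
  have sat_r: "sat ?M (e(0 := pcl I J X)) \<phi> \<longleftrightarrow> sat ?M (\<lambda>v. pcl I J (((\<lambda>v. r (e v))(0 := X)) v)) \<phi>"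
    if "(\<phi>, e) \<in> p" for \<phi> e X
  proof (rule sat_cong)
    fix v assume "v \<in> fv \<phi>"
    then have "v \<noteq> 0 \<Longrightarrow> e v \<in> univ ?M" using that p(1) C(1) by (auto simp: param_formulas_def)
    then show "(e(0 := pcl I J X)) v = pcl I J (((\<lambda>v. r (e v))(0 := X)) v)"
      using r' by auto
  qed
  have rC: "r ` C \<subseteq> Pow I" "|r ` C| <o \<kappa>" using r small_image[OF C(2)] by auto
  obtain C' where C': "r ` C \<subseteq> C'" "C' \<subseteq> Pow I" "|C'| <o \<kappa>" "I \<in> C'" "\<forall>X \<in> C'. \<forall>Y \<in> C'. X - Y \<in> C'"
    using small_set_algebra[OF \<kappa> rC] by metis
  have Un: "X \<union> Y \<in> C'" if "X \<in> C'" "Y \<in> C'" for X Y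
  proof -
    have "I - ((I - X) - Y) \<in> C'" using C'(4,5) that by blast
    moreover have "I - ((I - X) - Y) = X \<union> Y" using that C'(2) by blast
    ultimately show ?thesis by simp
  qed
  have empty: "{} \<in> C'" using C'(4,5) by (metis Diff_cancel)

  define Sol where "Sol = (\<lambda>(\<phi>, e). {X. X \<subseteq> I \<and> sat ?M (e(0 := pcl I J X)) \<phi>})"
  have "\<forall>F \<subseteq> Sol ` p. finite F \<longrightarrow> \<Inter>F \<noteq> {}"
  proof (intro allI impI)
    fix F assume "F \<subseteq> Sol ` p" "finite F"
    then obtain q where q: "q \<subseteq> p" "finite q" "F = Sol ` q" by (meson finite_subset_image)
    then have "realised ?M q" using p(2) by (auto simp: consistent_def)
    then obtain X where X: "X \<subseteq> I" "\<forall>(\<phi>, e) \<in> q. sat ?M (e(0 := pcl I J X)) \<phi>"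
      unfolding realised_def univ by blast
    then have "X \<in> \<Inter>F" unfolding q(3) Sol_def by blast
    then show "\<Inter>F \<noteq> {}" by blast
  qed
  from ultrafilter_extension[OF this] obtain \<U> where U: "Sol ` p \<subseteq> \<U>"
    "\<forall>F \<subseteq> \<U>. finite F \<longrightarrow> \<Inter>F \<noteq> {}" "\<forall>S. S \<in> \<U> \<or> - S \<in> \<U>" by metis
  note up = ultrafilter_upward[OF U(2,3)]
  \<comment> \<open>In the sense of \<open>\<U>\<close>, almost every candidate agrees with the
    verdict of \<open>\<U>\<close> on \<open>P\<close>.\<close>
  have Uc: "{X. P X \<longleftrightarrow> {X. P X} \<in> \<U>} \<in> \<U>" for P :: "'a set \<Rightarrow> bool"
  proof (cases "{X. P X} \<in> \<U>")
    case False
    then have "- {X. P X} \<in> \<U>" using U(3) by blast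
    moreover have "- {X. P X} = {X. P X \<longleftrightarrow> {X. P X} \<in> \<U>}" using False by auto
    ultimately show ?thesis by simp
  qed simp
  have "{} \<notin> \<U>"
  proof
    assume "{} \<in> \<U>"
    then have "\<Inter>{{}} \<noteq> ({} :: 'a set set)" using U(2)[rule_format, of "{{}}"] by blast
    then show False by simp
  qed
  then have UNIV: "UNIV \<in> \<U>" using U(3)[rule_format, of UNIV] by simp

  define \<A> where "\<A> = {c \<in> C'. {X. c - X \<in> J} \<in> \<U>}"
  define \<B> where "\<B> = {c \<in> C'. {X. c \<inter> X \<in> J} \<in> \<U>}"
  \<comment> \<open>A set outside \<open>\<D>\<close> is almost covered by some
    \<open>A \<union> B\<close>, and its relation to \<open>X\<close> then follows from those of
    \<open>\<A>\<close> and \<open>\<B>\<close>. Only \<open>\<D>\<close> has to be split.\<close>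
  define \<D> where "\<D> = {d \<in> C'. \<forall>A \<in> \<A>. \<forall>B \<in> \<B>. d - (A \<union> B) \<notin> J}"
  note J = ideal_onD[OF ideal] and JUn = ideal_subset_Un[OF ideal]
  obtain X where X: "X \<subseteq> I" "\<forall>A \<in> \<A>. A - X \<in> J" "\<forall>B \<in> \<B>. B \<inter> X \<in> J" "\<forall>D \<in> \<D>. D \<inter> X \<notin> J \<and> D - X \<notin> J"
  proof (rule separating_and_splitting_set[OF ideal at \<kappa> lower sep, of \<A> \<B> \<D>])
    have sub: "\<A> \<subseteq> C'" "\<B> \<subseteq> C'" "\<D> \<subseteq> C'" by (auto simp: \<A>_def \<B>_def \<D>_def)
    show "|\<A>| <o \<kappa>" "|\<B>| <o \<kappa>" "|\<D>| <o \<kappa>"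
      by (rule small_subset[OF C'(3) sub(1)], rule small_subset[OF C'(3) sub(2)], rule small_subset[OF C'(3) sub(3)])
    show "\<A> \<subseteq> Pow I" "\<B> \<subseteq> Pow I" "\<D> \<subseteq> Pow I" using sub C'(2) by blast+
    have "{} \<in> \<A>" "{} \<in> \<B>" using empty J(1) UNIV by (auto simp: \<A>_def \<B>_def)
    then show "\<A> \<noteq> {}" "\<B> \<noteq> {}" by blast+
    show "A \<union> A' \<in> \<A>" if "A \<in> \<A>" "A' \<in> \<A>" for A A'
    proof -
      have "{X. A - X \<in> J} \<inter> {X. A' - X \<in> J} \<subseteq> {X. (A \<union> A') - X \<in> J}"
        by (auto simp: Un_Diff intro: J(3))
      then show ?thesis using that up[of "{X. A - X \<in> J}" "{X. A' - X \<in> J}"] Un by (auto simp: \<A>_def)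
    qed
    show "B \<union> B' \<in> \<B>" if "B \<in> \<B>" "B' \<in> \<B>" for B B'
    proof -
      have "{X. B \<inter> X \<in> J} \<inter> {X. B' \<inter> X \<in> J} \<subseteq> {X. (B \<union> B') \<inter> X \<in> J}"
        by (auto simp: Int_Un_distrib2 intro: J(3))
      then show ?thesis using that up[of "{X. B \<inter> X \<in> J}" "{X. B' \<inter> X \<in> J}"] Un by (auto simp: \<B>_def)
    qed
    show "A \<inter> B \<in> J" if "A \<in> \<A>" "B \<in> \<B>" for A B
    proof -
      have "{{X. A - X \<in> J}, {X. B \<inter> X \<in> J}} \<subseteq> \<U>" using that by (auto simp: \<A>_def \<B>_def)
      then have "\<Inter>{{X. A - X \<in> J}, {X. B \<inter> X \<in> J}} \<noteq> {}" using U(2) by blast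
      then obtain Y where "A - Y \<in> J" "B \<inter> Y \<in> J" by auto
      then show ?thesis by (rule JUn) blast
    qed
    show "D - (A \<union> B) \<notin> J" if "A \<in> \<A>" "B \<in> \<B>" "D \<in> \<D>" for A B D
      using that by (auto simp: \<D>_def)
  qed (rule that)
  have cov: "\<exists>A \<in> \<A>. \<exists>B \<in> \<B>. c - (A \<union> B) \<in> J" if "c \<in> C'" "c \<notin> \<D>" for c
    using that by (auto simp: \<D>_def)
  have XB: "c \<inter> X \<in> J \<longleftrightarrow> {Y. c \<inter> Y \<in> J} \<in> \<U>" if c: "c \<in> C'" for c
  proof
    assume "{Y. c \<inter> Y \<in> J} \<in> \<U>"
    then show "c \<inter> X \<in> J" using c X(3) by (auto simp: \<B>_def)
  next
    assume cX: "c \<inter> X \<in> J"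
    then have "c \<notin> \<D>" using X(4) by blast
    then obtain A B where AB: "A \<in> \<A>" "B \<in> \<B>" "c - (A \<union> B) \<in> J" using cov c by blast
    \<comment> \<open>Up to \<open>J\<close>, \<open>c - B\<close> is contained in \<open>A\<close>,
      so it is to lie below \<open>X\<close>. As \<open>c\<close> almost misses \<open>X\<close>,
      this makes \<open>c - B\<close> null, and \<open>c\<close> inherits from \<open>B\<close> the
      verdict of being outside.\<close>
    have "{Y. A - Y \<in> J} \<subseteq> {Y. (c - B) - Y \<in> J}"
      by (clarify, rule JUn[OF AB(3)], assumption) blast
    then have "{Y. (c - B) - Y \<in> J} \<in> \<U>"
      using AB(1) up[of "{Y. A - Y \<in> J}" "{Y. A - Y \<in> J}"] by (auto simp: \<A>_def)
    moreover have "c - B \<in> C'" using c AB(2) C'(5) by (auto simp: \<B>_def)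
    ultimately have "(c - B) - X \<in> J" using X(2) by (auto simp: \<A>_def)
    then have cJ: "c - B \<in> J" by (rule JUn[OF cX]) blast
    have "{Y. B \<inter> Y \<in> J} \<subseteq> {Y. c \<inter> Y \<in> J}" 
      by (clarify, rule JUn[OF cJ], assumption) blast
    then show "{Y. c \<inter> Y \<in> J} \<in> \<U>"
      using AB(2) up[of "{Y. B \<inter> Y \<in> J}" "{Y. B \<inter> Y \<in> J}"] by (auto simp: \<B>_def)
  qed
  have XA: "c - X \<in> J \<longleftrightarrow> {Y. c - Y \<in> J} \<in> \<U>" if c: "c \<in> C'" for c
  proof
    assume "{Y. c - Y \<in> J} \<in> \<U>"
    then show "c - X \<in> J" using c X(2) by (auto simp: \<A>_def)
  next
    assume cX: "c - X \<in> J"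
    then have "c \<notin> \<D>" using X(4) by blast
    then obtain A B where AB: "A \<in> \<A>" "B \<in> \<B>" "c - (A \<union> B) \<in> J" using cov c by blast
    have "{Y. B \<inter> Y \<in> J} \<subseteq> {Y. (c - A) \<inter> Y \<in> J}"
      by (clarify, rule JUn[OF AB(3)], assumption) blast
    then have "{Y. (c - A) \<inter> Y \<in> J} \<in> \<U>"
      using AB(2) up[of "{Y. B \<inter> Y \<in> J}" "{Y. B \<inter> Y \<in> J}"] by (auto simp: \<B>_def)
    moreover have "c - A \<in> C'" using c AB(1) C'(5) by (auto simp: \<A>_def)
    ultimately have "(c - A) \<inter> X \<in> J" using X(3) by (auto simp: \<B>_def)
    then have cJ: "c - A \<in> J" by (rule JUn[OF cX]) blast
    have "{Y. A - Y \<in> J} \<subseteq> {Y. c - Y \<in> J}" 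
      by (clarify, rule JUn[OF cJ], assumption) blast
    then show "{Y. c - Y \<in> J} \<in> \<U>"
      using AB(1) up[of "{Y. A - Y \<in> J}" "{Y. A - Y \<in> J}"] by (auto simp: \<A>_def)
  qed
  have "sat ?M (e(0 := pcl I J X)) \<phi>" if \<phi>: "(\<phi>, e) \<in> p" for \<phi> e
  proof -
    define W where "W = fv \<phi> - {0}"
    have W: "finite W" "0 \<notin> W" "fv \<phi> \<subseteq> insert 0 W" by (auto simp: W_def finite_fv)
    have wf: "wf_fm ba_language \<phi>" and eC: "\<forall>v \<in> W. e v \<in> C"
      using \<phi> p(1) by (auto simp: param_formulas_def W_def)
    let ?e = "\<lambda>v. r (e v)"
    have cells: "cell I ?e W S \<in> C'" if "S \<subseteq> W" for S
      using eC C'(1) by (intro cell_in_algebra[OF ideal W(1) that _ C'(4,5,2)]) blast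
    \<comment> \<open>These are finitely many members of \<open>\<U>\<close>: a common element
      solves \<open>\<phi>\<close> and obeys the verdicts on all cells of its parameters, hence has
      the same cells as \<open>X\<close>.\<close>
    let ?F = "insert (Sol (\<phi>, e))
       ((\<lambda>S. {Y. cell I ?e W S \<inter> Y \<in> J \<longleftrightarrow> {Y. cell I ?e W S \<inter> Y \<in> J} \<in> \<U>}) ` Pow W \<union>
        (\<lambda>S. {Y. cell I ?e W S - Y \<in> J \<longleftrightarrow> {Y. cell I ?e W S - Y \<in> J} \<in> \<U>}) ` Pow W)"
    have "?F \<subseteq> \<U>"
    proof -
      have "Sol (\<phi>, e) \<in> \<U>" using U(1) \<phi> by blast
      then show ?thesis using Uc by (simp add: image_subset_iff)
    qed
    moreover have "finite ?F" using W(1) by simp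
    ultimately have "\<Inter>?F \<noteq> {}" using U(2) by blast
    then obtain Y where Y: "Y \<in> \<Inter>?F" by blast
    have YI: "Y \<subseteq> I" "sat ?M (e(0 := pcl I J Y)) \<phi>" using Y by (auto simp: Sol_def)
    have "same_cells I J (insert 0 W) (?e(0 := Y)) (?e(0 := X))"
      unfolding same_cells_insert[OF ideal W(2)]
    proof (intro allI impI)
      fix S assume S: "S \<subseteq> W"
      have "cell I ?e W S \<inter> Y \<in> J \<longleftrightarrow> {Y. cell I ?e W S \<inter> Y \<in> J} \<in> \<U>"
        "cell I ?e W S - Y \<in> J \<longleftrightarrow> {Y. cell I ?e W S - Y \<in> J} \<in> \<U>"
        using Y S by (simp_all add: ball_Un)
      then show "(cell I ?e W S \<inter> Y \<in> J \<longleftrightarrow> cell I ?e W S \<inter> X \<in> J) \<and> (cell I ?e W S - Y \<in> J \<longleftrightarrow> cell I ?e W S - X \<in> J)"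
        using XA[OF cells[OF S]] XB[OF cells[OF S]] by blast
    qed
    moreover have "range (?e(0 := Y)) \<subseteq> Pow I" "range (?e(0 := X)) \<subseteq> Pow I"
      using r YI(1) X(1) by (auto simp: image_subset_iff)
    moreover have "sat ?M (\<lambda>v. pcl I J ((?e(0 := Y)) v)) \<phi>" using YI(2) sat_r[OF \<phi>] by blast
    ultimately have "sat ?M (\<lambda>v. pcl I J ((?e(0 := X)) v)) \<phi>"
      using sat_same_cells[OF ideal at _ W(3) _ _ wf] W(1) by blast
    then show ?thesis using sat_r[OF \<phi>] by blast
  qed
  then show "realised ?M p"
    unfolding realised_def using X(1) by (intro bexI[of _ "pcl I J X"]) (auto simp: univ)
qed

section \<open>Reduced products and h-formulas\<close>

definition himp :: "nat \<Rightarrow> ('f, 'p) fm \<Rightarrow> ('f, 'p) fm \<Rightarrow> ('f, 'p) fm" where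
  "himp v \<theta> \<eta> = And (Ex v \<theta>) (Neg (Ex v (And \<theta> (Neg \<eta>))))"

inductive hfm :: "('f, 'p) fm \<Rightarrow> bool" where
  "hfm (Eq s t)"
| "hfm (Rel r ts)"
| "hfm \<theta> \<Longrightarrow> hfm \<eta> \<Longrightarrow> hfm (And \<theta> \<eta>)"
| "hfm \<theta> \<Longrightarrow> hfm (Ex v \<theta>)"
| "hfm \<theta> \<Longrightarrow> hfm \<eta> \<Longrightarrow> hfm (himp v \<theta> \<eta>)"

lemma sat_himp:
  "sat M e (himp v \<theta> \<eta>) \<longleftrightarrow>
    (\<exists>a \<in> univ M. sat M (e(v := a)) \<theta>) \<and> (\<forall>a \<in> univ M. sat M (e(v := a)) \<theta> \<longrightarrow> sat M (e(v := a)) \<eta>)"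
  by (auto simp: himp_def)

lemma wf_himp: "wf_fm L (himp v \<theta> \<eta>) \<longleftrightarrow> wf_fm L \<theta> \<and> wf_fm L \<eta>"
  by (auto simp: himp_def)

lemma fv_himp: "fv (himp v \<theta> \<eta>) = fv \<theta> \<union> fv \<eta> - {v}"
  by (auto simp: himp_def)

lemma hfm_conj: "(\<forall>\<phi> \<in> set \<phi>s. hfm \<phi>) \<Longrightarrow> hfm \<chi> \<Longrightarrow> hfm (conj \<phi>s \<chi>)"
  by (induction \<phi>s) (auto intro: hfm.intros)

lemma hfm_exs: "hfm \<phi> \<Longrightarrow> hfm (exs vs \<phi>)"
  by (induction vs) (auto intro: hfm.intros)

lemma hfm_ren: "hfm \<phi> \<Longrightarrow> hfm (ren \<pi> \<phi>)"
proof (induction rule: hfm.induct)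
  case (5 \<theta> \<eta> v)
  have "ren \<pi> (himp v \<theta> \<eta>) = himp (\<pi> v) (ren \<pi> \<theta>) (ren \<pi> \<eta>)" by (simp add: himp_def)
  then show ?case using 5 by (simp add: hfm.intros)
qed (auto intro: hfm.intros)

text \<open>Disjointness is exact here, not just modulo \<open>J\<close>, because elements will be
  glued along these sets. If the new \<open>D x\<close> almost avoids all pieces, its remainder is
  taken; otherwise its intersection with some \<open>E y\<close> is split between \<open>x\<close>
  and \<open>y\<close>.\<close>

lemma finite_disjoint_refinement:
  assumes ideal: "ideal_on I J" and at: "atomless_ideal I J" and "finite N"
    "\<forall>x \<in> N. D x \<subseteq> I \<and> D x \<notin> J"
  shows "\<exists>E. (\<forall>x \<in> N. E x \<subseteq> D x \<and> E x \<notin> J) \<and> (\<forall>x \<in> N. \<forall>y \<in> N. x \<noteq> y \<longrightarrow> E x \<inter> E y = {})"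
  using assms(3,4)
proof (induction N)
  case (insert x N)
  then obtain E where E: "\<forall>y \<in> N. E y \<subseteq> D y \<and> E y \<notin> J"
    "\<forall>y \<in> N. \<forall>z \<in> N. y \<noteq> z \<longrightarrow> E y \<inter> E z = {}" by auto
  have Dx: "D x \<subseteq> I" "D x \<notin> J" using insert.prems by auto
  show ?case
  proof (cases "\<exists>y \<in> N. D x \<inter> E y \<notin> J")
    case False
    then have "(\<lambda>y. D x \<inter> E y) ` N \<subseteq> J" by blast
    then have "\<Union>((\<lambda>y. D x \<inter> E y) ` N) \<in> J" using insert.hyps by (intro ideal_finite_Union[OF ideal]) auto
    then have "D x - \<Union>(E ` N) \<notin> J"
      using ideal_subset_Un[OF ideal, of "\<Union>((\<lambda>y. D x \<inter> E y) ` N)" "D x - \<Union>(E ` N)" "D x"] Dx by blast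
    then show ?thesis using E insert.hyps
      by (intro exI[of _ "E(x := D x - \<Union>(E ` N))"]) auto
  next
    case True
    then obtain y where y: "y \<in> N" "D x \<inter> E y \<notin> J" by blast
    have "D x \<inter> E y \<subseteq> I" using Dx(1) by blast
    then obtain Y where Y: "Y \<subseteq> D x \<inter> E y" "Y \<notin> J" "D x \<inter> E y - Y \<notin> J"
      using at[unfolded atomless_ideal_def, rule_format, OF _ y(2)] by metis
    have "E y - Y \<notin> J" using Y(3) ideal_onD(2)[OF ideal, of "E y - Y" "D x \<inter> E y - Y"] by blast
    moreover have "x \<noteq> y" using y insert.hyps by blast
    moreover have "z \<noteq> x \<and> (z \<noteq> y \<longrightarrow> E z \<inter> E y = {})" if "z \<in> N" for z
      using E(2) y(1) insert.hyps that by blast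
    ultimately have "\<forall>z \<in> insert x N. (E(x := Y, y := E y - Y)) z \<subseteq> D z \<and> (E(x := Y, y := E y - Y)) z \<notin> J"
      "\<forall>z \<in> insert x N. \<forall>z' \<in> insert x N. z \<noteq> z' \<longrightarrow>
        (E(x := Y, y := E y - Y)) z \<inter> (E(x := Y, y := E y - Y)) z' = {}"
      using E Y(1,2) y(1) by (auto; blast)+
    then show ?thesis by blast
  qed
qed simp

section \<open>Truth in a reduced product and truth in its coordinates\<close>

locale reduced_prod =
  fixes I :: "'i set" and J :: "'i set set" and L :: "('f, 'p) language"
    and M :: "'i \<Rightarrow> ('f, 'p, 'a) fo_struct"
  assumes ideal: "ideal_on I J" and struct: "\<And>i. i \<in> I \<Longrightarrow> is_struct L (M i)"
begin

abbreviation "PU \<equiv> product_univ I M"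
abbreviation "RP \<equiv> reduced_product I J M"

definition rcl :: "('i \<Rightarrow> 'a) \<Rightarrow> ('i \<Rightarrow> 'a) set" where
  "rcl a = reduced_rel I J M `` {a}"

text \<open>Recording failure instead of truth turns almost-everywhere truth into membership in
  \<open>J\<close>.\<close>

definition fails :: "('f, 'p) fm \<Rightarrow> (nat \<Rightarrow> 'i \<Rightarrow> 'a) \<Rightarrow> 'i set" where
  "fails \<phi> a = {i \<in> I. \<not> sat (M i) (\<lambda>v. a v i) \<phi>}"

lemma PU_univ: "a \<in> PU \<Longrightarrow> i \<in> I \<Longrightarrow> a i \<in> univ (M i)"
  by (auto simp: product_univ_def)

lemma equiv_reduced_rel: "equiv PU (reduced_rel I J M)"
proof (rule equivI)
  show "reduced_rel I J M \<subseteq> PU \<times> PU" by (auto simp: reduced_rel_def)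
  show "refl_on PU (reduced_rel I J M)" using ideal_onD(1)[OF ideal] by (auto simp: refl_on_def reduced_rel_def)
  show "sym (reduced_rel I J M)" by (auto simp: sym_def reduced_rel_def eq_commute)
  show "trans (reduced_rel I J M)"
  proof (rule transI)
    fix a b c assume "(a, b) \<in> reduced_rel I J M" "(b, c) \<in> reduced_rel I J M"
    then have ab: "a \<in> PU" "c \<in> PU" "{i \<in> I. a i \<noteq> b i} \<in> J" "{i \<in> I. b i \<noteq> c i} \<in> J"
      by (auto simp: reduced_rel_def)
    have "{i \<in> I. a i \<noteq> c i} \<in> J" by (rule ideal_subset_Un[OF ideal ab(3,4)]) auto
    then show "(a, c) \<in> reduced_rel I J M" using ab by (simp add: reduced_rel_def)
  qed
qed

lemma rcl_eq_iff: "a \<in> PU \<Longrightarrow> b \<in> PU \<Longrightarrow> rcl a = rcl b \<longleftrightarrow> {i \<in> I. a i \<noteq> b i} \<in> J"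
  unfolding rcl_def using eq_equiv_class_iff[OF equiv_reduced_rel, of a b] by (simp add: reduced_rel_def)

lemma mem_rcl: "b \<in> rcl a \<longleftrightarrow> a \<in> PU \<and> b \<in> PU \<and> {i \<in> I. a i \<noteq> b i} \<in> J"
  by (simp add: rcl_def reduced_rel_def)

lemma univ_RP: "univ RP = rcl ` PU"
  by (auto simp: reduced_product_def quotient_def rcl_def)

lemma listset_rcl:
  assumes "bs \<in> listset (map rcl as)"
  shows "length bs = length as" "set as \<subseteq> PU" "set bs \<subseteq> PU" "{i \<in> I. map (\<lambda>a. a i) as \<noteq> map (\<lambda>a. a i) bs} \<in> J"
proof -
  have *: "length bs = length as" "\<And>k. k < length as \<Longrightarrow> bs ! k \<in> rcl (as ! k)"
    using assms by (auto simp: listset_iff list_all2_conv_all_nth)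
  show "length bs = length as" "set as \<subseteq> PU" "set bs \<subseteq> PU"
    using * by (auto simp: mem_rcl set_conv_nth)
  have "(\<lambda>k. {i \<in> I. (as ! k) i \<noteq> (bs ! k) i}) ` {..<length as} \<subseteq> J"
    using * by (auto simp: mem_rcl)
  then have "\<Union>((\<lambda>k. {i \<in> I. (as ! k) i \<noteq> (bs ! k) i}) ` {..<length as}) \<in> J"
    by (intro ideal_finite_Union[OF ideal]) auto
  moreover have "{i \<in> I. map (\<lambda>a. a i) as \<noteq> map (\<lambda>a. a i) bs} \<subseteq>
     \<Union>((\<lambda>k. {i \<in> I. (as ! k) i \<noteq> (bs ! k) i}) ` {..<length as})"
    using *(1) by (auto simp: list_eq_iff_nth_eq)
  ultimately show "{i \<in> I. map (\<lambda>a. a i) as \<noteq> map (\<lambda>a. a i) bs} \<in> J"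
    by (rule ideal_onD(2)[OF ideal])
qed

lemma mem_listset_rcl:
  assumes "set as \<subseteq> PU" shows "as \<in> listset (map rcl as)"
  using assms ideal_onD(1)[OF ideal] by (auto simp: listset_iff list_all2_conv_all_nth mem_rcl)

lemma fun_PU:
  assumes "f \<in> funs L" "set as \<subseteq> PU" "length as = fun_arity L f"
  shows "(\<lambda>i \<in> I. fun_interp (M i) f (map (\<lambda>a. a i) as)) \<in> PU"
  unfolding product_univ_def
proof (rule restrict_PiE_iff[THEN iffD2], rule ballI)
  fix i assume i: "i \<in> I"
  have "set (map (\<lambda>a. a i) as) \<subseteq> univ (M i)" using assms(2) PU_univ[OF _ i] by auto
  then show "fun_interp (M i) f (map (\<lambda>a. a i) as) \<in> univ (M i)"
    using struct[OF i] assms(1,3) unfolding is_struct_def by (metis length_map)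
qed

lemma fun_interp_RP:
  assumes "f \<in> funs L" "set as \<subseteq> PU" "length as = fun_arity L f"
  shows "fun_interp RP f (map rcl as) = rcl (\<lambda>i \<in> I. fun_interp (M i) f (map (\<lambda>a. a i) as))"
proof -
  let ?g = "\<lambda>as. \<lambda>i \<in> I. fun_interp (M i) f (map (\<lambda>a. a i) as)"
  have eq: "rcl (?g bs) = rcl (?g as)" if bs: "bs \<in> listset (map rcl as)" for bs
  proof -
    note * = listset_rcl[OF bs]
    have "{i \<in> I. ?g bs i \<noteq> ?g as i} \<subseteq> {i \<in> I. map (\<lambda>a. a i) as \<noteq> map (\<lambda>a. a i) bs}"
      by (auto simp del: map_eq_conv)
    then have "{i \<in> I. ?g bs i \<noteq> ?g as i} \<in> J" using *(4) ideal_onD(2)[OF ideal] by blast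
    then show ?thesis using fun_PU assms * by (simp add: rcl_eq_iff)
  qed
  have "fun_interp RP f (map rcl as) = (\<Union>bs \<in> listset (map rcl as). rcl (?g bs))"
    by (simp add: reduced_product_def rcl_def)
  also have "\<dots> = rcl (?g as)"
    by (rule equalityI[OF UN_least UN_upper[OF mem_listset_rcl[OF assms(2)]]]) (rule equalityD1[OF eq])
  finally show ?thesis .
qed

lemma rel_interp_RP:
  assumes "set as \<subseteq> PU"
  shows "rel_interp RP r (map rcl as) \<longleftrightarrow> {i \<in> I. \<not> rel_interp (M i) r (map (\<lambda>a. a i) as)} \<in> J"
proof -
  have "{i \<in> I. \<not> rel_interp (M i) r (map (\<lambda>a. a i) as)} \<in> J"
    if bs: "bs \<in> listset (map rcl as)" "{i \<in> I. \<not> rel_interp (M i) r (map (\<lambda>a. a i) bs)} \<in> J" for bs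
    by (rule ideal_subset_Un[OF ideal bs(2) listset_rcl(4)[OF bs(1)]]) (auto simp del: map_eq_conv)
  then show ?thesis using mem_listset_rcl[OF assms] by (auto simp: reduced_product_def)
qed

lemma eval_RP:
  assumes a: "\<And>v. a v \<in> PU"
  shows "wf_tm L t \<Longrightarrow> (\<lambda>i \<in> I. eval_tm (M i) (\<lambda>v. a v i) t) \<in> PU \<and>
    eval_tm RP (\<lambda>v. rcl (a v)) t = rcl (\<lambda>i \<in> I. eval_tm (M i) (\<lambda>v. a v i) t)"
proof (induction t)
  case (Var v)
  have "(\<lambda>i \<in> I. a v i) = a v" using a[of v] by (auto simp: product_univ_def fun_eq_iff PiE_def extensional_def)
  then show ?case using a[of v] by simp
next
  case (Fn f ts)
  let ?as = "map (\<lambda>t. \<lambda>i \<in> I. eval_tm (M i) (\<lambda>v. a v i) t) ts"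
  have ev: "(\<lambda>i \<in> I. eval_tm (M i) (\<lambda>v. a v i) t) \<in> PU \<and>
    eval_tm RP (\<lambda>v. rcl (a v)) t = rcl (\<lambda>i \<in> I. eval_tm (M i) (\<lambda>v. a v i) t)" if "t \<in> set ts" for t
    by (rule Fn.IH[OF that]) (use Fn.prems that in simp)
  have 1: "set ?as \<subseteq> PU" "length ?as = fun_arity L f" "f \<in> funs L"
    using ev Fn.prems unfolding set_map by (blast, simp_all)
  have 2: "map (eval_tm RP (\<lambda>v. rcl (a v))) ts = map rcl ?as"
    unfolding map_map comp_def by (rule map_cong[OF refl]) (rule ev[THEN conjunct2])
  have 3: "map (\<lambda>a. a i) ?as = map (eval_tm (M i) (\<lambda>v. a v i)) ts" if "i \<in> I" for i using that by simp
  have 4: "(\<lambda>i \<in> I. fun_interp (M i) f (map (\<lambda>a. a i) ?as)) = (\<lambda>i \<in> I. eval_tm (M i) (\<lambda>v. a v i) (Fn f ts))"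
    by (rule restrict_ext) (simp only: 3 eval_tm.simps)
  show ?case
    using fun_PU[OF 1(3,1,2)] fun_interp_RP[OF 1(3,1,2)] unfolding 4 by (simp only: eval_tm.simps 2)
qed

lemma rcl_upd: "(\<lambda>w. rcl (a w))(v := rcl x) = (\<lambda>w. rcl ((a(v := x)) w))"
  by (simp add: fun_eq_iff)

lemma coord_upd: "(\<lambda>w. (a(v := x)) w i) = (\<lambda>w. a w i)(v := x i)"
  by (simp add: fun_eq_iff)

lemma sat_Ex_RP: "sat RP (\<lambda>w. rcl (a w)) (Ex v \<phi>) \<longleftrightarrow> (\<exists>x \<in> PU. sat RP (\<lambda>w. rcl ((a(v := x)) w)) \<phi>)"
  by (simp add: univ_RP rcl_upd del: fun_upd_apply)

text \<open>The default \<open>d\<close> has two uses: it fills the coordinates without a witness,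
  and it retains a known solution off the set where counterexamples are inserted.\<close>

lemma PU_choice:
  assumes d: "d \<in> PU" and P: "\<And>i. i \<in> D \<Longrightarrow> i \<in> I \<Longrightarrow> \<exists>c \<in> univ (M i). P i c"
  obtains x where "x \<in> PU" "\<forall>i \<in> D \<inter> I. P i (x i)" "\<forall>i \<in> I - D. x i = d i"
proof -
  define x where "x = (\<lambda>i \<in> I. if i \<in> D then SOME c. c \<in> univ (M i) \<and> P i c else d i)"
  have c: "x i \<in> univ (M i) \<and> P i (x i)" if "i \<in> D" "i \<in> I" for i
  proof -
    have "\<exists>c. c \<in> univ (M i) \<and> P i c" using P[OF that] by blast
    from someI_ex[OF this] show ?thesis using that by (simp add: x_def)
  qed
  have "x i \<in> univ (M i)" if "i \<in> I" for i
    using c[OF _ that] PU_univ[OF d that] that by (cases "i \<in> D") (auto simp: x_def)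
  moreover have "x \<in> extensional I" by (simp add: x_def)
  ultimately have "x \<in> PU" by (auto simp: product_univ_def PiE_def)
  then show ?thesis using c by (intro that[of x]) (auto simp: x_def)
qed

text \<open>Los's theorem for h-formulas. For \<open>\<exists>\<close>, witnesses are chosen
  coordinatewise. For \<open>himp\<close>, a solution \<open>x\<close> of \<open>\<theta>\<close> is
  changed into a counterexample to \<open>\<eta>\<close> at every coordinate in \<open>D\<close>,
  where one exists. The result still solves \<open>\<theta>\<close> almost everywhere, so it
  satisfies \<open>\<eta>\<close> almost everywhere, and \<open>D\<close> must be null.\<close>

lemma sat_hfm:
  assumes "hfm \<phi>"
  shows "wf_fm L \<phi> \<Longrightarrow> (\<And>v. a v \<in> PU) \<Longrightarrow> sat RP (\<lambda>v. rcl (a v)) \<phi> \<longleftrightarrow> fails \<phi> a \<in> J"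
  using assms
proof (induction \<phi> arbitrary: a rule: hfm.induct)
  case (1 s t)
  let ?e = "\<lambda>t. \<lambda>i \<in> I. eval_tm (M i) (\<lambda>v. a v i) t"
  have "{i \<in> I. ?e s i \<noteq> ?e t i} = fails (Eq s t) a" by (auto simp: fails_def)
  then show ?case using eval_RP[of a s] eval_RP[of a t] 1 rcl_eq_iff[of "?e s" "?e t"] by simp
next
  case (2 r ts)
  let ?as = "map (\<lambda>t. \<lambda>i \<in> I. eval_tm (M i) (\<lambda>v. a v i) t) ts"
  have ev: "(\<lambda>i \<in> I. eval_tm (M i) (\<lambda>v. a v i) t) \<in> PU \<and>
    eval_tm RP (\<lambda>v. rcl (a v)) t = rcl (\<lambda>i \<in> I. eval_tm (M i) (\<lambda>v. a v i) t)" if "t \<in> set ts" for t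
    using 2 that by (intro eval_RP) auto
  have 3: "map (\<lambda>a. a i) ?as = map (eval_tm (M i) (\<lambda>v. a v i)) ts" if "i \<in> I" for i using that by simp
  have 4: "{i \<in> I. \<not> rel_interp (M i) r (map (\<lambda>a. a i) ?as)} = fails (Rel r ts) a"
    unfolding fails_def sat.simps by (rule Collect_cong, rule conj_cong, rule refl) (simp only: 3)
  have "map (eval_tm RP (\<lambda>v. rcl (a v))) ts = map rcl ?as"
    unfolding map_map comp_def by (rule map_cong[OF refl]) (rule ev[THEN conjunct2])
  moreover have "set ?as \<subseteq> PU" using ev unfolding set_map by blast
  ultimately show ?case using rel_interp_RP[of ?as r] unfolding 4 by (simp only: sat.simps)
next
  case (3 \<theta> \<eta>)
  have "fails (And \<theta> \<eta>) a = fails \<theta> a \<union> fails \<eta> a" by (auto simp: fails_def)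
  moreover have "fails \<theta> a \<union> fails \<eta> a \<in> J \<longleftrightarrow> fails \<theta> a \<in> J \<and> fails \<eta> a \<in> J"
    using ideal_onD(2,3)[OF ideal] by (meson sup.cobounded1 sup.cobounded2)
  ultimately show ?case using 3 by simp
next
  case (4 \<theta> v)
  have IH: "sat RP (\<lambda>w. rcl ((a(v := x)) w)) \<theta> \<longleftrightarrow> fails \<theta> (a(v := x)) \<in> J" if "x \<in> PU" for x
    by (rule "4.IH") (use that "4.prems" in auto)
  show ?case
  proof
    assume "sat RP (\<lambda>w. rcl (a w)) (Ex v \<theta>)"
    then obtain x where x: "x \<in> PU" "sat RP (\<lambda>w. rcl ((a(v := x)) w)) \<theta>" unfolding sat_Ex_RP by blast
    then have "fails \<theta> (a(v := x)) \<in> J" using IH by blast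
    moreover have "fails (Ex v \<theta>) a \<subseteq> fails \<theta> (a(v := x))"
      unfolding fails_def coord_upd using PU_univ[OF x(1)] by auto
    ultimately show "fails (Ex v \<theta>) a \<in> J" using ideal_onD(2)[OF ideal] by blast
  next
    assume J: "fails (Ex v \<theta>) a \<in> J"
    have "\<exists>c \<in> univ (M i). sat (M i) ((\<lambda>w. a w i)(v := c)) \<theta>" if "i \<in> I - fails (Ex v \<theta>) a" "i \<in> I" for i
      using that by (auto simp: fails_def)
    then obtain x where x: "x \<in> PU" "\<forall>i \<in> (I - fails (Ex v \<theta>) a) \<inter> I. sat (M i) ((\<lambda>w. a w i)(v := x i)) \<theta>"
      using PU_choice[OF "4.prems"(2)[of v], of "I - fails (Ex v \<theta>) a" "\<lambda>i c. sat (M i) ((\<lambda>w. a w i)(v := c)) \<theta>"] by metis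
    then have "fails \<theta> (a(v := x)) \<subseteq> fails (Ex v \<theta>) a"
      unfolding fails_def coord_upd by auto
    then have "fails \<theta> (a(v := x)) \<in> J" using J ideal_onD(2)[OF ideal] by blast
    then have "sat RP (\<lambda>w. rcl ((a(v := x)) w)) \<theta>" using IH x(1) by blast
    then show "sat RP (\<lambda>w. rcl (a w)) (Ex v \<theta>)" unfolding sat_Ex_RP using x(1) by blast
  qed
next
  case (5 \<theta> \<eta> v)
  have wf: "wf_fm L \<theta>" "wf_fm L \<eta>" using 5 by (auto simp: wf_himp)
  have IH: "sat RP (\<lambda>w. rcl ((a(v := x)) w)) \<theta> \<longleftrightarrow> fails \<theta> (a(v := x)) \<in> J"
    "sat RP (\<lambda>w. rcl ((a(v := x)) w)) \<eta> \<longleftrightarrow> fails \<eta> (a(v := x)) \<in> J" if "x \<in> PU" for x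
    by (rule "5.IH"; use that "5.prems" wf in auto)+
  have satRP: "sat RP (\<lambda>w. rcl (a w)) (himp v \<theta> \<eta>) \<longleftrightarrow>
     (\<exists>x \<in> PU. fails \<theta> (a(v := x)) \<in> J) \<and> (\<forall>x \<in> PU. fails \<theta> (a(v := x)) \<in> J \<longrightarrow> fails \<eta> (a(v := x)) \<in> J)"
    unfolding sat_himp univ_RP using IH by (simp add: rcl_upd del: fun_upd_apply)
  show ?case unfolding satRP
  proof
    assume as: "(\<exists>x \<in> PU. fails \<theta> (a(v := x)) \<in> J) \<and> (\<forall>x \<in> PU. fails \<theta> (a(v := x)) \<in> J \<longrightarrow> fails \<eta> (a(v := x)) \<in> J)"
    then obtain x where x: "x \<in> PU" "fails \<theta> (a(v := x)) \<in> J" by blast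
    define D where "D = {i \<in> I. \<exists>c \<in> univ (M i). sat (M i) ((\<lambda>w. a w i)(v := c)) \<theta> \<and> \<not> sat (M i) ((\<lambda>w. a w i)(v := c)) \<eta>}"
    have "\<exists>c \<in> univ (M i). sat (M i) ((\<lambda>w. a w i)(v := c)) \<theta> \<and> \<not> sat (M i) ((\<lambda>w. a w i)(v := c)) \<eta>" if "i \<in> D" "i \<in> I" for i
      using that by (simp add: D_def)
    then obtain y where y: "y \<in> PU"
      "\<forall>i \<in> D \<inter> I. sat (M i) ((\<lambda>w. a w i)(v := y i)) \<theta> \<and> \<not> sat (M i) ((\<lambda>w. a w i)(v := y i)) \<eta>"
      "\<forall>i \<in> I - D. y i = x i"
      using PU_choice[OF x(1), of D "\<lambda>i c. sat (M i) ((\<lambda>w. a w i)(v := c)) \<theta> \<and> \<not> sat (M i) ((\<lambda>w. a w i)(v := c)) \<eta>"] by metis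
    have "fails \<theta> (a(v := y)) \<subseteq> fails \<theta> (a(v := x))"
    proof
      fix i assume i: "i \<in> fails \<theta> (a(v := y))"
      then have "i \<in> I - D" using y(2) unfolding fails_def coord_upd by blast
      then have "y i = x i" using y(3) by blast
      then show "i \<in> fails \<theta> (a(v := x))" using i unfolding fails_def coord_upd by simp
    qed
    then have "fails \<theta> (a(v := y)) \<in> J" using x ideal_onD(2)[OF ideal] by blast
    then have "fails \<eta> (a(v := y)) \<in> J" using as y(1) by blast
    moreover have "fails (himp v \<theta> \<eta>) a \<subseteq> fails \<theta> (a(v := x)) \<union> fails \<eta> (a(v := y))"
    proof
      fix i assume i: "i \<in> fails (himp v \<theta> \<eta>) a"
      then have "i \<in> I" by (simp add: fails_def)
      show "i \<in> fails \<theta> (a(v := x)) \<union> fails \<eta> (a(v := y))"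
      proof (cases "i \<in> D")
        case True
        then have "i \<in> fails \<eta> (a(v := y))" unfolding fails_def coord_upd using y(2) \<open>i \<in> I\<close> by auto
        then show ?thesis by blast
      next
        case False
        then have "i \<in> fails \<theta> (a(v := x))"
          using i PU_univ[OF x(1)] unfolding fails_def coord_upd D_def sat_himp by auto
        then show ?thesis by blast
      qed
    qed
    ultimately show "fails (himp v \<theta> \<eta>) a \<in> J" using x ideal_subset_Un[OF ideal] by blast
  next
    assume J: "fails (himp v \<theta> \<eta>) a \<in> J"
    let ?D = "I - fails (himp v \<theta> \<eta>) a"
    have "\<exists>c \<in> univ (M i). sat (M i) ((\<lambda>w. a w i)(v := c)) \<theta>" if "i \<in> ?D" "i \<in> I" for i
      using that by (auto simp: fails_def sat_himp)
    then obtain x where x: "x \<in> PU" "\<forall>i \<in> ?D \<inter> I. sat (M i) ((\<lambda>w. a w i)(v := x i)) \<theta>"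
      using PU_choice[OF "5.prems"(2)[of v], of ?D "\<lambda>i c. sat (M i) ((\<lambda>w. a w i)(v := c)) \<theta>"] by metis
    have "fails \<theta> (a(v := x)) \<subseteq> fails (himp v \<theta> \<eta>) a"
      using x(2) unfolding fails_def coord_upd by auto
    then have 1: "fails \<theta> (a(v := x)) \<in> J" using J ideal_onD(2)[OF ideal] by blast
    have 2: "fails \<eta> (a(v := y)) \<in> J" if y: "y \<in> PU" "fails \<theta> (a(v := y)) \<in> J" for y
    proof (rule ideal_subset_Un[OF ideal y(2) J], rule subsetI)
      fix i assume i: "i \<in> fails \<eta> (a(v := y))"
      then have "i \<in> I" by (simp add: fails_def)
      then show "i \<in> fails \<theta> (a(v := y)) \<union> fails (himp v \<theta> \<eta>) a"
        using i PU_univ[OF y(1) \<open>i \<in> I\<close>] unfolding fails_def coord_upd sat_himp by auto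
    qed
    show "(\<exists>x \<in> PU. fails \<theta> (a(v := x)) \<in> J) \<and> (\<forall>x \<in> PU. fails \<theta> (a(v := x)) \<in> J \<longrightarrow> fails \<eta> (a(v := x)) \<in> J)"
      using 1 2 x(1) by blast
  qed
qed

end

section \<open>Ramsey's theorem and failure of normality\<close>

lemma ramsey_pairs:
  fixes K :: "'a set"
  assumes K: "finite K"
  shows "\<exists>N :: nat. \<forall>c. (\<forall>i j. i < j \<and> j < N \<longrightarrow> c i j \<in> K) \<longrightarrow>
    (\<exists>i0 i1 i2 i3 x. i0 < i1 \<and> i1 < i2 \<and> i2 < i3 \<and> i3 < N \<and>
      (\<forall>i \<in> {i0, i1, i2, i3}. \<forall>j \<in> {i0, i1, i2, i3}. i < j \<longrightarrow> c i j = x))"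
proof -
  obtain h where h: "bij_betw h K {0..<card K}" using ex_bij_betw_finite_nat[OF K] by blast
  obtain N :: nat where N: "partn_lst {..<N} (replicate (card K) 4) 2" using ramsey_full by blast
  show ?thesis
  proof (rule exI[of _ N], intro allI impI)
    fix c :: "nat \<Rightarrow> nat \<Rightarrow> 'a" assume c: "\<forall>i j. i < j \<and> j < N \<longrightarrow> c i j \<in> K"
    \<comment> \<open>The partition theorem colours unordered pairs; \<open>Min\<close> and
      \<open>Max\<close> recover their order.\<close>
    define f where "f S = h (c (Min S) (Max S))" for S
    have f: "f {i, j} = h (c i j)" if "i < j" for i j using that by (simp add: f_def)
    have "f \<in> nsets {..<N} 2 \<rightarrow> {..<card K}"
    proof
      fix S :: "nat set" assume "S \<in> nsets {..<N} 2"
      then obtain x y where xy: "S = {x, y}" "x \<noteq> y" "x < N" "y < N" by (auto simp: nsets_def card_2_iff)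
      then obtain i j where ij: "S = {i, j}" "i < j" "j < N"
        by (cases "x < y") (auto, metis insert_commute linorder_neqE_nat)
      then have "c i j \<in> K" using c by blast
      then show "f S \<in> {..<card K}" using h f[OF ij(2)] ij(1) by (auto simp: bij_betw_def)
    qed
    then obtain k where k: "k < card K" "monochromatic {..<N} 4 2 f k"
      using N unfolding partn_lst_def by force
    then obtain H where H: "H \<in> nsets {..<N} 4" "f ` nsets H 2 \<subseteq> {k}" unfolding monochromatic_def by blast
    define xs where "xs = sorted_list_of_set H"
    have xs: "sorted_wrt (<) xs" "set xs = H" "length xs = 4"
      using H by (auto simp: xs_def nsets_def)
    obtain i0 i1 i2 i3 where xs4: "xs = [i0, i1, i2, i3]"
      using xs(3) by (auto simp: numeral_eq_Suc length_Suc_conv)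
    have lt: "i0 < i1" "i1 < i2" "i2 < i3" using xs(1) xs4 by auto
    have HN: "H \<subseteq> {..<N}" using H by (auto simp: nsets_def)
    have H4: "H = {i0, i1, i2, i3}" using xs(2) xs4 by simp
    have "c i j = c i0 i1" if ij: "i \<in> H" "j \<in> H" "i < j" for i j
    proof -
      have "{i, j} \<in> nsets H 2" "{i0, i1} \<in> nsets H 2" using ij lt H4 by (auto simp: nsets_def)
      then have "f {i, j} = k" "f {i0, i1} = k" using H(2) by blast+
      then have "h (c i j) = h (c i0 i1)" using f ij(3) lt(1) by simp
      moreover have "c i j \<in> K" "c i0 i1 \<in> K" using c HN ij lt(1) H4 by blast+
      ultimately show ?thesis using h by (auto simp: bij_betw_def inj_on_def)
    qed
    then have mono: "\<forall>i \<in> {i0, i1, i2, i3}. \<forall>j \<in> {i0, i1, i2, i3}. i < j \<longrightarrow> c i j = c i0 i1"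
      unfolding H4 by blast
    have "i3 < N" using HN H4 by auto
    then show "\<exists>i0 i1 i2 i3 x. i0 < i1 \<and> i1 < i2 \<and> i2 < i3 \<and> i3 < N \<and>
      (\<forall>i \<in> {i0, i1, i2, i3}. \<forall>j \<in> {i0, i1, i2, i3}. i < j \<longrightarrow> c i j = x)"
      by (intro exI[of _ i0] exI[of _ i1] exI[of _ i2] exI[of _ i3] exI[of _ "c i0 i1"] conjI lt mono)
  qed
qed

text \<open>Tuples are total assignments: of \<open>s\<close> only the places below \<open>m\<close>
  count, of \<open>t\<close> only those from \<open>m\<close> on.\<close>

definition mix :: "nat \<Rightarrow> (nat \<Rightarrow> 'b) \<Rightarrow> (nat \<Rightarrow> 'b) \<Rightarrow> nat \<Rightarrow> 'b" where
  "mix m s t v = (if v < m then s v else t v)"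

context reduced_prod
begin

definition determines :: "('f, 'p) fm set \<Rightarrow> ('f, 'p) fm \<Rightarrow> bool" where
  "determines H \<phi> \<longleftrightarrow> (\<forall>a b. (\<forall>v. a v \<in> PU) \<longrightarrow> (\<forall>v. b v \<in> PU) \<longrightarrow>
     (\<forall>\<eta> \<in> H. sat RP (\<lambda>v. rcl (a v)) \<eta> \<longleftrightarrow> sat RP (\<lambda>v. rcl (b v)) \<eta>) \<longrightarrow>
     (sat RP (\<lambda>v. rcl (a v)) \<phi> \<longleftrightarrow> sat RP (\<lambda>v. rcl (b v)) \<phi>))"

text \<open>Realisations of \<open>\<theta> \<and> \<not> \<eta>\<close>, one for each \<open>\<eta> \<in> N\<close>, are glued along disjoint positive sets of indices.\<close>

lemma glue_counterexamples:
  assumes at: "atomless_ideal I J" and N: "finite N" "\<forall>\<eta> \<in> N. hfm \<eta> \<and> wf_fm L \<eta>"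
    and \<theta>: "hfm \<theta>" "wf_fm L \<theta>" and b: "\<And>v. b v \<in> PU"
    and ex: "sat RP (\<lambda>w. rcl (b w)) (Ex v \<theta>)"
    and counter: "\<forall>\<eta> \<in> N. \<not> sat RP (\<lambda>w. rcl (b w)) (himp v \<theta> \<eta>)"
  shows "\<exists>y \<in> PU. sat RP (\<lambda>w. rcl ((b(v := y)) w)) \<theta> \<and> (\<forall>\<eta> \<in> N. \<not> sat RP (\<lambda>w. rcl ((b(v := y)) w)) \<eta>)"
proof -
  have los: "sat RP (\<lambda>w. rcl ((b(v := x)) w)) \<psi> \<longleftrightarrow> fails \<psi> (b(v := x)) \<in> J"
    if "x \<in> PU" "hfm \<psi>" "wf_fm L \<psi>" for x \<psi>
    by (rule sat_hfm[OF that(2,3)]) (use b that(1) in auto)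
  obtain y0 where y0: "y0 \<in> PU" "sat RP (\<lambda>w. rcl ((b(v := y0)) w)) \<theta>"
    using ex unfolding sat_Ex_RP by blast
  have "\<exists>y. y \<in> PU \<and> sat RP (\<lambda>w. rcl ((b(v := y)) w)) \<theta> \<and> \<not> sat RP (\<lambda>w. rcl ((b(v := y)) w)) \<eta>"
    if "\<eta> \<in> N" for \<eta>
    using counter that ex unfolding himp_def sat.simps(3,4) sat_Ex_RP by auto
  then obtain y where y: "\<And>\<eta>. \<eta> \<in> N \<Longrightarrow> y \<eta> \<in> PU \<and> sat RP (\<lambda>w. rcl ((b(v := y \<eta>)) w)) \<theta> \<and>
     \<not> sat RP (\<lambda>w. rcl ((b(v := y \<eta>)) w)) \<eta>" by metis
  have f\<theta>: "fails \<theta> (b(v := y \<eta>)) \<in> J" and f\<eta>: "fails \<eta> (b(v := y \<eta>)) \<notin> J" if "\<eta> \<in> N" for \<eta>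
    using y[OF that] los[OF _ \<theta>] los[of _ \<eta>] N(2) that by blast+
  have f0: "fails \<theta> (b(v := y0)) \<in> J" using y0 los[OF _ \<theta>] by blast
  have "\<forall>\<eta> \<in> N. fails \<eta> (b(v := y \<eta>)) \<subseteq> I \<and> fails \<eta> (b(v := y \<eta>)) \<notin> J"
    using f\<eta> by (auto simp: fails_def)
  from finite_disjoint_refinement[OF ideal at N(1) this]
  obtain E where E: "\<forall>\<eta> \<in> N. E \<eta> \<subseteq> fails \<eta> (b(v := y \<eta>)) \<and> E \<eta> \<notin> J"
    "\<forall>\<eta> \<in> N. \<forall>\<eta>' \<in> N. \<eta> \<noteq> \<eta>' \<longrightarrow> E \<eta> \<inter> E \<eta>' = {}" by metis
  \<comment> \<open>Off the pieces the default \<open>y0\<close> keeps \<open>\<theta>\<close> true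
    almost everywhere; on \<open>E \<eta>\<close> the realisation belonging to \<open>\<eta>\<close>
    refutes \<open>\<eta>\<close>. Exact disjointness makes the selected \<open>\<eta>\<close>
    unique.\<close>
  define z where "z = (\<lambda>i \<in> I. if \<exists>\<eta> \<in> N. i \<in> E \<eta> then y (THE \<eta>. \<eta> \<in> N \<and> i \<in> E \<eta>) i else y0 i)"
  have z1: "z i = y \<eta> i" if "\<eta> \<in> N" "i \<in> E \<eta>" "i \<in> I" for \<eta> i
  proof -
    have "(THE \<eta>. \<eta> \<in> N \<and> i \<in> E \<eta>) = \<eta>" using that E(2) by (intro the_equality) auto
    then show ?thesis using that by (auto simp: z_def)
  qed
  have z0: "z i = y0 i" if "\<not> (\<exists>\<eta> \<in> N. i \<in> E \<eta>)" "i \<in> I" for i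
    using that by (simp add: z_def)
  have zPU: "z \<in> PU"
  proof -
    have "z i \<in> univ (M i)" if i: "i \<in> I" for i
    proof (cases "\<exists>\<eta> \<in> N. i \<in> E \<eta>")
      case True
      then obtain \<eta> where "\<eta> \<in> N" "i \<in> E \<eta>" by blast
      then show ?thesis using z1[of \<eta> i] i y PU_univ by metis
    next
      case False
      then show ?thesis using z0 i y0(1) PU_univ by metis
    qed
    moreover have "z \<in> extensional I" by (simp add: z_def)
    ultimately show ?thesis by (auto simp: product_univ_def PiE_def)
  qed
  have "\<Union>((\<lambda>\<eta>. fails \<theta> (b(v := y \<eta>))) ` N) \<in> J"
    using f\<theta> N(1) by (intro ideal_finite_Union[OF ideal]) auto
  moreover have "fails \<theta> (b(v := z)) \<subseteq> \<Union>((\<lambda>\<eta>. fails \<theta> (b(v := y \<eta>))) ` N) \<union> fails \<theta> (b(v := y0))"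
  proof
    fix i assume i: "i \<in> fails \<theta> (b(v := z))"
    then have iI: "i \<in> I" by (simp add: fails_def)
    show "i \<in> \<Union>((\<lambda>\<eta>. fails \<theta> (b(v := y \<eta>))) ` N) \<union> fails \<theta> (b(v := y0))"
    proof (cases "\<exists>\<eta> \<in> N. i \<in> E \<eta>")
      case True
      then obtain \<eta> where \<eta>: "\<eta> \<in> N" "i \<in> E \<eta>" by blast
      then have "i \<in> fails \<theta> (b(v := y \<eta>))" using i z1[OF \<eta> iI] unfolding fails_def coord_upd by simp
      then show ?thesis using \<eta> by blast
    next
      case False
      then have "i \<in> fails \<theta> (b(v := y0))" using i z0[OF False iI] unfolding fails_def coord_upd by simp
      then show ?thesis by blast
    qed
  qed
  ultimately have "fails \<theta> (b(v := z)) \<in> J" using f0 ideal_subset_Un[OF ideal] by metis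
  then have s\<theta>: "sat RP (\<lambda>w. rcl ((b(v := z)) w)) \<theta>" using los[OF zPU \<theta>] by blast
  have "\<not> sat RP (\<lambda>w. rcl ((b(v := z)) w)) \<eta>" if \<eta>: "\<eta> \<in> N" for \<eta>
  proof -
    have "E \<eta> \<subseteq> fails \<eta> (b(v := z))"
    proof
      fix i assume i: "i \<in> E \<eta>"
      then have "i \<in> fails \<eta> (b(v := y \<eta>))" using E(1) \<eta> by blast
      then show "i \<in> fails \<eta> (b(v := z))" using z1[OF \<eta> i] unfolding fails_def coord_upd by simp
    qed
    then have "fails \<eta> (b(v := z)) \<notin> J" using E(1) \<eta> ideal_onD(2)[OF ideal] by blast
    then show ?thesis using los[OF zPU] N(2) \<eta> by blast
  qed
  then show ?thesis using s\<theta> zPU by blast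
qed

text \<open>Only the quantifier step needs an idea. Let \<open>P\<close> be the set of formulas of
  \<open>H\<close> true at a witness. That \<open>P\<close> has a solution is an h-formula, and,
  given this, that \<open>P\<close> does not entail some \<open>\<eta>\<close> outside
  \<open>P\<close> is the negation of one. Gluing merges these separate non-entailments into one
  element at which exactly the formulas of \<open>P\<close> hold.\<close>

lemma finite_determining_set:
  assumes at: "atomless_ideal I J"
  shows "wf_fm L \<phi> \<Longrightarrow> \<exists>H. finite H \<and> (\<forall>\<eta> \<in> H. hfm \<eta> \<and> wf_fm L \<eta> \<and> fv \<eta> \<subseteq> fv \<phi>) \<and> determines H \<phi>"
proof (induction \<phi>)
  case (Eq s t)
  then show ?case by (intro exI[of _ "{Eq s t}"]) (auto simp: determines_def intro: hfm.intros)
next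
  case (Rel r ts)
  then show ?case by (intro exI[of _ "{Rel r ts}"]) (auto simp: determines_def intro: hfm.intros)
next
  case (Neg \<phi>)
  have "determines H (Neg \<phi>) \<longleftrightarrow> determines H \<phi>" for H
    unfolding determines_def by simp
  then show ?case using Neg by simp
next
  case (And \<phi> \<psi>)
  then have "\<exists>H. finite H \<and> (\<forall>\<eta> \<in> H. hfm \<eta> \<and> wf_fm L \<eta> \<and> fv \<eta> \<subseteq> fv \<phi>) \<and> determines H \<phi>"
    "\<exists>H. finite H \<and> (\<forall>\<eta> \<in> H. hfm \<eta> \<and> wf_fm L \<eta> \<and> fv \<eta> \<subseteq> fv \<psi>) \<and> determines H \<psi>" by simp_all
  then obtain H K where H: "finite H" "\<forall>\<eta> \<in> H. hfm \<eta> \<and> wf_fm L \<eta> \<and> fv \<eta> \<subseteq> fv \<phi>" "determines H \<phi>"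
    and K: "finite K" "\<forall>\<eta> \<in> K. hfm \<eta> \<and> wf_fm L \<eta> \<and> fv \<eta> \<subseteq> fv \<psi>" "determines K \<psi>" by blast
  have "determines (H \<union> K) (And \<phi> \<psi>)"
    unfolding determines_def
  proof (intro allI impI)
    fix a b assume ab: "\<forall>v. a v \<in> PU" "\<forall>v. b v \<in> PU"
      "\<forall>\<eta> \<in> H \<union> K. sat RP (\<lambda>v. rcl (a v)) \<eta> \<longleftrightarrow> sat RP (\<lambda>v. rcl (b v)) \<eta>"
    then have "sat RP (\<lambda>v. rcl (a v)) \<phi> \<longleftrightarrow> sat RP (\<lambda>v. rcl (b v)) \<phi>"
      using H(3)[unfolded determines_def, rule_format, of a b] by blast
    moreover have "sat RP (\<lambda>v. rcl (a v)) \<psi> \<longleftrightarrow> sat RP (\<lambda>v. rcl (b v)) \<psi>"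
      using K(3)[unfolded determines_def, rule_format, of a b] ab by blast
    ultimately show "sat RP (\<lambda>v. rcl (a v)) (And \<phi> \<psi>) \<longleftrightarrow> sat RP (\<lambda>v. rcl (b v)) (And \<phi> \<psi>)" by simp
  qed
  moreover have "\<forall>\<eta> \<in> H \<union> K. hfm \<eta> \<and> wf_fm L \<eta> \<and> fv \<eta> \<subseteq> fv (And \<phi> \<psi>)" using H(2) K(2) by auto
  ultimately show ?case using H(1) K(1) by (intro exI[of _ "H \<union> K"]) simp
next
  case (Ex v \<phi>)
  then obtain H where H: "finite H" "\<forall>\<eta> \<in> H. hfm \<eta> \<and> wf_fm L \<eta> \<and> fv \<eta> \<subseteq> fv \<phi>" "determines H \<phi>" by auto
  define ls where "ls P = (SOME l. set l = P)" for P :: "('f, 'p) fm set"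
  have ls: "set (ls P) = P" if P: "P \<subseteq> H" for P
  proof -
    have "\<exists>l. set l = P" using finite_list[OF rev_finite_subset[OF H(1) P]] .
    from someI_ex[OF this] show ?thesis by (simp add: ls_def)
  qed
  define \<theta> where "\<theta> P = conj (ls P) (Eq (Var v) (Var v))" for P
  have \<theta>: "hfm (\<theta> P)" "wf_fm L (\<theta> P)" "fv (\<theta> P) \<subseteq> insert v (fv \<phi>)" if P: "P \<subseteq> H" for P
  proof -
    have *: "\<forall>\<eta> \<in> set (ls P). hfm \<eta> \<and> wf_fm L \<eta> \<and> fv \<eta> \<subseteq> fv \<phi>" using ls[OF P] H(2) P by blast
    show "hfm (\<theta> P)" "wf_fm L (\<theta> P)" "fv (\<theta> P) \<subseteq> insert v (fv \<phi>)"
      unfolding \<theta>_def wf_conj fv_conj using * by (auto intro!: hfm_conj hfm.intros)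
  qed
  have sat\<theta>: "sat RP e (\<theta> P) \<longleftrightarrow> (\<forall>\<eta> \<in> P. sat RP e \<eta>)" if "P \<subseteq> H" for P e
    unfolding \<theta>_def sat_conj ls[OF that] by simp
  define H' where "H' = (\<lambda>P. Ex v (\<theta> P)) ` Pow H \<union> (\<lambda>(P, \<eta>). himp v (\<theta> P) \<eta>) ` (Pow H \<times> H)"
  have H'Ex: "Ex v (\<theta> P) \<in> H'" if "P \<subseteq> H" for P using that by (auto simp: H'_def)
  have H'himp: "himp v (\<theta> P) \<eta> \<in> H'" if "P \<subseteq> H" "\<eta> \<in> H" for P \<eta>
    unfolding H'_def using that by (intro UnI2 rev_image_eqI[of "(P, \<eta>)"]) auto
  have *: "sat RP (\<lambda>w. rcl (b w)) (Ex v \<phi>)"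
    if a: "\<And>w. a w \<in> PU" and b: "\<And>w. b w \<in> PU"
      and eq: "\<And>\<eta>. \<eta> \<in> H' \<Longrightarrow> sat RP (\<lambda>w. rcl (a w)) \<eta> \<longleftrightarrow> sat RP (\<lambda>w. rcl (b w)) \<eta>"
      and s: "sat RP (\<lambda>w. rcl (a w)) (Ex v \<phi>)" for a b
  proof -
    obtain x where x: "x \<in> PU" "sat RP (\<lambda>w. rcl ((a(v := x)) w)) \<phi>" using s unfolding sat_Ex_RP by blast
    define P where "P = {\<eta> \<in> H. sat RP (\<lambda>w. rcl ((a(v := x)) w)) \<eta>}"
    have P: "P \<subseteq> H" by (auto simp: P_def)
    have xP: "sat RP (\<lambda>w. rcl ((a(v := x)) w)) (\<theta> P)" unfolding sat\<theta>[OF P] by (simp add: P_def)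
    then have "sat RP (\<lambda>w. rcl (a w)) (Ex v (\<theta> P))" unfolding sat_Ex_RP using x(1) by blast
    then have exb: "sat RP (\<lambda>w. rcl (b w)) (Ex v (\<theta> P))" using eq[OF H'Ex[OF P]] by blast
    have "\<forall>\<eta> \<in> H - P. \<not> sat RP (\<lambda>w. rcl (b w)) (himp v (\<theta> P) \<eta>)"
    proof
      fix \<eta> assume \<eta>: "\<eta> \<in> H - P"
      then have "\<not> sat RP (\<lambda>w. rcl ((a(v := x)) w)) \<eta>" by (simp add: P_def)
      then have "sat RP (\<lambda>w. rcl ((a(v := x)) w)) (And (\<theta> P) (Neg \<eta>))" using xP unfolding sat.simps by blast
      then have "sat RP (\<lambda>w. rcl (a w)) (Ex v (And (\<theta> P) (Neg \<eta>)))" unfolding sat_Ex_RP using x(1) by blast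
      then have "\<not> sat RP (\<lambda>w. rcl (a w)) (himp v (\<theta> P) \<eta>)" unfolding himp_def sat.simps(3,4) by blast
      then show "\<not> sat RP (\<lambda>w. rcl (b w)) (himp v (\<theta> P) \<eta>)" using eq[OF H'himp[OF P]] \<eta> by blast
    qed
    moreover have "finite (H - P)" "\<forall>\<eta> \<in> H - P. hfm \<eta> \<and> wf_fm L \<eta>" using H(1,2) by blast+
    ultimately obtain y where y: "y \<in> PU" "sat RP (\<lambda>w. rcl ((b(v := y)) w)) (\<theta> P)"
      "\<forall>\<eta> \<in> H - P. \<not> sat RP (\<lambda>w. rcl ((b(v := y)) w)) \<eta>"
      using glue_counterexamples[OF at _ _ \<theta>(1,2)[OF P] b exb, of "H - P"] by blast
    have "sat RP (\<lambda>w. rcl ((a(v := x)) w)) \<eta> \<longleftrightarrow> sat RP (\<lambda>w. rcl ((b(v := y)) w)) \<eta>" if "\<eta> \<in> H" for \<eta>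
      using y(2)[unfolded sat\<theta>[OF P]] y(3) that unfolding P_def by blast
    moreover have "\<forall>w. (a(v := x)) w \<in> PU" "\<forall>w. (b(v := y)) w \<in> PU" using a b x(1) y(1) by simp_all
    ultimately have "sat RP (\<lambda>w. rcl ((b(v := y)) w)) \<phi>"
      using H(3)[unfolded determines_def, rule_format, of "a(v := x)" "b(v := y)"] x(2) by blast
    then show ?thesis unfolding sat_Ex_RP using y(1) by blast
  qed
  have "determines H' (Ex v \<phi>)"
    unfolding determines_def
  proof (intro allI impI)
    fix a b assume ab: "\<forall>v. a v \<in> PU" "\<forall>v. b v \<in> PU"
      "\<forall>\<eta> \<in> H'. sat RP (\<lambda>v. rcl (a v)) \<eta> \<longleftrightarrow> sat RP (\<lambda>v. rcl (b v)) \<eta>"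
    show "sat RP (\<lambda>v. rcl (a v)) (Ex v \<phi>) \<longleftrightarrow> sat RP (\<lambda>v. rcl (b v)) (Ex v \<phi>)"
      using *[of a b] *[of b a] ab by blast
  qed
  moreover have "finite H'" using H(1) by (simp add: H'_def)
  moreover have "\<forall>\<eta> \<in> H'. hfm \<eta> \<and> wf_fm L \<eta> \<and> fv \<eta> \<subseteq> fv (Ex v \<phi>)"
  proof
    fix \<chi> assume "\<chi> \<in> H'"
    then consider P where "P \<subseteq> H" "\<chi> = Ex v (\<theta> P)" | P \<eta> where "P \<subseteq> H" "\<eta> \<in> H" "\<chi> = himp v (\<theta> P) \<eta>"
      by (auto simp: H'_def)
    then show "hfm \<chi> \<and> wf_fm L \<chi> \<and> fv \<chi> \<subseteq> fv (Ex v \<phi>)"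
    proof cases
      case (1 P)
      then show ?thesis using \<theta>[of P] by (auto intro: hfm.intros)
    next
      case (2 P \<eta>)
      then show ?thesis using \<theta>[of P] H(2) by (auto simp: wf_himp fv_himp intro!: hfm.intros)
    qed
  qed
  ultimately show ?case by blast
qed

text \<open>A pair \<open>i < j\<close> is coloured by the \<open>H\<close>-types of
  \<open>(c i, c j)\<close> and of \<open>(c j, c i)\<close>. On homogeneous indices there is one
  forward and one backward type, and they differ because \<open>\<phi>\<close> tells the two
  directions apart. Four indices are enough for a rectangle with three forward corners
  \<open>(i0, i3)\<close>, \<open>(i0, i1)\<close>, \<open>(i2, i3)\<close> and the backward corner
  \<open>(i2, i1)\<close>; a formula true backward and false forward uses the rectangle
  \<open>(i3, i0)\<close>, \<open>(i3, i2)\<close>, \<open>(i1, i0)\<close>,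
  \<open>(i1, i2)\<close>.\<close>

lemma nonnormal_hfm:
  assumes at: "atomless_ideal I J" and wf: "wf_fm L \<phi>"
    and order: "\<And>k. \<exists>c. (\<forall>i v. c i v \<in> PU) \<and>
      (\<forall>i<k. \<forall>j<k. sat RP (\<lambda>v. rcl (mix m (c i) (c j) v)) \<phi> \<longleftrightarrow> i \<le> (j::nat))"
  obtains \<eta> s s' t t' where "hfm \<eta>" "wf_fm L \<eta>" "fv \<eta> \<subseteq> fv \<phi>"
    "\<forall>v. s v \<in> PU" "\<forall>v. s' v \<in> PU" "\<forall>v. t v \<in> PU" "\<forall>v. t' v \<in> PU"
    "sat RP (\<lambda>v. rcl (mix m s t v)) \<eta>" "sat RP (\<lambda>v. rcl (mix m s t' v)) \<eta>"
    "sat RP (\<lambda>v. rcl (mix m s' t v)) \<eta>" "\<not> sat RP (\<lambda>v. rcl (mix m s' t' v)) \<eta>"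
proof -
  obtain H where H: "finite H" "\<forall>\<eta> \<in> H. hfm \<eta> \<and> wf_fm L \<eta> \<and> fv \<eta> \<subseteq> fv \<phi>" "determines H \<phi>"
    using finite_determining_set[OF at wf] by blast
  have "finite (Pow H \<times> Pow H)" using H(1) by simp
  from ramsey_pairs[OF this] obtain N :: nat where N: "\<forall>c. (\<forall>i j. i < j \<and> j < N \<longrightarrow> c i j \<in> Pow H \<times> Pow H) \<longrightarrow>
    (\<exists>i0 i1 i2 i3 x. i0 < i1 \<and> i1 < i2 \<and> i2 < i3 \<and> i3 < N \<and>
      (\<forall>i \<in> {i0, i1, i2, i3}. \<forall>j \<in> {i0, i1, i2, i3}. i < j \<longrightarrow> c i j = x))" by blast
  obtain c where c: "\<forall>i v. c i v \<in> PU"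
    "\<forall>i<N. \<forall>j<N. sat RP (\<lambda>v. rcl (mix m (c i) (c j) v)) \<phi> \<longleftrightarrow> i \<le> j" using order[of N] by blast
  define T where "T i j = {\<eta> \<in> H. sat RP (\<lambda>v. rcl (mix m (c i) (c j) v)) \<eta>}" for i j
  have "\<forall>i j. i < j \<and> j < N \<longrightarrow> (T i j, T j i) \<in> Pow H \<times> Pow H" by (auto simp: T_def)
  from mp[OF spec[OF N, of "\<lambda>i j. (T i j, T j i)"] this] obtain i0 i1 i2 i3 x where i: "i0 < i1" "i1 < i2" "i2 < i3" "i3 < N"
    and x: "\<forall>i \<in> {i0, i1, i2, i3}. \<forall>j \<in> {i0, i1, i2, i3}. i < j \<longrightarrow> (T i j, T j i) = x" by metis
  have fw: "T i0 i1 = fst x" "T i0 i3 = fst x" "T i2 i3 = fst x" "T i1 i2 = fst x"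
    and bw: "T i3 i2 = snd x" "T i3 i0 = snd x" "T i1 i0 = snd x" "T i2 i1 = snd x"
    using x i by force+
  have "T i1 i2 \<noteq> T i2 i1"
  proof
    assume eq: "T i1 i2 = T i2 i1"
    have *: "sat RP (\<lambda>v. rcl (mix m (c i1) (c i2) v)) \<eta> \<longleftrightarrow> sat RP (\<lambda>v. rcl (mix m (c i2) (c i1) v)) \<eta>" if "\<eta> \<in> H" for \<eta>
      using eq that unfolding T_def by blast
    have "\<forall>v. mix m (c i1) (c i2) v \<in> PU" "\<forall>v. mix m (c i2) (c i1) v \<in> PU" using c(1) by (simp_all add: mix_def)
    then have "sat RP (\<lambda>v. rcl (mix m (c i1) (c i2) v)) \<phi> \<longleftrightarrow> sat RP (\<lambda>v. rcl (mix m (c i2) (c i1) v)) \<phi>"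
      using H(3)[unfolded determines_def, rule_format, of "mix m (c i1) (c i2)" "mix m (c i2) (c i1)"] * by blast
    moreover have "i1 < N" "i2 < N" using i by auto
    ultimately show False using c(2) i(2) by auto
  qed
  then consider \<eta> where "\<eta> \<in> T i1 i2" "\<eta> \<notin> T i2 i1" | \<eta> where "\<eta> \<in> T i2 i1" "\<eta> \<notin> T i1 i2" by blast
  then show ?thesis
  proof cases
    case (1 \<eta>)
    then have \<eta>: "\<eta> \<in> H" "\<eta> \<in> T i0 i1" "\<eta> \<in> T i0 i3" "\<eta> \<in> T i2 i3" "\<eta> \<notin> T i2 i1" using fw by (auto simp: T_def)
    show ?thesis
      using \<eta> H(2) c(1) by (intro that[of \<eta> "c i0" "c i2" "c i3" "c i1"]) (auto simp: T_def)
  next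
    case (2 \<eta>)
    then have \<eta>: "\<eta> \<in> H" "\<eta> \<in> T i3 i2" "\<eta> \<in> T i3 i0" "\<eta> \<in> T i1 i0" "\<eta> \<notin> T i1 i2" using bw by (auto simp: T_def)
    show ?thesis
      using \<eta> H(2) c(1) by (intro that[of \<eta> "c i3" "c i1" "c i0" "c i2"]) (auto simp: T_def)
  qed
qed

end

section \<open>The preorder of a non-normal h-formula\<close>

text \<open>\<open>himp\<close> binds one variable; for a block, the premise at each stage is that
  the remaining variables can still be chosen. The base case is a conjunction, because that is what
  \<open>\<exists>\<theta>\<close> and \<open>\<forall>(\<theta> \<longrightarrow> \<eta>)\<close>
  amount to when no variable is left.\<close>

fun himps :: "nat list \<Rightarrow> ('f, 'p) fm \<Rightarrow> ('f, 'p) fm \<Rightarrow> ('f, 'p) fm" where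
  "himps [] \<theta> \<eta> = And \<theta> \<eta>"
| "himps (v # vs) \<theta> \<eta> = himp v (exs vs \<theta>) (himps vs \<theta> \<eta>)"

lemma hfm_himps: "hfm \<theta> \<Longrightarrow> hfm \<eta> \<Longrightarrow> hfm (himps vs \<theta> \<eta>)"
  by (induction vs) (auto intro: hfm.intros hfm_exs)

lemma wf_himps: "wf_fm L (himps vs \<theta> \<eta>) \<longleftrightarrow> wf_fm L \<theta> \<and> wf_fm L \<eta>"
  by (induction vs) (auto simp: wf_himp wf_exs)

lemma fv_himps: "fv (himps vs \<theta> \<eta>) = fv \<theta> \<union> fv \<eta> - set vs"
  by (induction vs) (auto simp: fv_himp fv_exs)

lemma sat_exs_mono: "(\<And>e. sat M e \<phi> \<Longrightarrow> sat M e \<psi>) \<Longrightarrow> sat M e (exs vs \<phi>) \<Longrightarrow> sat M e (exs vs \<psi>)"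
proof (induction vs arbitrary: e)
  case (Cons v vs)
  from Cons.prems(2) obtain a where a: "a \<in> univ M" "sat M (e(v := a)) (exs vs \<phi>)" by auto
  have "sat M (e(v := a)) (exs vs \<psi>)" by (rule Cons.IH[OF Cons.prems(1) a(2)])
  then show ?case using a(1) by auto
qed simp

text \<open>A counterexample in the inner block is in particular a solution of
  \<open>\<theta>\<close>, so restricting the outer variable to values that admit a solution loses
  no counterexample.\<close>

lemma sat_himps_exs:
  "sat M e (himps vs \<theta> \<eta>) \<longleftrightarrow> sat M e (exs vs \<theta>) \<and> \<not> sat M e (exs vs (And \<theta> (Neg \<eta>)))"
proof (induction vs arbitrary: e)
  case Nil
  show ?case by auto
next
  case (Cons v vs)
  have "sat M e (exs vs \<theta>)" if "sat M e (exs vs (And \<theta> (Neg \<eta>)))" for e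
    using sat_exs_mono[of M "And \<theta> (Neg \<eta>)" \<theta>] that by simp
  then show ?case unfolding himps.simps sat_himp Cons.IH exs_simps sat.simps(5) by blast
qed

lemma sat_himps:
  assumes "distinct vs"
  shows "sat M e (himps vs \<theta> \<eta>) \<longleftrightarrow>
    (\<exists>f. f ` set vs \<subseteq> univ M \<and> sat M (override_on e f (set vs)) \<theta>) \<and>
    (\<forall>f. f ` set vs \<subseteq> univ M \<longrightarrow> sat M (override_on e f (set vs)) \<theta> \<longrightarrow> sat M (override_on e f (set vs)) \<eta>)"
  unfolding sat_himps_exs sat_exs[OF assms] by auto

text \<open>For \<open>Y(s) = {y. \<eta>(s0, y) \<and> \<eta>(s, y)}\<close> this is the preorder \<open>\<emptyset> \<noteq> Y(s) \<subseteq> Y(t)\<close>.\<close>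

definition preorder_at ::
    "('f, 'p) fm \<Rightarrow> nat \<Rightarrow> nat \<Rightarrow> ('f, 'p, 'a) fo_struct \<Rightarrow> (nat \<Rightarrow> 'a) \<Rightarrow> (nat \<Rightarrow> 'a) \<Rightarrow> (nat \<Rightarrow> 'a) \<Rightarrow> bool" where
  "preorder_at \<eta> m n N s0 s t \<longleftrightarrow>
    (\<exists>y. y ` {m..<m + n} \<subseteq> univ N \<and> sat N (mix m s0 y) \<eta> \<and> sat N (mix m s y) \<eta>) \<and>
    (\<forall>y. y ` {m..<m + n} \<subseteq> univ N \<longrightarrow> sat N (mix m s0 y) \<eta> \<longrightarrow> sat N (mix m s y) \<eta> \<longrightarrow> sat N (mix m t y) \<eta>)"

lemma preorder_at_trans:
  "preorder_at \<eta> m n N s0 s t \<Longrightarrow> preorder_at \<eta> m n N s0 t r \<Longrightarrow> preorder_at \<eta> m n N s0 s r"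
  unfolding preorder_at_def by blast

lemma preorder_at_cong:
  assumes "\<And>v. v < m \<Longrightarrow> s0 v = s0' v" "\<And>v. v < m \<Longrightarrow> s v = s' v" "\<And>v. v < m \<Longrightarrow> t v = t' v"
  shows "preorder_at \<eta> m n N s0 s t \<longleftrightarrow> preorder_at \<eta> m n N s0' s' t'"
proof -
  have "mix m s0 y = mix m s0' y" "mix m s y = mix m s' y" "mix m t y = mix m t' y" for y
    using assms by (auto simp: mix_def fun_eq_iff)
  then show ?thesis by (simp add: preorder_at_def)
qed

text \<open>The tuple of block \<open>b\<close> occupies the variables \<open>prod_encode (b, v)\<close> with \<open>v < m\<close>; block \<open>0\<close> is the
  base tuple and block \<open>3\<close> the quantified one.\<close>

definition block_ren :: "nat \<Rightarrow> nat \<Rightarrow> nat \<Rightarrow> nat" where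
  "block_ren m b v = prod_encode (if v < m then b else 3, v)"

definition preorder_fm :: "('f, 'p) fm \<Rightarrow> nat \<Rightarrow> nat \<Rightarrow> nat \<Rightarrow> nat \<Rightarrow> ('f, 'p) fm" where
  "preorder_fm \<eta> m n b c = himps (map (\<lambda>v. prod_encode (3, v)) [m..<m + n])
     (And (ren (block_ren m 0) \<eta>) (ren (block_ren m b) \<eta>)) (ren (block_ren m c) \<eta>)"

lemma inj_block_ren: "inj (block_ren m b)"
  by (auto simp: inj_def block_ren_def)

lemma hfm_preorder_fm: "hfm \<eta> \<Longrightarrow> hfm (preorder_fm \<eta> m n b c)"
  by (simp add: preorder_fm_def hfm_himps hfm_ren hfm.intros)

lemma wf_preorder_fm: "wf_fm L \<eta> \<Longrightarrow> wf_fm L (preorder_fm \<eta> m n b c)"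
  by (simp add: preorder_fm_def wf_himps wf_ren)

lemma fv_preorder_fm:
  assumes "fv \<eta> \<subseteq> {..<m + n}"
  shows "fv (preorder_fm \<eta> m n b c) \<subseteq> {prod_encode (d, v) | d v. d \<in> {0, b, c} \<and> v < m}"
proof
  fix w assume "w \<in> fv (preorder_fm \<eta> m n b c)"
  then obtain d v where d: "d \<in> {0, b, c}" "v \<in> fv \<eta>" "w = block_ren m d v"
    and w: "w \<notin> (\<lambda>v. prod_encode (3, v)) ` {m..<m + n}"
    by (auto simp: preorder_fm_def fv_himps fv_ren[OF inj_block_ren])
  have "v < m"
  proof (rule ccontr)
    assume "\<not> v < m"
    then have "w = prod_encode (3, v)" "v \<in> {m..<m + n}" using d assms by (auto simp: block_ren_def)
    then show False using w by blast
  qed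
  then show "w \<in> {prod_encode (d, v) | d v. d \<in> {0, b, c} \<and> v < m}"
    using d by (auto simp: block_ren_def)
qed

text \<open>Block 3 is bound, so the compared tuples must avoid it. The values of \<open>f\<close>
  off this block do not matter, and \<open>f\<close> can be traded for the quantified tuple
  \<open>y\<close>.\<close>

lemma sat_preorder_fm:
  fixes N :: "('f, 'p, 'a) fo_struct"
  assumes fv: "fv \<eta> \<subseteq> {..<m + n}" and b: "b \<noteq> 3" "c \<noteq> 3"
  shows "sat N e (preorder_fm \<eta> m n b c) \<longleftrightarrow> preorder_at \<eta> m n N (\<lambda>v. e (prod_encode (0, v)))
    (\<lambda>v. e (prod_encode (b, v))) (\<lambda>v. e (prod_encode (c, v)))"
proof -
  let ?vs = "map (\<lambda>v. prod_encode (3, v)) [m..<m + n]"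
  have dist: "distinct ?vs" by (simp add: distinct_map inj_on_def)
  have *: "sat N (override_on e f (set ?vs)) (ren (block_ren m d) \<eta>) \<longleftrightarrow>
      sat N (mix m (\<lambda>v. e (prod_encode (d, v))) (\<lambda>v. f (prod_encode (3, v)))) \<eta>" if "d \<noteq> 3" for d f
    unfolding sat_ren[OF inj_block_ren]
  proof (rule sat_cong)
    fix v assume "v \<in> fv \<eta>"
    then have "v < m + n" using fv by auto
    then show "override_on e f (set ?vs) (block_ren m d v) =
      mix m (\<lambda>v. e (prod_encode (d, v))) (\<lambda>v. f (prod_encode (3, v))) v"
      using that by (auto simp: override_on_def block_ren_def mix_def)
  qed
  let ?P = "\<lambda>y. sat N (mix m (\<lambda>v. e (prod_encode (0, v))) y) \<eta> \<and> sat N (mix m (\<lambda>v. e (prod_encode (b, v))) y) \<eta>"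
  let ?Q = "\<lambda>y. sat N (mix m (\<lambda>v. e (prod_encode (c, v))) y) \<eta>"
  have "sat N e (preorder_fm \<eta> m n b c) \<longleftrightarrow>
     (\<exists>f. f ` set ?vs \<subseteq> univ N \<and> ?P (\<lambda>v. f (prod_encode (3, v)))) \<and>
     (\<forall>f. f ` set ?vs \<subseteq> univ N \<longrightarrow> ?P (\<lambda>v. f (prod_encode (3, v))) \<longrightarrow> ?Q (\<lambda>v. f (prod_encode (3, v))))"
    unfolding preorder_fm_def sat_himps[OF dist] sat.simps using * b by auto
  also have "\<dots> \<longleftrightarrow> (\<exists>y. y ` {m..<m + n} \<subseteq> univ N \<and> ?P y) \<and>
     (\<forall>y. y ` {m..<m + n} \<subseteq> univ N \<longrightarrow> ?P y \<longrightarrow> ?Q y)"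
  proof -
    have 1: "f ` set ?vs \<subseteq> univ N \<longleftrightarrow> (\<lambda>v. f (prod_encode (3, v))) ` {m..<m + n} \<subseteq> univ N" for f
      by (auto simp: image_subset_iff)
    have all: "(\<forall>f. G (\<lambda>v. f (prod_encode (3, v)))) \<longleftrightarrow> (\<forall>y. G y)" for G :: "(nat \<Rightarrow> 'a) \<Rightarrow> bool"
    proof
      assume G: "\<forall>f. G (\<lambda>v. f (prod_encode (3, v)))"
      show "\<forall>y. G y"
      proof
        fix y show "G y" using G[rule_format, of "\<lambda>w. y (snd (prod_decode w))"] by simp
      qed
    qed simp
    have ex: "(\<exists>f. G (\<lambda>v. f (prod_encode (3, v)))) \<longleftrightarrow> (\<exists>y. G y)" for G :: "(nat \<Rightarrow> 'a) \<Rightarrow> bool"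
      using all[of "\<lambda>y. \<not> G y"] by blast
    show ?thesis
      unfolding 1 using ex[of "\<lambda>y. y ` {m..<m + n} \<subseteq> univ N \<and> ?P y"]
        all[of "\<lambda>y. y ` {m..<m + n} \<subseteq> univ N \<longrightarrow> ?P y \<longrightarrow> ?Q y"] by (simp only:)
  qed
  finally show ?thesis unfolding preorder_at_def imp_conjL .
qed

section \<open>Coding subsets of \<open>A\<close> by tuples\<close>

context reduced_prod
begin

text \<open>For a lower bound of \<open>\<C>\<close> one asks for \<open>x\<close> below every
  \<open>u C\<close> but not below \<open>u {}\<close>. Outside \<open>C\<close> both codes equal
  \<open>\<alpha>'\<close>, so the set where \<open>x\<close> is not below \<open>\<alpha>'\<close>
  is almost contained in \<open>C\<close>. For separation one asks for
  \<open>u Z \<le> x \<le> u (A - W)\<close>. The set where \<open>\<alpha>\<close> is below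
  \<open>x\<close> then almost contains \<open>Z\<close>, and it almost avoids \<open>W\<close>,
  since \<open>\<alpha> \<le> x \<le> \<alpha>'\<close> is excluded almost everywhere on
  \<open>A\<close>.\<close>

lemma saturated_lower_bound_and_separation:
  assumes \<kappa>: "Card_order \<kappa>" "infinite (Field \<kappa>)" and saturated: "saturated \<kappa> L RP"
    and \<eta>: "hfm \<eta>" "wf_fm L \<eta>" "fv \<eta> \<subseteq> {..<m + n}"
    and all_PU: "\<forall>v. \<alpha> v \<in> PU" "\<forall>v. \<alpha>' v \<in> PU" "\<forall>v. \<beta> v \<in> PU" "\<forall>v. \<beta>' v \<in> PU"
    and holds: "fails \<eta> (mix m \<alpha> \<beta>) \<in> J" "fails \<eta> (mix m \<alpha> \<beta>') \<in> J" "fails \<eta> (mix m \<alpha>' \<beta>) \<in> J"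
    and A: "A = fails \<eta> (mix m \<alpha>' \<beta>')"
  shows "lower_bound_property \<kappa> A (J \<inter> Pow A)" "separation_property \<kappa> A (J \<inter> Pow A)"
proof -
  note PU = all_PU[rule_format]
  define le where "le i s t \<longleftrightarrow> preorder_at \<eta> m n (M i) (\<lambda>v. \<alpha> v i) (\<lambda>v. s v i) (\<lambda>v. t v i)"
    for i and s t :: "nat \<Rightarrow> 'i \<Rightarrow> 'a"
  have le_trans: "le i s t \<Longrightarrow> le i t r \<Longrightarrow> le i s r" for i s t r
    unfolding le_def by (rule preorder_at_trans)
  have le_cong: "le i s t \<longleftrightarrow> le i s' t'" if "\<And>v. v < m \<Longrightarrow> s v i = s' v i" "\<And>v. v < m \<Longrightarrow> t v i = t' v i" for i s t s' t'
    unfolding le_def using that by (intro preorder_at_cong) auto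
  \<comment> \<open>Off the null set \<open>B\<close> the three instances assumed in
    \<open>holds\<close> are true, which gives the three base inequalities and, on \<open>A\<close>,
    strictness.\<close>
  define B where "B = fails \<eta> (mix m \<alpha> \<beta>) \<union> fails \<eta> (mix m \<alpha> \<beta>') \<union> fails \<eta> (mix m \<alpha>' \<beta>)"
  have BJ: "B \<in> J" unfolding B_def using holds ideal_onD(3)[OF ideal] by blast
  have AI: "A \<subseteq> I" by (auto simp: A fails_def)
  have mixc: "(\<lambda>v. mix m s t v i) = mix m (\<lambda>v. s v i) (\<lambda>v. t v i)" for s t :: "nat \<Rightarrow> 'i \<Rightarrow> 'a" and i
    by (auto simp: mix_def fun_eq_iff)
  have le_base: "le i \<alpha> \<alpha>" "le i \<alpha>' \<alpha>" "le i \<alpha>' \<alpha>'" if "i \<in> I - B" for i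
  proof -
    have "(\<lambda>v. \<beta> v i) ` {m..<m + n} \<subseteq> univ (M i)" using PU_univ[OF PU(3)] that by auto
    moreover have "sat (M i) (mix m (\<lambda>v. \<alpha> v i) (\<lambda>v. \<beta> v i)) \<eta>" "sat (M i) (mix m (\<lambda>v. \<alpha>' v i) (\<lambda>v. \<beta> v i)) \<eta>"
      using that unfolding B_def fails_def mixc by blast+
    ultimately show "le i \<alpha> \<alpha>" "le i \<alpha>' \<alpha>" "le i \<alpha>' \<alpha>'"
      unfolding le_def preorder_at_def by blast+
  qed
  have le_strict: "\<not> le i \<alpha> \<alpha>'" if "i \<in> A - B" for i
  proof -
    have i: "i \<in> I" using that AI by blast
    have "(\<lambda>v. \<beta>' v i) ` {m..<m + n} \<subseteq> univ (M i)" using PU_univ[OF PU(4) i] by auto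
    moreover have "sat (M i) (mix m (\<lambda>v. \<alpha> v i) (\<lambda>v. \<beta>' v i)) \<eta>" "\<not> sat (M i) (mix m (\<lambda>v. \<alpha>' v i) (\<lambda>v. \<beta>' v i)) \<eta>"
      using that i unfolding A B_def fails_def mixc by blast+
    ultimately show ?thesis unfolding le_def preorder_at_def by blast
  qed
  define u where "u Z v = (\<lambda>i \<in> I. if i \<in> Z then \<alpha> v i else \<alpha>' v i)" for Z v
  have uPU: "u Z v \<in> PU" for Z v
    using PU(1,2) unfolding u_def product_univ_def by (auto simp: PiE_iff)
  have u1: "u Z v i = \<alpha> v i" if "i \<in> I" "i \<in> Z" for Z v i using that by (simp add: u_def)
  have u0: "u Z v i = \<alpha>' v i" if "i \<in> I" "i \<notin> Z" for Z v i using that by (simp add: u_def)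

  define \<Psi> where "\<Psi> = preorder_fm \<eta> m n"
  \<comment> \<open>Block 1 is the unknown tuple and block 0 the base \<open>\<alpha>\<close>. Every
    other block is filled with \<open>u Z\<close>, though among these only block 2 occurs
    free.\<close>
  define V where "V = (\<lambda>v. prod_encode (1, v)) ` {..<m}"
  define E where "E Z w = (let (b, v) = prod_decode w in rcl (if b = 0 then \<alpha> v else u Z v))" for Z w
  define hold where "hold x \<phi> e \<longleftrightarrow> sat RP (override_on e (\<lambda>w. rcl (x (snd (prod_decode w)))) V) \<phi>"
    for x :: "nat \<Rightarrow> 'i \<Rightarrow> 'a" and \<phi> :: "('f, 'p) fm" and e
  have coords: "override_on (E Z) (\<lambda>w. rcl (x (snd (prod_decode w)))) V =
      (\<lambda>w. rcl (let (b, v) = prod_decode w in if b = 0 then \<alpha> v else if b = 1 \<and> v < m then x v else u Z v))" for Z x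
  proof
    fix w
    obtain b v where w: "w = prod_encode (b, v)" by (metis prod_decode_inverse surj_pair)
    show "override_on (E Z) (\<lambda>w. rcl (x (snd (prod_decode w)))) V w =
       rcl (let (b, v) = prod_decode w in if b = 0 then \<alpha> v else if b = 1 \<and> v < m then x v else u Z v)"
      unfolding w by (auto simp: override_on_def V_def E_def)
  qed
  have hold_iff: "hold x (\<Psi> 1 2) (E Z) \<longleftrightarrow> {i \<in> I. \<not> le i x (u Z)} \<in> J"
    "hold x (\<Psi> 2 1) (E Z) \<longleftrightarrow> {i \<in> I. \<not> le i (u Z) x} \<in> J" if x: "\<forall>v. x v \<in> PU" for x Z
  proof -
    let ?a = "\<lambda>w. let (b, v) = prod_decode w in if b = 0 then \<alpha> v else if b = 1 \<and> v < m then x v else u Z v"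
    have aPU: "?a w \<in> PU" for w using x PU uPU by (auto split: prod.split)
    have hf: "hfm (\<Psi> b c)" "wf_fm L (\<Psi> b c)" for b c
      using \<eta> by (auto simp: \<Psi>_def hfm_preorder_fm wf_preorder_fm)
    have n3: "(1 :: nat) \<noteq> 3" "(2 :: nat) \<noteq> 3" by simp_all
    have 1: "fails (\<Psi> 1 2) ?a = {i \<in> I. \<not> le i x (u Z)}"
      unfolding fails_def \<Psi>_def sat_preorder_fm[OF \<eta>(3) n3(1,2)] le_def
      by (intro Collect_cong conj_cong refl arg_cong[of _ _ Not] preorder_at_cong) auto
    have 2: "fails (\<Psi> 2 1) ?a = {i \<in> I. \<not> le i (u Z) x}"
      unfolding fails_def \<Psi>_def sat_preorder_fm[OF \<eta>(3) n3(2,1)] le_def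
      by (intro Collect_cong conj_cong refl arg_cong[of _ _ Not] preorder_at_cong) auto
    show "hold x (\<Psi> 1 2) (E Z) \<longleftrightarrow> {i \<in> I. \<not> le i x (u Z)} \<in> J"
      unfolding hold_def coords 1[symmetric] by (rule sat_hfm[OF hf aPU])
    show "hold x (\<Psi> 2 1) (E Z) \<longleftrightarrow> {i \<in> I. \<not> le i (u Z) x} \<in> J"
      unfolding hold_def coords 2[symmetric] by (rule sat_hfm[OF hf aPU])
  qed
  have hold_Neg: "hold x (Neg \<phi>) e \<longleftrightarrow> \<not> hold x \<phi> e" for x \<phi> e by (simp add: hold_def)

  have realise: "\<exists>x. (\<forall>v. x v \<in> PU) \<and> (\<forall>(\<phi>, e) \<in> p. hold x \<phi> e)"
    if K: "|K| <o \<kappa>" and p: "p \<subseteq> {\<Psi> 1 2, Neg (\<Psi> 1 2), \<Psi> 2 1} \<times> E ` K"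
      and q: "\<forall>q \<subseteq> p. finite q \<longrightarrow> (\<exists>x. (\<forall>v. x v \<in> PU) \<and> (\<forall>(\<phi>, e) \<in> q. hold x \<phi> e))" for K p
  proof -
    \<comment> \<open>Each \<open>Z\<close> contributes one parameter for every place
      \<open>v < m\<close>, and finitely many images of the small set \<open>K\<close> are still
      small together.\<close>
    define P where "P = rcl ` \<alpha> ` {..<m} \<union> (\<Union>v \<in> {..<m}. (\<lambda>Z. rcl (u Z v)) ` K)"
    have "|\<Union>v \<in> {..<k}. (\<lambda>Z. rcl (u Z v)) ` K| <o \<kappa>" for k
    proof (induction k)
      case 0
      show ?case by (rule Card_order_finite_ordLess[OF \<kappa>]) simp
    next
      case (Suc k)
      have "(\<Union>v \<in> {..<Suc k}. (\<lambda>Z. rcl (u Z v)) ` K) = (\<lambda>Z. rcl (u Z k)) ` K \<union> (\<Union>v \<in> {..<k}. (\<lambda>Z. rcl (u Z v)) ` K)"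
        by (simp only: lessThan_Suc UN_insert)
      then show ?case using small_Un[OF \<kappa> small_image[OF K] Suc] by simp
    qed
    moreover have "|rcl ` \<alpha> ` {..<m}| <o \<kappa>" by (rule Card_order_finite_ordLess[OF \<kappa>]) simp
    ultimately have Ps: "|P| <o \<kappa>" unfolding P_def by (intro small_Un \<kappa>)
    have PU': "P \<subseteq> univ RP" using PU uPU by (auto simp: P_def univ_RP)
    have "realised_on RP V p"
    proof (rule saturated_realised_on[OF \<kappa> saturated _ PU' Ps])
      show "finite V" by (simp add: V_def)
      show "wf_fm L \<phi> \<and> (\<forall>w \<in> fv \<phi> - V. e w \<in> P)" if pe: "(\<phi>, e) \<in> p" for \<phi> e
      proof -
        obtain Z where Z: "Z \<in> K" "e = E Z" and \<phi>: "\<phi> \<in> {\<Psi> 1 2, Neg (\<Psi> 1 2), \<Psi> 2 1}" using pe p by blast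
        have "wf_fm L \<phi>" using \<phi> wf_preorder_fm[OF \<eta>(2)] by (auto simp: \<Psi>_def)
        moreover have "e w \<in> P" if w: "w \<in> fv \<phi> - V" for w
        proof -
          have "w \<in> fv (preorder_fm \<eta> m n 1 2) \<union> fv (preorder_fm \<eta> m n 2 1)" using w \<phi> by (auto simp: \<Psi>_def)
          then obtain d v where dv: "w = prod_encode (d, v)" "d \<in> {0, 1, 2}" "v < m"
            using fv_preorder_fm[OF \<eta>(3)] by blast
          moreover have "d \<noteq> 1" using w dv by (auto simp: V_def)
          ultimately show ?thesis using Z by (auto simp: E_def P_def)
        qed
        ultimately show ?thesis by blast
      qed
      fix q' assume "q' \<subseteq> p" "finite q'"
      then obtain x where "\<forall>v. x v \<in> PU" "\<forall>(\<phi>, e) \<in> q'. hold x \<phi> e" using q by blast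
      then show "realised_on RP V q'"
        unfolding realised_on_def hold_def
        by (intro exI[of _ "\<lambda>w. rcl (x (snd (prod_decode w)))"]) (auto simp: univ_RP)
    qed
    then obtain f where f: "f ` V \<subseteq> univ RP" "\<forall>(\<phi>, e) \<in> p. sat RP (override_on e f V) \<phi>"
      unfolding realised_on_def by blast
    have "\<exists>y \<in> PU. v < m \<longrightarrow> rcl y = f (prod_encode (1, v))" for v
    proof (cases "v < m")
      case True
      then have "f (prod_encode (1, v)) \<in> rcl ` PU" using f(1) by (auto simp: V_def univ_RP)
      then show ?thesis by force
    next
      case False
      then show ?thesis using PU(1) by blast
    qed
    then obtain x where x: "\<And>v. x v \<in> PU" "\<And>v. v < m \<Longrightarrow> rcl (x v) = f (prod_encode (1, v))" by metis
    have "override_on e (\<lambda>w. rcl (x (snd (prod_decode w)))) V = override_on e f V" for e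
      using x(2) by (auto simp: override_on_def V_def fun_eq_iff)
    then have "\<forall>(\<phi>, e) \<in> p. hold x \<phi> e" using f(2) by (simp add: hold_def)
    then show ?thesis using x(1) by blast
  qed

  note sub = ideal_onD(2)[OF ideal] and subUn = ideal_subset_Un[OF ideal]
  have le_u: "le i (u X) (u Z)" if iIB: "i \<in> I - B" and XZ: "i \<in> X \<Longrightarrow> i \<in> Z" for i X Z
  proof -
    have i: "i \<in> I" using iIB by blast
    consider "i \<in> X" "i \<in> Z" | "i \<notin> X" "i \<in> Z" | "i \<notin> X" "i \<notin> Z" using XZ by blast
    then show ?thesis
    proof cases
      case 1
      then have "le i (u X) (u Z) \<longleftrightarrow> le i \<alpha> \<alpha>" using u1[OF i] by (intro le_cong) auto
      then show ?thesis using le_base iIB by blast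
    next
      case 2
      then have "le i (u X) (u Z) \<longleftrightarrow> le i \<alpha>' \<alpha>" using u1[OF i] u0[OF i] by (intro le_cong) auto
      then show ?thesis using le_base iIB by blast
    next
      case 3
      then have "le i (u X) (u Z) \<longleftrightarrow> le i \<alpha>' \<alpha>'" using u0[OF i] by (intro le_cong) auto
      then show ?thesis using le_base iIB by blast
    qed
  qed

  show "lower_bound_property \<kappa> A (J \<inter> Pow A)"
    unfolding lower_bound_property_def
  proof (intro allI impI)
    fix \<C> assume C: "\<C> \<subseteq> Pow A" "|\<C>| <o \<kappa>" "\<forall>F \<subseteq> \<C>. finite F \<longrightarrow> A \<inter> \<Inter>F \<notin> J \<inter> Pow A"
    \<comment> \<open>Adding the condition for \<open>A\<close> itself makes the set
      \<open>Y\<close> read off from a realisation almost contained in \<open>A\<close>.\<close>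
    define p where "p = insert (Neg (\<Psi> 1 2), E {}) ((\<lambda>C. (\<Psi> 1 2, E C)) ` insert A \<C>)"
    have "\<exists>x. (\<forall>v. x v \<in> PU) \<and> (\<forall>(\<phi>, e) \<in> p. hold x \<phi> e)"
    proof (rule realise[of "insert {} (insert A \<C>)"])
      show "|insert {} (insert A \<C>)| <o \<kappa>" by (intro insert_ordLess \<kappa> C)
      show "p \<subseteq> {\<Psi> 1 2, Neg (\<Psi> 1 2), \<Psi> 2 1} \<times> E ` insert {} (insert A \<C>)" by (auto simp: p_def)
      show "\<forall>q \<subseteq> p. finite q \<longrightarrow> (\<exists>x. (\<forall>v. x v \<in> PU) \<and> (\<forall>(\<phi>, e) \<in> q. hold x \<phi> e))"
      proof (intro allI impI)
        fix q assume q: "q \<subseteq> p" "finite q"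
        obtain F where F: "F \<subseteq> insert A \<C>" "finite F" "q - {(Neg (\<Psi> 1 2), E {})} = (\<lambda>C. (\<Psi> 1 2, E C)) ` F"
          using finite_subset_insert_image[OF q[unfolded p_def]] by metis
        define X where "X = A \<inter> \<Inter>F"
        have "X = A \<inter> \<Inter>(F - {A})" by (auto simp: X_def)
        moreover have "F - {A} \<subseteq> \<C>" "finite (F - {A})" using F by auto
        ultimately have "X \<notin> J \<inter> Pow A" using C(3) by metis
        then have XJ: "X \<notin> J" by (auto simp: X_def)
        have "hold (u X) \<phi> e" if pe: "(\<phi>, e) \<in> q" for \<phi> e
        proof (cases "(\<phi>, e) = (Neg (\<Psi> 1 2), E {})")
          case True
          have "X \<subseteq> {i \<in> I. \<not> le i (u X) (u {})} \<union> B"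
          proof
            fix i assume iX: "i \<in> X"
            then have i: "i \<in> I" "i \<in> A" using AI by (auto simp: X_def)
            have "le i (u X) (u {}) \<longleftrightarrow> le i \<alpha> \<alpha>'" using u1[OF i(1) iX] u0[OF i(1)] by (intro le_cong) auto
            then show "i \<in> {i \<in> I. \<not> le i (u X) (u {})} \<union> B" using le_strict i by blast
          qed
          then have "{i \<in> I. \<not> le i (u X) (u {})} \<notin> J" using subUn[OF _ BJ] XJ by blast
          then show ?thesis using True hold_iff(1) uPU by (simp add: hold_Neg)
        next
          case False
          then have "(\<phi>, e) \<in> (\<lambda>C. (\<Psi> 1 2, E C)) ` F" using pe F(3) by blast
          then obtain C where CF: "C \<in> F" "\<phi> = \<Psi> 1 2" "e = E C" by blast
          have "{i \<in> I. \<not> le i (u X) (u C)} \<subseteq> B" using le_u[of _ X C] CF(1) by (auto simp: X_def)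
          then have "{i \<in> I. \<not> le i (u X) (u C)} \<in> J" using sub[OF BJ] by blast
          then show ?thesis using CF hold_iff(1) uPU by simp
        qed
        then show "\<exists>x. (\<forall>v. x v \<in> PU) \<and> (\<forall>(\<phi>, e) \<in> q. hold x \<phi> e)" using uPU by blast
      qed
    qed
    then obtain x where x: "\<forall>v. x v \<in> PU" "\<forall>(\<phi>, e) \<in> p. hold x \<phi> e" by blast
    define Y where "Y = {i \<in> I. \<not> le i x (u {})}"
    have "hold x (Neg (\<Psi> 1 2)) (E {})" using x(2) by (simp add: p_def)
    then have YJ: "Y \<notin> J" using hold_iff(1)[OF x(1)] by (simp add: hold_Neg Y_def)
    have YC: "Y - C \<in> J" if "C \<in> insert A \<C>" for C
    proof -
      have "hold x (\<Psi> 1 2) (E C)" using x(2) that by (auto simp: p_def)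
      then have "{i \<in> I. \<not> le i x (u C)} \<in> J" using hold_iff(1)[OF x(1)] by blast
      moreover have "Y - C \<subseteq> {i \<in> I. \<not> le i x (u C)}"
      proof
        fix i assume i: "i \<in> Y - C"
        then have "i \<in> I" by (simp add: Y_def)
        then have "le i x (u C) \<longleftrightarrow> le i x (u {})" using u0 i by (intro le_cong) auto
        then show "i \<in> {i \<in> I. \<not> le i x (u C)}" using i by (simp add: Y_def)
      qed
      ultimately show ?thesis using sub by blast
    qed
    have "Y \<inter> A \<notin> J" using subUn[of "Y - A" "Y \<inter> A" Y] YC[of A] YJ by blast
    moreover have "Y \<inter> A - C \<in> J" if "C \<in> \<C>" for C using sub[OF YC[of C], of "Y \<inter> A - C"] that by blast
    ultimately show "\<exists>Y \<subseteq> A. Y \<notin> J \<inter> Pow A \<and> (\<forall>C \<in> \<C>. Y - C \<in> J \<inter> Pow A)"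
      by (intro exI[of _ "Y \<inter> A"]) auto
  qed

  show "separation_property \<kappa> A (J \<inter> Pow A)"
    unfolding separation_property_def
  proof (intro allI impI)
    fix \<A> \<B> assume sub\<A>: "\<A> \<subseteq> Pow A" "\<B> \<subseteq> Pow A" and small: "|\<A>| <o \<kappa>" "|\<B>| <o \<kappa>"
      and orth: "\<forall>Z \<in> \<A>. \<forall>W \<in> \<B>. Z \<inter> W \<in> J \<inter> Pow A"
    define g1 where "g1 Z = (\<Psi> 2 1, E Z)" for Z
    define g2 where "g2 W = (\<Psi> 1 2, E (A - W))" for W
    define p where "p = g1 ` \<A> \<union> g2 ` \<B>"
    have "\<exists>x. (\<forall>v. x v \<in> PU) \<and> (\<forall>(\<phi>, e) \<in> p. hold x \<phi> e)"
    proof (rule realise[of "\<A> \<union> (\<lambda>W. A - W) ` \<B>"])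
      show "|\<A> \<union> (\<lambda>W. A - W) ` \<B>| <o \<kappa>" by (intro small_Un small_image \<kappa> small)
      show "p \<subseteq> {\<Psi> 1 2, Neg (\<Psi> 1 2), \<Psi> 2 1} \<times> E ` (\<A> \<union> (\<lambda>W. A - W) ` \<B>)"
        by (auto simp: p_def g1_def g2_def)
      show "\<forall>q \<subseteq> p. finite q \<longrightarrow> (\<exists>x. (\<forall>v. x v \<in> PU) \<and> (\<forall>(\<phi>, e) \<in> q. hold x \<phi> e))"
      proof (intro allI impI)
        fix q assume q: "q \<subseteq> p" "finite q"
        have "q \<inter> g1 ` \<A> \<subseteq> g1 ` \<A>" "finite (q \<inter> g1 ` \<A>)" using q by auto
        then obtain F1 where F1: "F1 \<subseteq> \<A>" "finite F1" "q \<inter> g1 ` \<A> = g1 ` F1" by (meson finite_subset_image)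
        \<comment> \<open>The finitely many \<open>Z\<close> alone determine the candidate: by
          orthogonality their union almost avoids every \<open>W\<close>.\<close>
        define X where "X = \<Union>F1"
        have "hold (u X) \<phi> e" if pe: "(\<phi>, e) \<in> q" for \<phi> e
        proof (cases "(\<phi>, e) \<in> g1 ` \<A>")
          case True
          then have "(\<phi>, e) \<in> g1 ` F1" using pe F1(3) by blast
          then obtain Z where Z: "Z \<in> F1" "\<phi> = \<Psi> 2 1" "e = E Z" by (auto simp: g1_def)
          have "{i \<in> I. \<not> le i (u Z) (u X)} \<subseteq> B" using le_u[of _ Z X] Z(1) by (auto simp: X_def)
          then have "{i \<in> I. \<not> le i (u Z) (u X)} \<in> J" using sub[OF BJ] by blast
          then show ?thesis using Z hold_iff(2) uPU by simp
        next
          case False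
          then have "(\<phi>, e) \<in> g2 ` \<B>" using pe q(1) by (auto simp: p_def)
          then obtain W where W: "W \<in> \<B>" "\<phi> = \<Psi> 1 2" "e = E (A - W)" by (auto simp: g2_def)
          have "(\<lambda>Z. Z \<inter> W) ` F1 \<subseteq> J" using orth W(1) F1(1) by blast
          then have "\<Union>((\<lambda>Z. Z \<inter> W) ` F1) \<in> J" using F1(2) by (intro ideal_finite_Union[OF ideal]) auto
          moreover have "{i \<in> I. \<not> le i (u X) (u (A - W))} \<subseteq> \<Union>((\<lambda>Z. Z \<inter> W) ` F1) \<union> B"
          proof
            fix i assume i: "i \<in> {i \<in> I. \<not> le i (u X) (u (A - W))}"
            show "i \<in> \<Union>((\<lambda>Z. Z \<inter> W) ` F1) \<union> B"
            proof (cases "i \<in> B")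
              case False
              then have "i \<in> X" "i \<notin> A - W" using i le_u[of i X "A - W"] by auto
              then obtain Z where "Z \<in> F1" "i \<in> Z" by (auto simp: X_def)
              moreover have "i \<in> W" using \<open>i \<notin> A - W\<close> calculation F1(1) sub\<A>(1) by blast
              ultimately show ?thesis by blast
            qed simp
          qed
          ultimately have "{i \<in> I. \<not> le i (u X) (u (A - W))} \<in> J" using subUn[OF _ BJ] by blast
          then show ?thesis using W hold_iff(1) uPU by simp
        qed
        then show "\<exists>x. (\<forall>v. x v \<in> PU) \<and> (\<forall>(\<phi>, e) \<in> q. hold x \<phi> e)" using uPU by blast
      qed
    qed
    then obtain x where x: "\<forall>v. x v \<in> PU" "\<forall>(\<phi>, e) \<in> p. hold x \<phi> e" by blast
    define X where "X = {i \<in> A. le i \<alpha> x}"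
    have "Z - X \<in> J \<inter> Pow A" if Z: "Z \<in> \<A>" for Z
    proof -
      have "hold x (\<Psi> 2 1) (E Z)" using x(2) Z by (auto simp: p_def g1_def)
      then have "{i \<in> I. \<not> le i (u Z) x} \<in> J" using hold_iff(2)[OF x(1)] by blast
      moreover have "Z - X \<subseteq> {i \<in> I. \<not> le i (u Z) x}"
      proof
        fix i assume i: "i \<in> Z - X"
        then have "i \<in> A" "i \<in> I" using Z sub\<A>(1) AI by blast+
        moreover have "le i (u Z) x \<longleftrightarrow> le i \<alpha> x" using u1 \<open>i \<in> I\<close> i by (intro le_cong) auto
        ultimately show "i \<in> {i \<in> I. \<not> le i (u Z) x}" using i by (simp add: X_def)
      qed
      ultimately show ?thesis using sub Z sub\<A>(1) by blast
    qed
    moreover have "W \<inter> X \<in> J \<inter> Pow A" if W: "W \<in> \<B>" for W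
    proof -
      have "hold x (\<Psi> 1 2) (E (A - W))" using x(2) W by (auto simp: p_def g2_def)
      then have "{i \<in> I. \<not> le i x (u (A - W))} \<in> J" using hold_iff(1)[OF x(1)] by blast
      moreover have "W \<inter> X \<subseteq> {i \<in> I. \<not> le i x (u (A - W))} \<union> B"
      proof
        fix i assume i: "i \<in> W \<inter> X"
        then have iA: "i \<in> A" "i \<in> I" "le i \<alpha> x" using AI by (auto simp: X_def)
        have "le i x (u (A - W)) \<longleftrightarrow> le i x \<alpha>'" using u0 iA i by (intro le_cong) auto
        then show "i \<in> {i \<in> I. \<not> le i x (u (A - W))} \<union> B"
          using le_trans[OF iA(3)] le_strict[of i] iA by blast
      qed
      ultimately have "W \<inter> X \<in> J" using subUn[OF _ BJ] by blast
      then show ?thesis by (auto simp: X_def)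
    qed
    moreover have "X \<subseteq> A" by (auto simp: X_def)
    ultimately show "\<exists>X \<subseteq> A. (\<forall>A' \<in> \<A>. A' - X \<in> J \<inter> Pow A) \<and> (\<forall>B' \<in> \<B>. B' \<inter> X \<in> J \<inter> Pow A)" by blast
  qed
qed

end

section \<open>Unstable reduced products\<close>

lemma atomless_ideal_pow_quotient:
  assumes ideal: "ideal_on I J" and at: "atomless (pow_quotient I J)"
  shows "atomless_ideal I J"
  unfolding atomless_ideal_def
proof (intro allI impI)
  fix X assume X: "X \<subseteq> I" "X \<notin> J"
  let ?B = "pow_quotient I J"
  note eq = pcl_eq_iff[OF ideal] and univ = univ_pow_quotient[OF ideal]
  have zero: "fun_interp ?B Zero [] = pcl I J {}"
    using fun_interp_pow_quotient[OF ideal, of "[]" Zero] by simp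
  have meet: "fun_interp ?B Meet [pcl I J Y, pcl I J Z] = pcl I J (Y \<inter> Z)" if "Y \<subseteq> I" "Z \<subseteq> I" for Y Z
    using fun_interp_pow_quotient[OF ideal, of "[Y, Z]" Meet] that by simp
  have "\<not> ba_atom ?B (pcl I J X)" using at by (simp add: atomless_def)
  moreover have "pcl I J X \<in> univ ?B" using X by (auto simp: univ)
  moreover have "pcl I J X \<noteq> pcl I J {}" using X eq[of X "{}"] by simp
  ultimately obtain y where y: "y \<in> univ ?B" "ba_le ?B y (pcl I J X)" "y \<noteq> pcl I J {}" "y \<noteq> pcl I J X"
    by (auto simp: ba_atom_def zero)
  then obtain Y where Y: "Y \<subseteq> I" "y = pcl I J Y" by (auto simp: univ)
  have y': "y = pcl I J (Y \<inter> X)" using y(2) Y X(1) by (simp add: ba_le_def meet)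
  have "Y \<inter> X \<notin> J" using y(3) eq[of "Y \<inter> X" "{}"] X(1) unfolding y' by auto
  moreover have "X - Y \<inter> X \<notin> J"
  proof -
    have "Y \<inter> X - X \<union> (X - Y \<inter> X) \<notin> J" using y(4) eq[of "Y \<inter> X" X] X(1) unfolding y' by blast
    then show ?thesis by (simp add: Diff_eq_empty_iff[THEN iffD2])
  qed
  ultimately show "\<exists>Y \<subseteq> X. Y \<notin> J \<and> X - Y \<notin> J" by (intro exI[of _ "Y \<inter> X"]) auto
qed

lemma ideal_on_restrict:
  assumes "ideal_on I J" "A \<subseteq> I"
  shows "ideal_on A (J \<inter> Pow A)"
  using ideal_onD[OF assms(1)] unfolding ideal_on_def by blast

lemma atomless_ideal_restrict:
  assumes "atomless_ideal I J" "A \<subseteq> I"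
  shows "atomless_ideal A (J \<inter> Pow A)"
  unfolding atomless_ideal_def
proof (intro allI impI)
  fix X assume X: "X \<subseteq> A" "X \<notin> J \<inter> Pow A"
  then have "X \<subseteq> I" "X \<notin> J" using assms(2) by auto
  then obtain Y where "Y \<subseteq> X" "Y \<notin> J" "X - Y \<notin> J" using assms(1) unfolding atomless_ideal_def by metis
  then show "\<exists>Y \<subseteq> X. Y \<notin> J \<inter> Pow A \<and> X - Y \<notin> J \<inter> Pow A" by blast
qed

text \<open>The order property is witnessed in models over another type, not in \<open>S\<close>.
  For fixed \<open>k\<close> the existence of a pattern of length \<open>k\<close> is a sentence
  \<open>\<sigma>\<close>; if it failed in \<open>S\<close>, its negation would be in the theory and
  contradict the given model. One family \<open>c\<close> can serve for both \<open>a\<close> and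
  \<open>b\<close>, because they occupy disjoint sets of places.\<close>

lemma order_property_transfer:
  fixes S :: "('f, 'p, 'a) fo_struct"
  assumes ne: "univ S \<noteq> {}" and wf: "wf_fm L \<phi>" and fv: "fv \<phi> \<subseteq> {..<m + n}"
    and op: "order_property TYPE('u) L (theory_of L S) m n \<phi>"
  shows "\<exists>c. (\<forall>i v. c i v \<in> univ S) \<and> (\<forall>i<k. \<forall>j<k. sat S (mix m (c i) (c j)) \<phi> \<longleftrightarrow> i \<le> (j::nat))"
proof -
  \<comment> \<open>An index owns one block for both of its tuples: places below \<open>m\<close>
    are taken from block \<open>i\<close>, the others from block \<open>j\<close>.\<close>
  define \<pi> where "\<pi> i j v = prod_encode (if v < m then i else j, v)" for i j v
  have inj: "inj (\<pi> i j)" for i j by (auto simp: \<pi>_def inj_def)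
  define vs where "vs = map prod_encode (List.product [0..<k] [0..<m + n])"
  have vs: "distinct vs" "set vs = prod_encode ` ({..<k} \<times> {..<m + n})"
    by (auto simp: vs_def distinct_map distinct_product atLeast0LessThan inj_prod_encode)
  define \<chi> where "\<chi> = (\<lambda>(i, j). if i \<le> j then ren (\<pi> i j) \<phi> else Neg (ren (\<pi> i j) \<phi>))"
  \<comment> \<open>The last conjunct is closed and true in every nonempty structure. An equation
    with a free variable would spoil the sentence when \<open>vs\<close> is empty, for instance when
    \<open>k = 0\<close>.\<close>
  define \<sigma> where "\<sigma> = exs vs (conj (map \<chi> (List.product [0..<k] [0..<k])) (Ex 0 (Eq (Var 0) (Var 0))))"
  have sat_\<chi>: "sat N e (\<chi> (i, j)) \<longleftrightarrow> (sat N (\<lambda>v. e (\<pi> i j v)) \<phi> \<longleftrightarrow> i \<le> j)"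
    for N :: "('f, 'p, 'b) fo_struct" and e i j
    by (simp add: \<chi>_def sat_ren[OF inj])
  have sat_\<sigma>: "sat N e \<sigma> \<longleftrightarrow> (\<exists>f. f ` set vs \<subseteq> univ N \<and> (\<forall>i<k. \<forall>j<k.
      sat N (mix m (\<lambda>v. f (prod_encode (i, v))) (\<lambda>v. f (prod_encode (j, v)))) \<phi> \<longleftrightarrow> i \<le> j))"
    if "univ N \<noteq> {}" for N :: "('f, 'p, 'b) fo_struct" and e
  proof -
    have "sat N (\<lambda>v. override_on e f (set vs) (\<pi> i j v)) \<phi> \<longleftrightarrow>
       sat N (mix m (\<lambda>v. f (prod_encode (i, v))) (\<lambda>v. f (prod_encode (j, v)))) \<phi>" if "i < k" "j < k" for f i j
    proof (rule sat_cong)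
      fix v assume "v \<in> fv \<phi>"
      then have "\<pi> i j v \<in> set vs" using fv that by (auto simp: vs \<pi>_def)
      then show "override_on e f (set vs) (\<pi> i j v) = mix m (\<lambda>v. f (prod_encode (i, v))) (\<lambda>v. f (prod_encode (j, v))) v"
        by (simp add: override_on_def) (simp add: \<pi>_def mix_def)
    qed
    then have "(\<forall>\<psi> \<in> set (map \<chi> (List.product [0..<k] [0..<k])). sat N (override_on e f (set vs)) \<psi>) \<longleftrightarrow>
       (\<forall>i<k. \<forall>j<k. sat N (mix m (\<lambda>v. f (prod_encode (i, v))) (\<lambda>v. f (prod_encode (j, v)))) \<phi> \<longleftrightarrow> i \<le> j)" for f
      by (auto simp: sat_\<chi>)
    then show ?thesis using that unfolding \<sigma>_def sat_exs[OF vs(1)] sat_conj by auto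
  qed
  have "wf_fm L \<sigma>" using wf by (auto simp: \<sigma>_def wf_exs wf_conj \<chi>_def wf_ren)
  moreover have "fv \<sigma> = {}"
  proof -
    have "\<pi> i j v \<in> set vs" if "v \<in> fv \<phi>" "i < k" "j < k" for i j v using fv that by (auto simp: vs \<pi>_def)
    then show ?thesis by (auto simp: \<sigma>_def fv_exs fv_conj \<chi>_def fv_ren[OF inj] split: if_splits)
  qed
  ultimately have sent: "Neg \<sigma> \<in> sentences L" by (simp add: sentences_def)
  have "\<exists>e. sat S e \<sigma>"
  proof (rule ccontr)
    assume "\<nexists>e. sat S e \<sigma>"
    then have th: "Neg \<sigma> \<in> theory_of L S" using sent by (auto simp: theory_of_def true_in_def)
    obtain N :: "('f, 'p, 'u) fo_struct" and a b where N: "is_model L (theory_of L S) N"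
      and ab: "\<forall>i<k. length (a i) = m \<and> set (a i) \<subseteq> univ N \<and> length (b i) = n \<and> set (b i) \<subseteq> univ N"
      and ord: "\<forall>i<k. \<forall>j<k. sat N (\<lambda>v. (a i @ b j) ! v) \<phi> \<longleftrightarrow> i \<le> j"
      using op unfolding order_property_def by metis
    have neN: "univ N \<noteq> {}" using N by (simp add: is_model_def is_struct_def)
    define f where "f w = (let (i, v) = prod_decode w in if v < m then a i ! v else b i ! (v - m))" for w
    have "f ` set vs \<subseteq> univ N"
    proof
      fix x assume "x \<in> f ` set vs"
      then obtain i v where iv: "i < k" "v < m + n" "x = f (prod_encode (i, v))" by (auto simp: vs)
      show "x \<in> univ N"
      proof (cases "v < m")
        case True
        then have "x \<in> set (a i)" using iv ab by (simp add: f_def)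
        then show ?thesis using iv(1) ab by blast
      next
        case False
        then have "v - m < n" using iv by auto
        then have "x \<in> set (b i)" using False iv ab by (simp add: f_def)
        then show ?thesis using iv(1) ab by blast
      qed
    qed
    moreover have "sat N (mix m (\<lambda>v. f (prod_encode (i, v))) (\<lambda>v. f (prod_encode (j, v)))) \<phi> \<longleftrightarrow>
      sat N (\<lambda>v. (a i @ b j) ! v) \<phi>" if "i < k" "j < k" for i j
      using ab that by (intro sat_cong) (auto simp: mix_def f_def nth_append)
    ultimately have "sat N e \<sigma>" for e unfolding sat_\<sigma>[OF neN] using ord by blast
    moreover obtain d where "d \<in> univ N" using neN by blast
    moreover have "true_in N (Neg \<sigma>)" using N th by (simp add: is_model_def)
    ultimately show False unfolding true_in_def by (auto dest!: spec[of _ "\<lambda>_. d"])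
  qed
  then obtain f where f: "f ` set vs \<subseteq> univ S"
    "\<forall>i<k. \<forall>j<k. sat S (mix m (\<lambda>v. f (prod_encode (i, v))) (\<lambda>v. f (prod_encode (j, v)))) \<phi> \<longleftrightarrow> i \<le> j"
    unfolding sat_\<sigma>[OF ne] by blast
  obtain d where d: "d \<in> univ S" using ne by blast
  define c where "c i v = (if i < k \<and> v < m + n then f (prod_encode (i, v)) else d)" for i v
  have "sat S (mix m (c i) (c j)) \<phi> \<longleftrightarrow>
     sat S (mix m (\<lambda>v. f (prod_encode (i, v))) (\<lambda>v. f (prod_encode (j, v)))) \<phi>" if "i < k" "j < k" for i j
    using that fv by (intro sat_cong) (auto simp: mix_def c_def)
  moreover have "c i v \<in> univ S" for i v using f(1) d by (auto simp: c_def vs)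
  ultimately show ?thesis using f(2) by (intro exI[of _ c]) auto
qed

context reduced_prod
begin

lemma unstable_nonnormal:
  assumes at: "atomless_ideal I J" and unst: "unstable TYPE('u) L (theory_of L RP)"
  obtains \<eta> m n s s' t t' where "hfm \<eta>" "wf_fm L \<eta>" "fv \<eta> \<subseteq> {..<m + n}"
    "\<forall>v. s v \<in> PU" "\<forall>v. s' v \<in> PU" "\<forall>v. t v \<in> PU" "\<forall>v. t' v \<in> PU"
    "fails \<eta> (mix m s t) \<in> J" "fails \<eta> (mix m s t') \<in> J" "fails \<eta> (mix m s' t) \<in> J" "fails \<eta> (mix m s' t') \<notin> J"
proof -
  obtain \<phi> m n where \<phi>: "wf_fm L \<phi>" "fv \<phi> \<subseteq> {..<m + n}" "order_property TYPE('u) L (theory_of L RP) m n \<phi>"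
    using unst unfolding unstable_def by blast
  have "univ RP \<noteq> {}"
  proof -
    have "\<forall>i \<in> I. univ (M i) \<noteq> {}" using struct by (simp add: is_struct_def)
    then show ?thesis by (simp add: univ_RP product_univ_def PiE_eq_empty_iff)
  qed
  note tr = order_property_transfer[OF this \<phi>]
  have ord: "\<exists>c. (\<forall>i v. c i v \<in> PU) \<and>
      (\<forall>i<k. \<forall>j<k. sat RP (\<lambda>v. rcl (mix m (c i) (c j) v)) \<phi> \<longleftrightarrow> i \<le> (j::nat))" for k
  proof -
    obtain c where c: "\<forall>i v. c i v \<in> univ RP" "\<forall>i<k. \<forall>j<k. sat RP (mix m (c i) (c j)) \<phi> \<longleftrightarrow> i \<le> j"
      using tr[of k] by blast
    have "\<forall>i v. \<exists>x \<in> PU. rcl x = c i v" using c(1) unfolding univ_RP by blast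
    then obtain c' where c': "\<And>i v. c' i v \<in> PU" "\<And>i v. rcl (c' i v) = c i v" by metis
    have "(\<lambda>v. rcl (mix m (c' i) (c' j) v)) = mix m (c i) (c j)" for i j
      by (auto simp: mix_def fun_eq_iff c'(2))
    then show ?thesis using c(2) c'(1) by (intro exI[of _ c']) simp
  qed
  obtain \<eta> s s' t t' where h: "hfm \<eta>" "wf_fm L \<eta>" "fv \<eta> \<subseteq> fv \<phi>"
    and PU: "\<forall>v. s v \<in> PU" "\<forall>v. s' v \<in> PU" "\<forall>v. t v \<in> PU" "\<forall>v. t' v \<in> PU"
    and sat: "sat RP (\<lambda>v. rcl (mix m s t v)) \<eta>" "sat RP (\<lambda>v. rcl (mix m s t' v)) \<eta>"
    "sat RP (\<lambda>v. rcl (mix m s' t v)) \<eta>" "\<not> sat RP (\<lambda>v. rcl (mix m s' t' v)) \<eta>"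
    using nonnormal_hfm[OF at \<phi>(1) ord] by metis
  have los: "sat RP (\<lambda>v. rcl (mix m x y v)) \<eta> \<longleftrightarrow> fails \<eta> (mix m x y) \<in> J"
    if "\<forall>v. x v \<in> PU" "\<forall>v. y v \<in> PU" for x y
    by (rule sat_hfm[OF h(1,2)]) (use that in \<open>simp add: mix_def\<close>)
  show ?thesis
    using sat los PU h \<phi>(2) by (intro that[of \<eta> m n s s' t t']) auto
qed

lemma saturated_pow_quotient_if_saturated:
  assumes at: "atomless_ideal I J" and \<kappa>: "Card_order \<kappa>" "infinite (Field \<kappa>)" and saturated: "saturated \<kappa> L RP"
    and \<eta>: "hfm \<eta>" "wf_fm L \<eta>" "fv \<eta> \<subseteq> {..<m + n}"
    and all_PU: "\<forall>v. \<alpha> v \<in> PU" "\<forall>v. \<alpha>' v \<in> PU" "\<forall>v. \<beta> v \<in> PU" "\<forall>v. \<beta>' v \<in> PU"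
    and holds: "fails \<eta> (mix m \<alpha> \<beta>) \<in> J" "fails \<eta> (mix m \<alpha> \<beta>') \<in> J" "fails \<eta> (mix m \<alpha>' \<beta>) \<in> J"
    and A: "A = fails \<eta> (mix m \<alpha>' \<beta>')"
  shows "saturated \<kappa> ba_language (pow_quotient A (J \<inter> Pow A))"
proof -
  have AI: "A \<subseteq> I" by (auto simp: A fails_def)
  show ?thesis
    by (rule saturated_pow_quotient[OF ideal_on_restrict[OF ideal AI] atomless_ideal_restrict[OF at AI] \<kappa>
          saturated_lower_bound_and_separation[OF \<kappa> saturated \<eta> all_PU holds A]])
qed

end

theorem theorem3p1:
  fixes I :: "'i set" and J :: "'i set set" and \<kappa> :: "'k rel"
  assumes "ideal_on I J"
    and "atomless (pow_quotient I J)"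
    and "Card_order \<kappa>" and "infinite (Field \<kappa>)"
  shows
    "(\<not> saturated \<kappa> ba_language (pow_quotient I J) \<longrightarrow>
       (\<forall>(L :: ('f, 'p) language) (M :: ('f, 'p, 'a) fo_struct).
          countable_language L \<and> is_struct L M \<and>
          unstable TYPE('u) L (theory_of L (reduced_power I J M)) \<longrightarrow>
          \<not> saturated \<kappa> L (reduced_power I J M)))
     \<and>
     ((\<forall>A \<in> positive_sets I J.
          \<not> saturated \<kappa> ba_language (pow_quotient A (restrict_ideal J A))) \<longrightarrow>
       (\<forall>(L :: ('f, 'p) language) (M :: 'i \<Rightarrow> ('f, 'p, 'a) fo_struct).
          countable_language L \<and> (\<forall>i \<in> I. is_struct L (M i)) \<and>
          unstable TYPE('u) L (theory_of L (reduced_product I J M)) \<longrightarrow>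
          \<not> saturated \<kappa> L (reduced_product I J M)))"
proof (intro conjI impI allI notI)
  note at = atomless_ideal_pow_quotient[OF assms(1,2)]
  fix L :: "('f, 'p) language" and M :: "('f, 'p, 'a) fo_struct"
  assume nsat: "\<not> saturated \<kappa> ba_language (pow_quotient I J)"
    and LM: "countable_language L \<and> is_struct L M \<and> unstable TYPE('u) L (theory_of L (reduced_power I J M))"
    and saturated: "saturated \<kappa> L (reduced_power I J M)"
  interpret reduced_prod I J L "\<lambda>_. M" using assms(1) LM by unfold_locales blast+
  have unst: "unstable TYPE('u) L (theory_of L RP)" using LM unfolding reduced_power_def by blast
  obtain \<eta> m n s s' t t' where h: "hfm \<eta>" "wf_fm L \<eta>" "fv \<eta> \<subseteq> {..<m + n}"
    and PU: "\<forall>v. s v \<in> PU" "\<forall>v. s' v \<in> PU" "\<forall>v. t v \<in> PU" "\<forall>v. t' v \<in> PU"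
    and fails: "fails \<eta> (mix m s t) \<in> J" "fails \<eta> (mix m s t') \<in> J" "fails \<eta> (mix m s' t) \<in> J"
      "fails \<eta> (mix m s' t') \<notin> J"
    by (rule unstable_nonnormal[OF at unst]) (rule that)
  \<comment> \<open>A positive set is not contained in the union of three null sets; at any
    coordinate outside them normality fails in \<open>M\<close> itself.\<close>
  have "\<not> fails \<eta> (mix m s' t') \<subseteq> fails \<eta> (mix m s t) \<union> fails \<eta> (mix m s t') \<union> fails \<eta> (mix m s' t)"
    using ideal_onD(2)[OF assms(1) ideal_onD(3)[OF assms(1) ideal_onD(3)[OF assms(1) fails(1,2)] fails(3)]] fails(4)
    by blast
  then obtain i where i: "i \<in> fails \<eta> (mix m s' t')" "i \<notin> fails \<eta> (mix m s t)" "i \<notin> fails \<eta> (mix m s t')"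
    "i \<notin> fails \<eta> (mix m s' t)" by blast
  then have iI: "i \<in> I" by (simp add: fails_def)
  \<comment> \<open>The values at \<open>i\<close> are repeated at all coordinates. Each instance of
    \<open>\<eta>\<close> then holds everywhere or nowhere on \<open>I\<close>, so the set of
    failures becomes all of \<open>I\<close> and the saturated algebra is
    \<open>P(I)/J\<close>.\<close>
  define k where "k x v = (\<lambda>_ \<in> I. x v i)" for x :: "nat \<Rightarrow> 'i \<Rightarrow> 'a" and v
  have kPU: "\<forall>v. k x v \<in> PU" if "\<forall>v. x v \<in> PU" for x
    using PU_univ[OF that[rule_format] iI] unfolding k_def product_univ_def by auto
  have kfails: "fails \<eta> (mix m (k x) (k y)) = (if i \<in> fails \<eta> (mix m x y) then I else {})" for x y
  proof -
    have "(\<lambda>v. mix m (k x) (k y) v j) = (\<lambda>v. mix m x y v i)" if "j \<in> I" for j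
      using that by (auto simp: mix_def k_def)
    then show ?thesis using iI by (auto simp: fails_def)
  qed
  have "saturated \<kappa> ba_language (pow_quotient I (J \<inter> Pow I))"
    by (rule saturated_pow_quotient_if_saturated[OF at assms(3,4) saturated[unfolded reduced_power_def] h
          kPU[OF PU(1)] kPU[OF PU(2)] kPU[OF PU(3)] kPU[OF PU(4)]])
      (use i ideal_onD(1)[OF assms(1)] in \<open>simp_all add: kfails\<close>)
  moreover have "J \<inter> Pow I = J" using assms(1) by (auto simp: ideal_on_def)
  ultimately show False using nsat by simp
next
  note at = atomless_ideal_pow_quotient[OF assms(1,2)]
  fix L :: "('f, 'p) language" and M :: "'i \<Rightarrow> ('f, 'p, 'a) fo_struct"
  assume nsat: "\<forall>A \<in> positive_sets I J. \<not> saturated \<kappa> ba_language (pow_quotient A (restrict_ideal J A))"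
    and LM: "countable_language L \<and> (\<forall>i \<in> I. is_struct L (M i)) \<and>
      unstable TYPE('u) L (theory_of L (reduced_product I J M))"
    and saturated: "saturated \<kappa> L (reduced_product I J M)"
  interpret reduced_prod I J L M using assms(1) LM by unfold_locales blast+
  have unst: "unstable TYPE('u) L (theory_of L RP)" using LM by blast
  obtain \<eta> m n s s' t t' where h: "hfm \<eta>" "wf_fm L \<eta>" "fv \<eta> \<subseteq> {..<m + n}"
    and PU: "\<forall>v. s v \<in> PU" "\<forall>v. s' v \<in> PU" "\<forall>v. t v \<in> PU" "\<forall>v. t' v \<in> PU"
    and fails: "fails \<eta> (mix m s t) \<in> J" "fails \<eta> (mix m s t') \<in> J" "fails \<eta> (mix m s' t) \<in> J"
      "fails \<eta> (mix m s' t') \<notin> J"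
    by (rule unstable_nonnormal[OF at unst]) (rule that)
  \<comment> \<open>With varying factors a coordinate cannot be copied, so the conclusion is
    confined to the set where normality fails; its positivity is what the hypothesis needs.\<close>
  have "saturated \<kappa> ba_language (pow_quotient (fails \<eta> (mix m s' t')) (J \<inter> Pow (fails \<eta> (mix m s' t'))))"
    by (rule saturated_pow_quotient_if_saturated[OF at assms(3,4) saturated h
          PU fails(1-3) refl])
  moreover have "fails \<eta> (mix m s' t') \<in> positive_sets I J"
    using fails(4) by (auto simp: positive_sets_def fails_def)
  ultimately show False using nsat by (simp add: restrict_ideal_def)
qed

end
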